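(* Let $n,d$ be positive integers with $n\ge 4d^2$. For every $s\in[d]$ let $\boldsymbol{\xi}_s\colon[n]^s\times[n]^s\to\mathbb{R}$ be a Hoeffding tensor, and set $$\beta_s:=\sum_{i,p\in[n]^s}\boldsymbol{\xi}_s(i,p)^2.$$ Assume that $\beta_1=n-1$, and let $$W=\sum_{s=1}^d\ \sum_{i\in[n]^s_{\mathrm{Inj}}}\boldsymbol{\xi}_s(i,\pi\circ i)$$ where $\pi$ is a random permutation uniformly distributed on the symmetric group $\mathbb{S}_n$. Then $$d_K\big(W,\mathcal{N}(0,1)\big)\le\frac{2^{18}C_1}{n}\sum_{i,j=1}^n|\boldsymbol{\xi}_1(i,j)|^3+C_d\sum_{s=2}^d\sqrt{\frac{\beta_s}{n^s}}$$ where $C_1\ge1$ is the absolute constant of Bolthausen's theorem (see context) and the coefficient $C_d$ of the second sum is a positive constant that depends only on $d$; in fact, one can take $C_d=5d^2e^d(2d)!$.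
   Context: $[n]=\{1,\dots,n\}$; $[n]^s$ is the set of functions $[s]\to[n]$, and $[n]^s_{\mathrm{Inj}}$ the set of one-to-one ones. For $\pi\in\mathbb{S}_n$ and $i=(i_1,\dots,i_s)\in[n]^s$, $\pi\circ i=(\pi(i_1),\dots,\pi(i_s))$. A tensor $\boldsymbol{\xi}\colon[n]^s\times[n]^s\to\mathbb{R}$ is a Hoeffding tensor if for every $r\in[s]$, every $j_0,q_0\colon[s]\setminus\{r\}\to[n]$ and every $i_0,p_0\in[n]^s$ we have $\sum_i\boldsymbol{\xi}(i,p_0)=0$ and $\sum_p\boldsymbol{\xi}(i_0,p)=0$, where the first sum is over all $i\in[n]^s$ extending $j_0$ and the second over all $p\in[n]^s$ extending $q_0$ (that is, the tensor sums to zero in each single coordinate, the other coordinates being fixed). Bolthausen's constant $C_1\ge1$: an absolute constant such that for every $n\geq 2$ and every Hoeffding tensor $\boldsymbol{\xi}\colon[n]\times[n]\to\mathbb{R}$ with $\sum_{i,j}\boldsymbol{\xi}(i,j)^2=n-1$ one has $d_K\big(\sum_{i=1}^n\boldsymbol{\xi}(i,\pi(i)),\mathcal{N}(0,1)\big)\le\frac{C_1}{n}\sum_{i,j=1}^n|\boldsymbol{\xi}(i,j)|^3$, with $\pi$ uniform on $\mathbb{S}_n$. (This is a known theorem; it is known that $C_1=451$ works.) When $d=1$ the second sum in the claim is empty, so $C_1$ always refers to Bolthausen's constant. $d_K(X,Y):=\sup_{x\in\mathbb{R}}|\mathbb{P}(X\le x)-\mathbb{P}(Y\le x)|$. *)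

theory Defs
  imports "HOL-Probability.Probability" "HOL-Combinatorics.Permutations"
begin

text \<open>
  The set $[n]^s$ consists of the extensional functions from $[s]$ to $[n]$ (they have the value
  \<open>undefined\<close> outside $[s]$), so that equality of tuples is equality in HOL.
\<close>

definition tuples :: "nat \<Rightarrow> nat \<Rightarrow> (nat \<Rightarrow> nat) set" where
  "tuples n s = {1..s} \<rightarrow>\<^sub>E {1..n}"

definition inj_tuples :: "nat \<Rightarrow> nat \<Rightarrow> (nat \<Rightarrow> nat) set" where
  "inj_tuples n s = {i \<in> tuples n s. inj_on i {1..s}}"

text \<open>The identification of $[n]$ with $[n]^1$, used to read a tensor with $s = 1$ as a matrix.\<close>

definition singleton_tuple :: "nat \<Rightarrow> nat \<Rightarrow> nat" where
  "singleton_tuple k = (\<lambda>_\<in>{1..1}. k)"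

text \<open>Only the values of \<open>\<xi>\<close> on \<open>tuples n s \<times> tuples n s\<close> matter.\<close>

definition hoeffding_tensor ::
    "nat \<Rightarrow> nat \<Rightarrow> ((nat \<Rightarrow> nat) \<Rightarrow> (nat \<Rightarrow> nat) \<Rightarrow> real) \<Rightarrow> bool" where
  "hoeffding_tensor n s \<xi> \<longleftrightarrow>
    (\<forall>r\<in>{1..s}. \<forall>j0 \<in> ({1..s} - {r}) \<rightarrow>\<^sub>E {1..n}. \<forall>q0 \<in> ({1..s} - {r}) \<rightarrow>\<^sub>E {1..n}.
     \<forall>i0 \<in> tuples n s. \<forall>p0 \<in> tuples n s.
       (\<Sum>i\<in>{i \<in> tuples n s. \<forall>k\<in>{1..s} - {r}. i k = j0 k}. \<xi> i p0) = 0 \<and>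
       (\<Sum>p\<in>{p \<in> tuples n s. \<forall>k\<in>{1..s} - {r}. p k = q0 k}. \<xi> i0 p) = 0)"

definition tensor_beta ::
    "nat \<Rightarrow> nat \<Rightarrow> ((nat \<Rightarrow> nat) \<Rightarrow> (nat \<Rightarrow> nat) \<Rightarrow> real) \<Rightarrow> real" where
  "tensor_beta n s \<xi> = (\<Sum>i\<in>tuples n s. \<Sum>p\<in>tuples n s. (\<xi> i p)\<^sup>2)"

definition uniform_perm :: "nat \<Rightarrow> (nat \<Rightarrow> nat) pmf" where
  "uniform_perm n = pmf_of_set {\<pi>. \<pi> permutes {1..n}}"

definition kolmogorov_dist :: "real measure \<Rightarrow> real measure \<Rightarrow> real" where
  "kolmogorov_dist M N = (SUP x. \<bar>cdf M x - cdf N x\<bar>)"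

text \<open>
  Bolthausen's combinatorial central limit theorem states that some \<open>C1\<close> satisfies the following
  predicate.
\<close>

definition bolthausen_constant :: "real \<Rightarrow> bool" where
  "bolthausen_constant C1 \<longleftrightarrow> C1 \<ge> 1 \<and>
    (\<forall>n \<xi>. n \<ge> 2 \<longrightarrow> hoeffding_tensor n 1 \<xi> \<longrightarrow>
      (\<Sum>i=1..n. \<Sum>j=1..n. (\<xi> (singleton_tuple i) (singleton_tuple j))\<^sup>2) = real n - 1 \<longrightarrow>
      kolmogorov_dist
        (distr (uniform_perm n) borel
          (\<lambda>\<pi>. \<Sum>i=1..n. \<xi> (singleton_tuple i) (singleton_tuple (\<pi> i))))
        std_normal_distribution
      \<le> C1 / real n *
          (\<Sum>i=1..n. \<Sum>j=1..n. \<bar>\<xi> (singleton_tuple i) (singleton_tuple j)\<bar> ^ 3))"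

end

theory Submission
  imports Defs
begin

text \<open>
  Write \<open>W = T + \<Delta>\<close>, where \<open>T\<close> is the part with \<open>s = 1\<close>. Bolthausen's theorem handles \<open>T\<close>, and
  replacing \<open>T\<close> by \<open>W\<close> changes the distribution function at \<open>z\<close> by at most \<open>P(\<bar>T - z\<bar> \<le> \<bar>\<Delta>\<bar>)\<close>.
  A concentration inequality from Stein's method, for the exchangeable pair of \<open>\<pi>\<close> and its product
  \<open>\<pi>'\<close> with a random transposition and with the test function that clips \<open>T - z\<close> at level
  \<open>\<bar>\<Delta>\<bar> + \<delta>\<close>, bounds this probability by the cubic term plus multiples of
  \<open>E \<bar>T\<bar> \<bar>\<Delta>\<bar>\<close> and \<open>n E \<bar>T(\<pi>) - T(\<pi>')\<bar> \<bar>\<Delta>(\<pi>) - \<Delta>(\<pi>')\<bar>\<close>; truncating the squared increments of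
  \<open>T\<close> at \<open>\<delta>\<close> is what keeps fourth moments out. By Cauchy--Schwarz only the second moment and the
  Dirichlet form of each component of \<open>\<Delta>\<close> remain. Both expand into sums over pairs of injective
  tuples, grouped by the coincidence pattern of the pair. A coordinate that coincides with no other
  one can be summed out, and by the Hoeffding property this only produces patterns in which it
  collides with another coordinate; after all such collisions at most \<open>s\<close> free values are left,
  which gives the factor \<open>1 / n^s\<close>, at the cost of a factorial for the number of patterns.
\<close>

section \<open>Means over the symmetric group\<close>

text \<open>The obstacle is that the clipping level depends on the permutation through
  \<open>\<Delta>\<close>. Comparing the test function at \<open>\<pi>\<close> and
  \<open>\<pi>'\<close> also compares two levels; clipping is 1-Lipschitz in the level, so this
  costs just the increment of \<open>\<Delta>\<close>, and that is why a Dirichlet form is needed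
  next to the second moment. With \<open>\<gamma>\<close> the sum of the cubes, the truncation level
  is \<open>32 \<gamma> / n\<close>: the normalized truncated squares then keep at least 5/6 of
  their mean 1, and by Chebyshev's inequality they fall below 1/2 only with probability of order
  \<open>\<gamma> / n\<close>. If the level exceeds 1, the claimed bound exceeds 1. In the moments
  of \<open>\<Delta>\<close>, a pattern with \<open>u\<close> values is eliminated once in the row
  tuples and once in the column tuples, at the cost \<open>(u!)^2\<close>. This cost is charged to
  the realizations of the pattern over an alphabet of \<open>2 s\<close> letters, of which all
  patterns together have only \<open>((2 s)! / s!)^2\<close>. The hypothesis
  \<open>n \<ge> 4 d^2\<close> makes the number of tuples with a given pattern at least
  \<open>n^u / 2\<close>.\<close>

definition perm_mean :: "'v set \<Rightarrow> (('v \<Rightarrow> 'v) \<Rightarrow> real) \<Rightarrow> real" where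
  "perm_mean V f = (\<Sum>\<pi> | \<pi> permutes V. f \<pi>) / fact (card V)"

lemma perm_mean_const: "finite V \<Longrightarrow> perm_mean V (\<lambda>_. c) = c"
  by (simp add: perm_mean_def card_permutations)

lemma perm_mean_mono:
  "(\<And>\<pi>. \<pi> permutes V \<Longrightarrow> f \<pi> \<le> g \<pi>) \<Longrightarrow> perm_mean V f \<le> perm_mean V g"
  unfolding perm_mean_def by (intro divide_right_mono sum_mono) auto

lemma perm_mean_cong:
  "(\<And>\<pi>. \<pi> permutes V \<Longrightarrow> f \<pi> = g \<pi>) \<Longrightarrow> perm_mean V f = perm_mean V g"
  unfolding perm_mean_def by (metis (mono_tags, lifting) mem_Collect_eq sum.cong)

lemma perm_mean_sum: "perm_mean V (\<lambda>\<pi>. \<Sum>i\<in>A. f i \<pi>) = (\<Sum>i\<in>A. perm_mean V (f i))"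
  unfolding perm_mean_def by (subst sum.swap) (simp add: sum_divide_distrib)

lemma perm_mean_add: "perm_mean V (\<lambda>\<pi>. f \<pi> + g \<pi>) = perm_mean V f + perm_mean V g"
  by (simp add: perm_mean_def sum.distrib add_divide_distrib)

lemma perm_mean_diff: "perm_mean V (\<lambda>\<pi>. f \<pi> - g \<pi>) = perm_mean V f - perm_mean V g"
  by (simp add: perm_mean_def sum_subtractf diff_divide_distrib)

lemma perm_mean_abs_diff_le:
  assumes "\<And>\<pi>. \<bar>f \<pi> - g \<pi>\<bar> \<le> h \<pi>"
  shows "\<bar>perm_mean V f - perm_mean V g\<bar> \<le> perm_mean V h"
proof -
  have "f \<pi> \<le> g \<pi> + h \<pi>" "g \<pi> \<le> f \<pi> + h \<pi>" for \<pi> using assms[of \<pi>] by linarith+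
  then have "perm_mean V f \<le> perm_mean V (\<lambda>\<pi>. g \<pi> + h \<pi>)" "perm_mean V g \<le> perm_mean V (\<lambda>\<pi>. f \<pi> + h \<pi>)"
    by (auto intro: perm_mean_mono)
  then show ?thesis unfolding perm_mean_add by linarith
qed

lemma perm_mean_cmult: "perm_mean V (\<lambda>\<pi>. c * f \<pi>) = c * perm_mean V f"
  by (simp add: perm_mean_def sum_distrib_left)

lemma perm_mean_compose_right:
  "\<sigma> permutes V \<Longrightarrow> perm_mean V (\<lambda>\<pi>. f (\<pi> \<circ> \<sigma>)) = perm_mean V f"
  unfolding perm_mean_def by (subst (2) sum_permutations_compose_right) auto

text \<open>The inequality on the product of the symmetric group with \<open>E\<close>. A one-point
  \<open>E\<close> serves plain second moments, the set of all index pairs serves the Dirichlet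
  form.\<close>

lemma perm_mean_Cauchy_Schwarz:
  "perm_mean V (\<lambda>\<pi>. \<Sum>e\<in>E. \<bar>f e \<pi>\<bar> * \<bar>g e \<pi>\<bar>)
    \<le> sqrt (perm_mean V (\<lambda>\<pi>. \<Sum>e\<in>E. (f e \<pi>)\<^sup>2)) * sqrt (perm_mean V (\<lambda>\<pi>. \<Sum>e\<in>E. (g e \<pi>)\<^sup>2))"
proof -
  let ?P = "{\<pi>. \<pi> permutes V}"
  have "(\<Sum>\<pi>\<in>?P. \<Sum>e\<in>E. \<bar>f e \<pi>\<bar> * \<bar>g e \<pi>\<bar>)
      \<le> L2_set (\<lambda>(\<pi>, e). f e \<pi>) (?P \<times> E) * L2_set (\<lambda>(\<pi>, e). g e \<pi>) (?P \<times> E)"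
    using L2_set_mult_ineq[of "\<lambda>(\<pi>, e). f e \<pi>" "\<lambda>(\<pi>, e). g e \<pi>" "?P \<times> E"]
    by (simp add: sum.cartesian_product case_prod_unfold)
  also have "\<dots> = sqrt (\<Sum>\<pi>\<in>?P. \<Sum>e\<in>E. (f e \<pi>)\<^sup>2) * sqrt (\<Sum>\<pi>\<in>?P. \<Sum>e\<in>E. (g e \<pi>)\<^sup>2)"
    by (simp add: L2_set_def sum.cartesian_product case_prod_unfold)
  finally show ?thesis
    unfolding perm_mean_def real_sqrt_divide
    by (simp add: divide_simps)
qed

section \<open>Permutations with prescribed values\<close>

lemma permutes_extend:
  assumes "finite V" "A \<subseteq> V" "inj_on f A" "f ` A \<subseteq> V"
  obtains \<pi> where "\<pi> permutes V" "\<And>a. a \<in> A \<Longrightarrow> \<pi> a = f a"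
proof -
  have "card (V - A) = card (V - f ` A)"
    using assms by (metis card_Diff_subset card_image finite_subset finite_imageI)
  then obtain h where h: "bij_betw h (V - A) (V - f ` A)"
    using assms(1) finite_same_card_bij[of "V - A" "V - f ` A"] by auto
  define \<pi> where "\<pi> v = (if v \<in> A then f v else if v \<in> V then h v else v)" for v
  have "bij_betw \<pi> (A \<union> (V - A)) (f ` A \<union> (V - f ` A))"
  proof (rule bij_betw_combine)
    show "bij_betw \<pi> A (f ` A)"
      using assms(3) by (auto simp: bij_betw_def \<pi>_def inj_on_def)
    show "bij_betw \<pi> (V - A) (V - f ` A)"
      using h by (subst bij_betw_cong[of _ _ h]) (auto simp: \<pi>_def)
  qed auto
  moreover have "A \<union> (V - A) = V" "f ` A \<union> (V - f ` A) = V" using assms by auto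
  ultimately have "\<pi> permutes V"
    using assms by (intro bij_imp_permutes) (auto simp: \<pi>_def)
  then show ?thesis using that by (simp add: \<pi>_def)
qed

lemma card_permutes_extending:
  assumes "finite V" "A \<subseteq> V" "inj_on f A" "f ` A \<subseteq> V"
  shows "card {\<pi>. \<pi> permutes V \<and> (\<forall>a\<in>A. \<pi> a = f a)} = fact (card V - card A)"
proof -
  obtain \<rho> where \<rho>: "\<rho> permutes V" "\<And>a. a \<in> A \<Longrightarrow> \<rho> a = f a"
    using permutes_extend[OF assms] by blast
  \<comment> \<open>The permutations that agree with \<open>\<rho>\<close> on \<open>A\<close> form
    a coset of the pointwise stabilizer of \<open>A\<close>.\<close>
  have "{\<pi>. \<pi> permutes V \<and> (\<forall>a\<in>A. \<pi> a = f a)} = (\<lambda>\<sigma>. \<rho> \<circ> \<sigma>) ` {\<sigma>. \<sigma> permutes (V - A)}"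
    (is "?L = ?R")
  proof (intro equalityI subsetI)
    fix \<pi> assume "\<pi> \<in> ?L"
    then have \<pi>: "\<pi> permutes V" "\<And>a. a \<in> A \<Longrightarrow> \<pi> a = f a" by auto
    have "inv \<rho> \<circ> \<pi> permutes V"
      using \<pi>(1) \<rho>(1) by (simp add: permutes_compose permutes_inv)
    moreover have "(inv \<rho> \<circ> \<pi>) a = a" if "a \<in> A" for a
      using \<pi>(2)[OF that] \<rho>(2)[OF that] permutes_inverses(2)[OF \<rho>(1), of a] by simp
    ultimately have "inv \<rho> \<circ> \<pi> permutes (V - A)"
 using permutes_superset[of "inv \<rho> \<circ> \<pi>" V "V - A"] by blast
    moreover have "\<pi> = \<rho> \<circ> (inv \<rho> \<circ> \<pi>)"
      using \<rho>(1) by (auto simp: fun_eq_iff permutes_inverses)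
    ultimately show "\<pi> \<in> ?R" by blast
  next
    fix \<pi> assume "\<pi> \<in> ?R"
    then obtain \<sigma> where \<sigma>: "\<pi> = \<rho> \<circ> \<sigma>" "\<sigma> permutes (V - A)" by auto
    have "\<sigma> permutes V" using \<sigma>(2) by (rule permutes_subset) auto
    moreover have "\<sigma> a = a" if "a \<in> A" for a
      using \<sigma>(2) that by (simp add: permutes_def)
    ultimately show "\<pi> \<in> ?L" using \<sigma>(1) \<rho> by (auto simp: permutes_compose)
  qed
  moreover have "inj_on (\<lambda>\<sigma>. \<rho> \<circ> \<sigma>) {\<sigma>. \<sigma> permutes (V - A)}"
    using permutes_inj[OF \<rho>(1)] by (auto intro!: inj_onI ext simp: fun_eq_iff inj_eq)
  ultimately show ?thesis
    using assms finite_subset[OF assms(2,1)]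
    by (simp add: card_image card_permutations card_Diff_subset)
qed

lemma permutes_image_mem: "\<pi> permutes V \<Longrightarrow> v \<in> V \<Longrightarrow> \<pi> v \<in> V"
  by (simp add: permutes_in_image)

text \<open>The pair \<open>(\<pi> I, \<pi> J)\<close> is uniform on pairs of distinct values; since
  \<open>F\<close> vanishes on the diagonal, the sum may run over all pairs.\<close>

lemma perm_mean_two:
  assumes V: "finite V" and I: "I \<in> V" "J \<in> V" "I \<noteq> J" and F: "\<And>p. F p p = 0"
  shows "perm_mean V (\<lambda>\<pi>. F (\<pi> I) (\<pi> J))
    = (\<Sum>p\<in>V. \<Sum>q\<in>V. F p q) / (real (card V) * (real (card V) - 1))"
proof -
  let ?P = "{\<pi>. \<pi> permutes V}"
  have fin: "finite ?P" using V by (rule finite_permutations)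
  have "card {I, J} \<le> card V" using I V by (intro card_mono) auto
  then have n2: "card V \<ge> 2" using I by simp
  have "(\<Sum>\<pi>\<in>?P. F (\<pi> I) (\<pi> J))
      = (\<Sum>pq\<in>V \<times> V. \<Sum>\<pi> | \<pi> \<in> ?P \<and> (\<pi> I, \<pi> J) = pq. F (\<pi> I) (\<pi> J))"
    using V I fin by (intro sum.group[symmetric]) (auto simp: permutes_image_mem)
  also have "\<dots> = (\<Sum>(p, q)\<in>V \<times> V. fact (card V - 2) * F p q)"
  proof (intro sum.cong refl)
    fix e assume "e \<in> V \<times> V"
    then obtain p q where pq: "e = (p, q)" "p \<in> V" "q \<in> V" by blast
    have "(\<Sum>\<pi> | \<pi> permutes V \<and> \<pi> I = p \<and> \<pi> J = q. F (\<pi> I) (\<pi> J))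
        = real (card {\<pi>. \<pi> permutes V \<and> \<pi> I = p \<and> \<pi> J = q}) * F p q"
      by simp
    also have "\<dots> = fact (card V - 2) * F p q"
    proof (cases "p = q")
      case False
      have "card {\<pi>. \<pi> permutes V \<and> (\<forall>a\<in>{I, J}. \<pi> a = (if a = I then p else q))}
          = fact (card V - card {I, J})"
        using V I pq False by (intro card_permutes_extending) (auto simp: inj_on_def)
      moreover have "{\<pi>. \<pi> permutes V \<and> (\<forall>a\<in>{I, J}. \<pi> a = (if a = I then p else q))}
          = {\<pi>. \<pi> permutes V \<and> \<pi> I = p \<and> \<pi> J = q}"
        using I(3) by auto
      ultimately show ?thesis using I(3) by (simp add: numeral_2_eq_2)
    qed (simp add: F)
    finally show "(\<Sum>\<pi> | \<pi> \<in> ?P \<and> (\<pi> I, \<pi> J) = e. F (\<pi> I) (\<pi> J))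
      = (case e of (p, q) \<Rightarrow> fact (card V - 2) * F p q)"
      by (simp add: pq(1))
  qed
  also have "\<dots> = fact (card V - 2) * (\<Sum>p\<in>V. \<Sum>q\<in>V. F p q)"
    by (simp add: sum.cartesian_product sum_distrib_left case_prod_unfold)
  finally have s: "(\<Sum>\<pi>\<in>?P. F (\<pi> I) (\<pi> J)) = fact (card V - 2) * (\<Sum>p\<in>V. \<Sum>q\<in>V. F p q)" .
  obtain m where m: "card V = Suc (Suc m)" using n2 by (metis add_2_eq_Suc le_Suc_ex)
  have "fact (card V) = (real (card V) * (real (card V) - 1)) * fact (card V - 2)"
    by (simp add: m)
  then show ?thesis
    unfolding perm_mean_def s by simp
qed

text \<open>The four values are a uniform quadruple of distinct elements. Nonnegativity of
  \<open>F\<close> allows quadruples with repetitions to be added, hence only an inequality.\<close>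

lemma perm_mean_four_le:
  assumes V: "finite V" and I: "{I, J, K, L} \<subseteq> V" "card {I, J, K, L} = 4"
    and F: "\<And>p q r s. 0 \<le> F p q r s"
  shows "perm_mean V (\<lambda>\<pi>. F (\<pi> I) (\<pi> J) (\<pi> K) (\<pi> L))
    \<le> fact (card V - 4) / fact (card V) * (\<Sum>p\<in>V. \<Sum>q\<in>V. \<Sum>r\<in>V. \<Sum>s\<in>V. F p q r s)"
proof -
  let ?P = "{\<pi>. \<pi> permutes V}"
  have fin: "finite ?P" using V by (rule finite_permutations)
  have dist: "distinct [I, J, K, L]" using I(2) by (intro card_distinct) simp
  have "(\<Sum>\<pi>\<in>?P. F (\<pi> I) (\<pi> J) (\<pi> K) (\<pi> L))
      = (\<Sum>pq\<in>V \<times> V \<times> V \<times> V. \<Sum>\<pi> | \<pi> \<in> ?P \<and> (\<pi> I, \<pi> J, \<pi> K, \<pi> L) = pq. F (\<pi> I) (\<pi> J) (\<pi> K) (\<pi> L))"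
    using V I fin by (intro sum.group[symmetric]) (auto simp: permutes_image_mem)
  also have "\<dots> \<le> (\<Sum>(p, q, r, s)\<in>V \<times> V \<times> V \<times> V. fact (card V - 4) * F p q r s)"
  proof (intro sum_mono)
    fix e assume "e \<in> V \<times> V \<times> V \<times> V"
    then obtain p q r s where e: "e = (p, q, r, s)" and pq: "p \<in> V" "q \<in> V" "r \<in> V" "s \<in> V"
      by blast
    let ?S = "{\<pi>. \<pi> permutes V \<and> \<pi> I = p \<and> \<pi> J = q \<and> \<pi> K = r \<and> \<pi> L = s}"
    have "card ?S \<le> fact (card V - 4)"
    proof (cases "?S = {}")
      case False
      then obtain \<rho> where \<rho>: "\<rho> permutes V" "\<rho> I = p" "\<rho> J = q" "\<rho> K = r" "\<rho> L = s" by auto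
      have "card {\<pi>. \<pi> permutes V \<and> (\<forall>a\<in>{I, J, K, L}. \<pi> a = \<rho> a)}
          = fact (card V - card {I, J, K, L})"
        using V I \<rho> pq inj_on_subset[OF permutes_inj[OF \<rho>(1)]]
        by (intro card_permutes_extending) auto
      moreover have "{\<pi>. \<pi> permutes V \<and> (\<forall>a\<in>{I, J, K, L}. \<pi> a = \<rho> a)} = ?S"
        using \<rho> by auto
      ultimately show ?thesis using I(2) by simp
    next
      case True
      then show ?thesis by (simp only: card.empty)
    qed
    then have "real (card ?S) * F p q r s \<le> fact (card V - 4) * F p q r s"
      using F[of p q r s] of_nat_mono[of "card ?S" "fact (card V - 4)", where 'a = real]
      by (intro mult_right_mono) simp_all
    moreover have "(\<Sum>\<pi> | \<pi> \<in> ?P \<and> (\<pi> I, \<pi> J, \<pi> K, \<pi> L) = e. F (\<pi> I) (\<pi> J) (\<pi> K) (\<pi> L))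
        = (\<Sum>\<pi>\<in>?S. F p q r s)"
      by (rule sum.cong) (auto simp: e)
    ultimately show "(\<Sum>\<pi> | \<pi> \<in> ?P \<and> (\<pi> I, \<pi> J, \<pi> K, \<pi> L) = e. F (\<pi> I) (\<pi> J) (\<pi> K) (\<pi> L))
        \<le> (case e of (p, q, r, s) \<Rightarrow> fact (card V - 4) * F p q r s)"
      by (simp add: e)
  qed
  also have "\<dots> = fact (card V - 4) * (\<Sum>p\<in>V. \<Sum>q\<in>V. \<Sum>r\<in>V. \<Sum>s\<in>V. F p q r s)"
    by (simp add: sum.cartesian_product sum_distrib_left case_prod_unfold)
  finally show ?thesis
    unfolding perm_mean_def by (simp add: divide_right_mono)
qed

section \<open>Kernel classes of tuples\<close>

text \<open>Only the coincidences of the pattern \<open>x0\<close> matter, not its values.\<close>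

definition kernel_class :: "'a set \<Rightarrow> 'v set \<Rightarrow> ('a \<Rightarrow> 'w) \<Rightarrow> ('a \<Rightarrow> 'v) set" where
  "kernel_class X V x0 = {x \<in> X \<rightarrow>\<^sub>E V. \<forall>a\<in>X. \<forall>b\<in>X. x a = x b \<longleftrightarrow> x0 a = x0 b}"

lemma kernel_class_iff:
  "x \<in> kernel_class X V x0 \<longleftrightarrow>
    x \<in> X \<rightarrow>\<^sub>E V \<and> (\<forall>a\<in>X. \<forall>b\<in>X. x a = x b \<longleftrightarrow> x0 a = x0 b)"
  by (simp add: kernel_class_def)

lemma finite_kernel_class [simp]: "finite X \<Longrightarrow> finite V \<Longrightarrow> finite (kernel_class X V x0)"
  by (auto simp: kernel_class_def intro: finite_subset[OF _ finite_PiE[of X "\<lambda>_. V"]])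

lemma kernel_class_refl: "x \<in> X \<rightarrow>\<^sub>E V \<Longrightarrow> x \<in> kernel_class X V x"
  by (simp add: kernel_class_iff)

lemma kernel_class_eq: "x \<in> kernel_class X V x0 \<Longrightarrow> kernel_class X W x = kernel_class X W x0"
  by (auto simp: kernel_class_def)

lemma kernel_class_card_image:
  assumes "x \<in> kernel_class X V x0"
  shows "card (x ` X) = card (x0 ` X)"
proof -
  have "bij_betw (\<lambda>v. x0 (inv_into X x v)) (x ` X) (x0 ` X)"
  proof (rule bij_betwI')
    fix v w assume vw: "v \<in> x ` X" "w \<in> x ` X"
    then have "inv_into X x v \<in> X" "inv_into X x w \<in> X"
      "x (inv_into X x v) = v" "x (inv_into X x w) = w"
      by (auto simp: inv_into_into f_inv_into_f)
    with assms show "(x0 (inv_into X x v) = x0 (inv_into X x w)) = (v = w)"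
      by (metis kernel_class_iff)
  next
    fix v assume "v \<in> x ` X"
    then show "x0 (inv_into X x v) \<in> x0 ` X" by (simp add: inv_into_into)
  next
    fix u assume "u \<in> x0 ` X"
    then obtain a where a: "a \<in> X" "u = x0 a" by blast
    then have "inv_into X x (x a) \<in> X" "x (inv_into X x (x a)) = x a"
      by (auto simp: inv_into_into f_inv_into_f)
    with assms a have "u = x0 (inv_into X x (x a))" by (metis kernel_class_iff)
    with a show "\<exists>v\<in>x ` X. u = x0 (inv_into X x v)" by blast
  qed
  then show ?thesis by (rule bij_betw_same_card)
qed

text \<open>Tuples with the same coincidences lie in one orbit of the symmetric group: sending
  values of \<open>x0\<close> to those of \<open>y\<close> is a partial injection, which
  extends.\<close>

lemma kernel_class_permutes:
  assumes X: "finite X" and V: "finite V" and x0: "x0 \<in> X \<rightarrow> V" and y: "y \<in> kernel_class X V x0"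
  obtains \<rho> where "\<rho> permutes V" "\<And>a. a \<in> X \<Longrightarrow> y a = \<rho> (x0 a)"
proof -
  define f where "f v = y (inv_into X x0 v)" for v
  have f: "f (x0 a) = y a" if "a \<in> X" for a
  proof -
    have "inv_into X x0 (x0 a) \<in> X" "x0 (inv_into X x0 (x0 a)) = x0 a"
      using that by (auto simp: inv_into_into f_inv_into_f)
    with y that show ?thesis by (auto simp: f_def kernel_class_iff)
  qed
  have "x0 ` X \<subseteq> V" using x0 by auto
  moreover have "inj_on f (x0 ` X)" using f y by (auto simp: inj_on_def kernel_class_iff)
  moreover have "f ` x0 ` X \<subseteq> V" using f y by (auto simp: kernel_class_iff)
  ultimately obtain \<rho> where \<rho>: "\<rho> permutes V" "\<And>v. v \<in> x0 ` X \<Longrightarrow> \<rho> v = f v"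
    using permutes_extend[OF V] by metis
  with f show ?thesis by (intro that[of \<rho>]) auto
qed

text \<open>Composition with all permutations hits every member of the class equally often, namely
  by the permutations prescribed on the image of \<open>x0\<close>.\<close>

lemma sum_perm_kernel_class:
  fixes F :: "('a \<Rightarrow> 'v) \<Rightarrow> real"
  assumes X: "finite X" and V: "finite V" and x0: "x0 \<in> X \<rightarrow> V"
  shows "(\<Sum>\<pi> | \<pi> permutes V. F (\<lambda>a\<in>X. \<pi> (x0 a)))
    = fact (card V - card (x0 ` X)) * (\<Sum>y\<in>kernel_class X V x0. F y)"
proof -
  let ?P = "{\<pi>. \<pi> permutes V}" and ?r = "\<lambda>\<pi>. \<lambda>a\<in>X. \<pi> (x0 a)"
  have K: "?r \<pi> \<in> kernel_class X V x0" if "\<pi> permutes V" for \<pi>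
    using that x0 permutes_inj[OF that]
    by (auto simp: kernel_class_iff permutes_in_image Pi_iff inj_eq)
  have "(\<Sum>\<pi>\<in>?P. F (?r \<pi>)) = (\<Sum>y\<in>kernel_class X V x0. \<Sum>\<pi> | \<pi> \<in> ?P \<and> ?r \<pi> = y. F (?r \<pi>))"
    using X V K by (intro sum.group[symmetric]) (auto simp: finite_permutations)
  also have "\<dots> = (\<Sum>y\<in>kernel_class X V x0. fact (card V - card (x0 ` X)) * F y)"
  proof (intro sum.cong refl)
    fix y assume y: "y \<in> kernel_class X V x0"
    then obtain \<rho> where \<rho>: "\<rho> permutes V" "\<And>a. a \<in> X \<Longrightarrow> y a = \<rho> (x0 a)"
      using kernel_class_permutes[OF X V x0] by blast
    have "{\<pi>. \<pi> \<in> ?P \<and> ?r \<pi> = y} = {\<pi>. \<pi> permutes V \<and> (\<forall>v\<in>x0 ` X. \<pi> v = \<rho> v)}"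
      using y \<rho>(2) by (auto simp: kernel_class_iff PiE_iff fun_eq_iff extensional_def)
    moreover have "card {\<pi>. \<pi> permutes V \<and> (\<forall>v\<in>x0 ` X. \<pi> v = \<rho> v)}
        = fact (card V - card (x0 ` X))"
      using x0 \<rho>(1) inj_on_subset[OF permutes_inj[OF \<rho>(1)]]
      by (intro card_permutes_extending V) (auto simp: permutes_in_image)
    ultimately have c: "card {\<pi>. \<pi> \<in> ?P \<and> ?r \<pi> = y} = fact (card V - card (x0 ` X))"
      by (simp only:)
    have "(\<Sum>\<pi> | \<pi> \<in> ?P \<and> ?r \<pi> = y. F (?r \<pi>)) = (\<Sum>\<pi> | \<pi> \<in> ?P \<and> ?r \<pi> = y. F y)"
      by (rule sum.cong) auto
    also have "\<dots> = real (card {\<pi>. \<pi> \<in> ?P \<and> ?r \<pi> = y}) * F y"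
      by (simp only: sum_constant)
    finally show "(\<Sum>\<pi> | \<pi> \<in> ?P \<and> ?r \<pi> = y. F (?r \<pi>)) = fact (card V - card (x0 ` X)) * F y"
      unfolding c by simp
  qed
  finally show ?thesis by (simp add: sum_distrib_left)
qed

lemma card_kernel_class:
  assumes X: "finite X" and V: "finite V" and x0: "card (x0 ` X) \<le> card V"
  shows "card (kernel_class X V x0) * fact (card V - card (x0 ` X)) = fact (card V)"
proof -
  \<comment> \<open>The pattern may take values outside \<open>V\<close>; \<open>h\<close> copies it
    into \<open>V\<close>, where the permutations can be counted by their action on the
    copy.\<close>
  obtain h where h: "h ` (x0 ` X) \<subseteq> V" "inj_on h (x0 ` X)"
    using card_le_inj[of "x0 ` X" V] X V x0 by auto
  define x where "x = (\<lambda>a\<in>X. h (x0 a))"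
  have x: "x \<in> X \<rightarrow>\<^sub>E V" "x \<in> kernel_class X V x0"
    using h by (auto simp: x_def kernel_class_iff inj_on_def)
  have "(\<Sum>\<pi> | \<pi> permutes V. 1::real)
      = fact (card V - card (x ` X)) * (\<Sum>y\<in>kernel_class X V x. 1)"
    using sum_perm_kernel_class[OF X V, of x "\<lambda>_. 1"] x(1) by auto
  then have "fact (card V) = fact (card V - card (x0 ` X)) * real (card (kernel_class X V x0))"
    using V kernel_class_card_image[OF x(2)] kernel_class_eq[OF x(2), of V]
    by (simp add: card_permutations)
  then have "real (card (kernel_class X V x0) * fact (card V - card (x0 ` X))) = real (fact (card V))"
    by (simp add: mult.commute)
  then show ?thesis using of_nat_eq_iff by blast
qed

lemma perm_mean_kernel_class:
  assumes X: "finite X" and V: "finite V" and x0: "x0 \<in> X \<rightarrow> V"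
  shows "perm_mean V (\<lambda>\<pi>. F (\<lambda>a\<in>X. \<pi> (x0 a)))
    = (\<Sum>y\<in>kernel_class X V x0. F y) / card (kernel_class X V x0)"
proof -
  have "card (x0 ` X) \<le> card V" using x0 V by (intro card_mono) auto
  from card_kernel_class[OF X V this]
  have c: "real (card (kernel_class X V x0)) * fact (card V - card (x0 ` X)) = fact (card V)"
    by (metis of_nat_fact of_nat_mult)
  then have "card (kernel_class X V x0) \<noteq> 0"
    by (metis fact_nonzero mult_zero_left of_nat_0)
  then show ?thesis
    unfolding perm_mean_def sum_perm_kernel_class[OF assms] c[symmetric] by simp
qed

text \<open>
  Summing \<open>F\<close> over all values of the isolated coordinate \<open>c\<close> gives zero, so the sum over the values
  that avoid the other coordinates is minus the sum over the collisions with them.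
\<close>

lemma kernel_class_eliminate:
  fixes F :: "('a \<Rightarrow> 'v) \<Rightarrow> real"
  assumes X: "finite X" and V: "finite V" and c: "c \<in> X"
    and single: "\<And>b. b \<in> X - {c} \<Longrightarrow> x0 b \<noteq> x0 c"
    and zero: "\<And>x. x \<in> (X - {c}) \<rightarrow>\<^sub>E V \<Longrightarrow> (\<Sum>v\<in>V. F (x(c := v))) = 0"
  shows "(\<Sum>x\<in>kernel_class X V x0. F x)
    = - (\<Sum>w\<in>x0 ` (X - {c}). \<Sum>x\<in>kernel_class X V (x0(c := w)). F x)"
proof -
  \<comment> \<open>\<open>U\<close> leaves the value at \<open>c\<close> free. It is the disjoint
    union of the class of \<open>x0\<close> and of the classes in which \<open>c\<close> collides
    with another coordinate.\<close>
  define U where "U = {x \<in> X \<rightarrow>\<^sub>E V. \<forall>a\<in>X - {c}. \<forall>b\<in>X - {c}. x a = x b \<longleftrightarrow> x0 a = x0 b}"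
  define R where "R = kernel_class (X - {c}) V x0"
  let ?K = "\<lambda>w. kernel_class X V (x0(c := w))" and ?W = "x0 ` (X - {c})"
  have finU: "finite U"
    using X V by (auto simp: U_def intro: finite_subset[OF _ finite_PiE[of X "\<lambda>_. V"]])
  have "(\<Sum>x\<in>U. F x) = (\<Sum>(x, v)\<in>R \<times> V. F (x(c := v)))"
  proof (rule sum.reindex_bij_witness[where i = "\<lambda>(x, v). x(c := v)"
        and j = "\<lambda>x. (restrict x (X - {c}), x c)"])
    fix x assume "x \<in> U"
    then have x: "x \<in> X \<rightarrow>\<^sub>E V" "\<forall>a\<in>X - {c}. \<forall>b\<in>X - {c}. x a = x b \<longleftrightarrow> x0 a = x0 b"
      by (auto simp: U_def)
    show "(restrict x (X - {c}), x c) \<in> R \<times> V"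
      using x c by (auto simp: R_def kernel_class_iff)
    show eq: "(case (restrict x (X - {c}), x c) of (x, v) \<Rightarrow> x(c := v)) = x"
      using x c by (auto simp: fun_eq_iff PiE_iff extensional_def)
    show "(case (restrict x (X - {c}), x c) of (x, v) \<Rightarrow> F (x(c := v))) = F x"
      using eq by simp
  next
    fix e assume "e \<in> R \<times> V"
    then obtain x v where e: "e = (x, v)" "x \<in> R" "v \<in> V" by blast
    then have x: "x \<in> (X - {c}) \<rightarrow>\<^sub>E V" by (auto simp: R_def kernel_class_iff)
    show "(restrict (case e of (x, v) \<Rightarrow> x(c := v)) (X - {c}), (case e of (x, v) \<Rightarrow> x(c := v)) c) = e"
      using x e by (auto simp: fun_eq_iff PiE_iff extensional_def restrict_def)
    show "(case e of (x, v) \<Rightarrow> x(c := v)) \<in> U"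
      using x e c by (auto simp: U_def R_def kernel_class_iff PiE_iff extensional_def)
  qed
  also have "\<dots> = (\<Sum>x\<in>R. \<Sum>v\<in>V. F (x(c := v)))"
    by (simp add: sum.cartesian_product)
  also have "\<dots> = 0"
    using zero by (intro sum.neutral) (auto simp: R_def kernel_class_iff)
  finally have U0: "(\<Sum>x\<in>U. F x) = 0" .
  have "U = kernel_class X V x0 \<union> (\<Union>w\<in>?W. ?K w)"
  proof (intro equalityI subsetI)
    fix x assume x: "x \<in> U"
    show "x \<in> kernel_class X V x0 \<union> (\<Union>w\<in>?W. ?K w)"
    proof (cases "\<exists>b\<in>X - {c}. x c = x b")
      case True
      then obtain b where b: "b \<in> X - {c}" "x c = x b" by blast
      with x have "x \<in> ?K (x0 b)" by (auto simp: U_def kernel_class_iff)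
      with b show ?thesis by blast
    next
      case False
      then have "x \<in> kernel_class X V x0"
        using x single by (auto simp: U_def kernel_class_iff) (metis DiffI singletonD)+
      then show ?thesis by blast
    qed
  next
    fix x assume "x \<in> kernel_class X V x0 \<union> (\<Union>w\<in>?W. ?K w)"
    then show "x \<in> U" by (auto simp: U_def kernel_class_iff)
  qed
  moreover have "kernel_class X V x0 \<inter> (\<Union>w\<in>?W. ?K w) = {}"
  proof (intro equals0I, elim IntE UN_E imageE)
    fix x w b
    assume x: "x \<in> kernel_class X V x0" "x \<in> ?K w" and b: "w = x0 b" "b \<in> X - {c}"
    have "x c = x b" using x(2) b c by (auto simp: kernel_class_iff)
    then have "x0 c = x0 b" using x(1) b c by (auto simp: kernel_class_iff)
    then show False using single[OF b(2)] by simp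
  qed
  ultimately have "(\<Sum>x\<in>U. F x) = (\<Sum>x\<in>kernel_class X V x0. F x) + (\<Sum>x\<in>(\<Union>w\<in>?W. ?K w). F x)"
    using X V by (simp add: sum.union_disjoint)
  also have "(\<Sum>x\<in>(\<Union>w\<in>?W. ?K w). F x) = (\<Sum>w\<in>?W. \<Sum>x\<in>?K w. F x)"
  proof (rule sum.UNION_disjoint)
    show "\<forall>w\<in>?W. \<forall>w'\<in>?W. w \<noteq> w' \<longrightarrow> ?K w \<inter> ?K w' = {}"
    proof (intro ballI impI)
      fix w w' assume w: "w \<in> ?W" "w' \<in> ?W" "w \<noteq> w'"
      then obtain b where b: "b \<in> X - {c}" "w = x0 b" by blast
      have "x c = x b" if "x \<in> ?K w" for x
        using that b c by (auto simp: kernel_class_iff)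
      moreover have "x c \<noteq> x b" if "x \<in> ?K w'" for x
        using that b c w(3) by (auto simp: kernel_class_iff)
      ultimately show "?K w \<inter> ?K w' = {}" by blast
    qed
  qed (use X V in auto)
  finally show ?thesis using U0 by simp
qed

text \<open>Eliminating an isolated coordinate from a pattern with \<open>u\<close> values leaves
  \<open>u - 1\<close> patterns with \<open>u - 1\<close> values, so at most \<open>u!\<close>
  patterns without isolated coordinates remain in the end. All of them are coarsenings of
  \<open>x0\<close>, which is why the bound \<open>M\<close> is only required for those.\<close>

lemma kernel_class_sum_bound:
  fixes F :: "('a \<Rightarrow> 'v) \<Rightarrow> real" and x0 :: "'a \<Rightarrow> 'w"
  assumes X: "finite X" and V: "finite V"
    and zero: "\<And>c x. c \<in> X \<Longrightarrow> x \<in> (X - {c}) \<rightarrow>\<^sub>E V \<Longrightarrow> (\<Sum>v\<in>V. F (x(c := v))) = 0"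
    and M0: "0 \<le> M"
    and M: "\<And>x1 :: 'a \<Rightarrow> 'w. (\<forall>a\<in>X. \<forall>b\<in>X. x0 a = x0 b \<longrightarrow> x1 a = x1 b) \<Longrightarrow>
      (\<forall>a\<in>X. \<exists>b\<in>X - {a}. x1 a = x1 b) \<Longrightarrow> \<bar>\<Sum>x\<in>kernel_class X V x1. F x\<bar> \<le> M"
  shows "\<bar>\<Sum>x\<in>kernel_class X V x0. F x\<bar> \<le> fact (card (x0 ` X)) * M"
  using M
proof (induction "card (x0 ` X)" arbitrary: x0 rule: less_induct)
  case less
  let ?u = "card (x0 ` X)"
  show ?case
  proof (cases "\<forall>a\<in>X. \<exists>b\<in>X - {a}. x0 a = x0 b")
    case True
    then have "\<bar>\<Sum>x\<in>kernel_class X V x0. F x\<bar> \<le> M" by (intro less.prems) auto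
    also have "\<dots> \<le> fact ?u * M" using M0 by (simp add: mult_le_cancel_right1)
    finally show ?thesis .
  next
    case False
    then obtain c where c: "c \<in> X" and single: "\<And>b. b \<in> X - {c} \<Longrightarrow> x0 b \<noteq> x0 c" by metis
    let ?W = "x0 ` (X - {c})"
    have "x0 c \<notin> ?W"
    proof
      assume "x0 c \<in> ?W"
      then obtain b where "b \<in> X - {c}" "x0 c = x0 b" by blast
      with single[of b] show False by simp
    qed
    moreover have "x0 ` X = insert (x0 c) ?W" using c by auto
    ultimately have u: "?u = Suc (card ?W)" using X by simp
    have "\<bar>\<Sum>x\<in>kernel_class X V (x0(c := w)). F x\<bar> \<le> fact (card ?W) * M" if w: "w \<in> ?W" for w
    proof -
      have im: "(x0(c := w)) ` X = ?W" using c w by (auto simp: image_iff)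
      have "\<bar>\<Sum>x\<in>kernel_class X V (x0(c := w)). F x\<bar> \<le> fact (card ((x0(c := w)) ` X)) * M"
      proof (rule less.hyps)
        show "card ((x0(c := w)) ` X) < ?u" using im u by simp
        show "\<bar>\<Sum>x\<in>kernel_class X V x1. F x\<bar> \<le> M"
          if "\<forall>a\<in>X. \<forall>b\<in>X. (x0(c := w)) a = (x0(c := w)) b \<longrightarrow> x1 a = x1 b"
            "\<forall>a\<in>X. \<exists>b\<in>X - {a}. x1 a = x1 b" for x1 :: "'a \<Rightarrow> 'w"
        proof (rule less.prems)
          \<comment> \<open>As \<open>c\<close> is isolated in \<open>x0\<close>, moving it onto
            \<open>w\<close> only merges blocks, so a coarsening of the new pattern is one of
            \<open>x0\<close>.\<close>
          show "\<forall>a\<in>X. \<forall>b\<in>X. x0 a = x0 b \<longrightarrow> x1 a = x1 b"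
          proof (intro ballI impI)
            fix a b assume ab: "a \<in> X" "b \<in> X" "x0 a = x0 b"
            then have "a = c \<longleftrightarrow> b = c" using single[of a] single[of b] by (metis DiffI singletonD)
            then have "(x0(c := w)) a = (x0(c := w)) b" using ab(3) by auto
            then show "x1 a = x1 b" using that(1) ab by blast
          qed
        qed (use that in blast)
      qed
      then show ?thesis using im by simp
    qed
    then have "(\<Sum>w\<in>?W. \<bar>\<Sum>x\<in>kernel_class X V (x0(c := w)). F x\<bar>) \<le> real (card ?W) * (fact (card ?W) * M)"
      by (rule sum_bounded_above)
    also have "\<dots> \<le> fact ?u * M"
      unfolding u using M0 by (simp add: algebra_simps)
    finally have tot: "(\<Sum>w\<in>?W. \<bar>\<Sum>x\<in>kernel_class X V (x0(c := w)). F x\<bar>) \<le> fact ?u * M" .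
    have elim: "(\<Sum>x\<in>kernel_class X V x0. F x)
        = - (\<Sum>w\<in>?W. \<Sum>x\<in>kernel_class X V (x0(c := w)). F x)"
      using X V c by (rule kernel_class_eliminate) (use single zero[OF c] in auto)
    have "\<bar>\<Sum>x\<in>kernel_class X V x0. F x\<bar>
        \<le> (\<Sum>w\<in>?W. \<bar>\<Sum>x\<in>kernel_class X V (x0(c := w)). F x\<bar>)"
      unfolding elim by (simp add: sum_abs)
    with tot show ?thesis by linarith
  qed
qed

section \<open>Pairs of tuples and Hoeffding tensors\<close>

definition half :: "nat \<Rightarrow> (bool \<times> nat \<Rightarrow> nat) \<Rightarrow> bool \<Rightarrow> nat \<Rightarrow> nat" where
  "half s x b = (\<lambda>r\<in>{1..s}. x (b, r))"

abbreviation positions :: "nat \<Rightarrow> (bool \<times> nat) set" where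
  "positions s \<equiv> UNIV \<times> {1..s}"

abbreviation side :: "nat \<Rightarrow> bool \<Rightarrow> (bool \<times> nat) set" where
  "side s b \<equiv> {b} \<times> {1..s}"

text \<open>A pair of injective tuples is encoded as one function on \<open>positions s\<close>, so
  that a single kernel class records which entries of the two tuples coincide.\<close>

definition tuple_pairs :: "nat \<Rightarrow> nat \<Rightarrow> (bool \<times> nat \<Rightarrow> nat) set" where
  "tuple_pairs n s = {x \<in> positions s \<rightarrow>\<^sub>E {1..n}. \<forall>b. inj_on x (side s b)}"

lemma finite_tuples [simp]: "finite (tuples n s)"
  by (simp add: tuples_def finite_PiE)

lemma finite_inj_tuples [simp]: "finite (inj_tuples n s)"
  by (simp add: inj_tuples_def)

lemma finite_tuple_pairs [simp]: "finite (tuple_pairs n s)"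
  unfolding tuple_pairs_def
  by (rule finite_subset[OF _ finite_PiE[of "positions s" "\<lambda>_. {1..n}"]]) auto

lemma half_in_tuples: "x \<in> positions s \<rightarrow>\<^sub>E {1..n} \<Longrightarrow> half s x b \<in> tuples n s"
  by (auto simp: half_def tuples_def)

lemma sum_tuple_pairs:
  "(\<Sum>i\<in>inj_tuples n s. \<Sum>j\<in>inj_tuples n s. f i j)
    = (\<Sum>x\<in>tuple_pairs n s. f (half s x True) (half s x False))"
proof -
  define join where
    "join i j = (\<lambda>e\<in>positions s. (if fst e then i else j) (snd e))" for i j :: "nat \<Rightarrow> nat"
  have half_join: "half s (join i j) True = i" "half s (join i j) False = j"
    if "i \<in> inj_tuples n s" "j \<in> inj_tuples n s" for i j
    using that
    by (auto simp: join_def half_def inj_tuples_def tuples_def PiE_iff extensional_def fun_eq_iff)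
  have join: "join i j \<in> tuple_pairs n s" if "i \<in> inj_tuples n s" "j \<in> inj_tuples n s" for i j
  proof -
    have "join i j \<in> positions s \<rightarrow>\<^sub>E {1..n}"
      using that by (auto simp: join_def inj_tuples_def tuples_def PiE_iff)
    moreover have "inj_on (join i j) (side s b)" for b
    proof (rule inj_onI)
      define k where "k = (if b then i else j)"
      have k: "inj_on k {1..s}" using that by (simp add: inj_tuples_def k_def)
      fix e e' assume "e \<in> side s b" "e' \<in> side s b" and eq: "join i j e = join i j e'"
      then obtain r r' where r: "e = (b, r)" "r \<in> {1..s}" "e' = (b, r')" "r' \<in> {1..s}" by blast
      have "join i j (b, q) = k q" if "q \<in> {1..s}" for q
        using that by (simp add: join_def k_def)
      with eq r have "k r = k r'" by metis
      with k r show "e = e'" by (metis inj_onD)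
    qed
    ultimately show ?thesis by (simp add: tuple_pairs_def)
  qed
  have half: "half s x b \<in> inj_tuples n s" if "x \<in> tuple_pairs n s" for x b
  proof -
    have "inj_on x (side s b)" "half s x b \<in> tuples n s"
      using that half_in_tuples[of x s n b] by (simp_all add: tuple_pairs_def)
    moreover have "inj_on (half s x b) {1..s}"
    proof (rule inj_onI)
      fix r r' assume r: "r \<in> {1..s}" "r' \<in> {1..s}" "half s x b r = half s x b r'"
      then have "x (b, r) = x (b, r')" by (simp add: half_def)
      with \<open>inj_on x (side s b)\<close> r(1,2) have "(b, r) = (b, r')" by (intro inj_onD[of x]) auto
      then show "r = r'" by simp
    qed
    ultimately show ?thesis by (simp add: inj_tuples_def)
  qed
  have join_half: "join (half s x True) (half s x False) = x" if "x \<in> tuple_pairs n s" for x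
  proof
    fix e show "join (half s x True) (half s x False) e = x e"
      using that by (cases e; cases "fst e")
        (auto simp: join_def half_def tuple_pairs_def PiE_iff extensional_def)
  qed
  have "(\<Sum>(i, j)\<in>inj_tuples n s \<times> inj_tuples n s. f i j)
      = (\<Sum>x\<in>tuple_pairs n s. f (half s x True) (half s x False))"
    by (rule sum.reindex_bij_witness[where i = "\<lambda>x. (half s x True, half s x False)"
          and j = "\<lambda>(i, j). join i j"])
      (use half_join join half join_half in \<open>auto\<close>)
  then show ?thesis by (simp add: sum.cartesian_product)
qed

lemma tensor_beta_nonneg: "0 \<le> tensor_beta n s \<xi>"
  unfolding tensor_beta_def by (intro sum_nonneg) simp

text \<open>Parametrizes the extensions of \<open>i\<close> by their value at \<open>r\<close>; this
  is the shape in which \<open>kernel_class_sum_bound\<close> needs the Hoeffding property.\<close>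

lemma hoeffding_tensor_sum_zero:
  assumes H: "hoeffding_tensor n s \<xi>" and r: "r \<in> {1..s}"
    and i: "i \<in> ({1..s} - {r}) \<rightarrow>\<^sub>E {1..n}" and p: "p \<in> tuples n s"
  shows "(\<Sum>v\<in>{1..n}. \<xi> (i(r := v)) p) = 0" "(\<Sum>v\<in>{1..n}. \<xi> p (i(r := v))) = 0"
proof -
  let ?E = "{j \<in> tuples n s. \<forall>k\<in>{1..s} - {r}. j k = i k}"
  have E: "?E = (\<lambda>v. i(r := v)) ` {1..n}"
  proof (intro equalityI subsetI)
    fix j assume j: "j \<in> ?E"
    have "j = i(r := j r)"
    proof
      fix x show "j x = (i(r := j r)) x"
      proof (cases "x = r \<or> x \<in> {1..s}")
        case False
        then have "x \<notin> {1..s}" "x \<notin> {1..s} - {r}" "x \<noteq> r" by auto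
        moreover have "j \<in> {1..s} \<rightarrow>\<^sub>E {1..n}" using j by (simp add: tuples_def)
        ultimately show ?thesis using PiE_arb[of j _ _ x] PiE_arb[OF i, of x] by (metis fun_upd_other)
      qed (use j in auto)
    qed
    moreover have "j r \<in> {1..n}" using j r by (auto simp: tuples_def)
    ultimately show "j \<in> (\<lambda>v. i(r := v)) ` {1..n}" by blast
  next
    fix j assume "j \<in> (\<lambda>v. i(r := v)) ` {1..n}"
    then obtain v where v: "v \<in> {1..n}" "j = i(r := v)" by blast
    have "i(r := v) \<in> insert r ({1..s} - {r}) \<rightarrow>\<^sub>E {1..n}"
      using v i by (intro PiE_fun_upd) auto
    moreover have "insert r ({1..s} - {r}) = {1..s}" using r by auto
    ultimately show "j \<in> ?E" by (simp add: v tuples_def)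
  qed
  have inj: "inj_on (\<lambda>v. i(r := v)) {1..n}" by (auto simp: inj_on_def dest: fun_upd_eqD)
  have "(\<Sum>j\<in>?E. \<xi> j p) = 0 \<and> (\<Sum>j\<in>?E. \<xi> p j) = 0"
    using H[unfolded hoeffding_tensor_def, rule_format, OF r i i p p] by blast
  then show "(\<Sum>v\<in>{1..n}. \<xi> (i(r := v)) p) = 0" "(\<Sum>v\<in>{1..n}. \<xi> p (i(r := v))) = 0"
    unfolding E sum.reindex[OF inj] o_def by blast+
qed

text \<open>Once the half on side \<open>b\<close> is known, only the values private to the other
  side are free. Each has at most \<open>n\<close> choices, and the summand does not depend on
  them.\<close>

lemma kernel_class_half_sum:
  fixes g :: "(nat \<Rightarrow> nat) \<Rightarrow> real" and x0 :: "bool \<times> nat \<Rightarrow> 'w"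
  assumes g: "\<And>i. 0 \<le> g i"
  shows "(\<Sum>x\<in>kernel_class (positions s) {1..n} x0. g (half s x b))
    \<le> real n ^ card (x0 ` side s (\<not> b) - x0 ` side s b) * (\<Sum>i\<in>tuples n s. g i)"
proof -
  let ?K = "kernel_class (positions s) {1..n} x0"
  define W where "W = x0 ` side s (\<not> b) - x0 ` side s b"
  \<comment> \<open>One position for each pattern value; a member of the class takes the same value
    on the whole block of that position.\<close>
  define rep where "rep w = inv_into (positions s) x0 w" for w
  define \<phi> where "\<phi> x = (half s x b, \<lambda>w\<in>W. x (rep w))" for x :: "bool \<times> nat \<Rightarrow> nat"
  have finW: "finite W" by (simp add: W_def)
  have rep: "rep w \<in> positions s" "x0 (rep w) = w" if "w \<in> x0 ` positions s" for w
    using that by (auto simp: rep_def inv_into_into f_inv_into_f simp del: mem_Sigma_iff)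
  have Wsub: "W \<subseteq> x0 ` positions s" by (auto simp: W_def)
  have inj: "inj_on \<phi> ?K"
  proof (rule inj_onI)
    fix x y assume x: "x \<in> ?K" and y: "y \<in> ?K" and eq: "\<phi> x = \<phi> y"
    have b: "x (b, r) = y (b, r)" if "r \<in> {1..s}" for r
    proof -
      have "half s x b r = half s y b r" using eq by (simp add: \<phi>_def)
      then show ?thesis using that by (simp add: half_def)
    qed
    have nb: "x (\<not> b, r) = y (\<not> b, r)" if r: "r \<in> {1..s}" for r
    proof (cases "x0 (\<not> b, r) \<in> x0 ` side s b")
      case True
      then obtain r' where r': "r' \<in> {1..s}" "x0 (\<not> b, r) = x0 (b, r')" by auto
      then have "x (\<not> b, r) = x (b, r')" "y (\<not> b, r) = y (b, r')"
        using x y r by (auto simp: kernel_class_iff)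
      then show ?thesis using b r' by simp
    next
      case False
      then have w: "x0 (\<not> b, r) \<in> W" using r by (auto simp: W_def)
      let ?e = "rep (x0 (\<not> b, r))"
      have e: "?e \<in> positions s" "x0 ?e = x0 (\<not> b, r)" using rep w Wsub by auto
      then have "x ?e = x (\<not> b, r)" "y ?e = y (\<not> b, r)"
        using x y r unfolding kernel_class_iff by (metis UNIV_I mem_Sigma_iff)+
      moreover have "x ?e = y ?e"
      proof -
        have "(\<lambda>w\<in>W. x (rep w)) (x0 (\<not> b, r)) = (\<lambda>w\<in>W. y (rep w)) (x0 (\<not> b, r))"
          using eq by (simp add: \<phi>_def)
        then show ?thesis using w by simp
      qed
      ultimately show ?thesis by simp
    qed
    show "x = y"
    proof (rule PiE_ext)
      show "x \<in> positions s \<rightarrow>\<^sub>E {1..n}" "y \<in> positions s \<rightarrow>\<^sub>E {1..n}"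
        using x y by (auto simp: kernel_class_iff)
      fix e assume "e \<in> positions s"
      then obtain b' r where "e = (b', r)" "r \<in> {1..s}" by blast
      then show "x e = y e" using b nb by (cases "b' = b") auto
    qed
  qed
  have sub: "\<phi> ` ?K \<subseteq> tuples n s \<times> (W \<rightarrow>\<^sub>E {1..n})"
  proof (intro subsetI, elim imageE)
    fix e x assume e: "e = \<phi> x" and x: "x \<in> ?K"
    have "x (rep w) \<in> {1..n}" if "w \<in> W" for w
    proof -
      have "rep w \<in> positions s" using rep(1) that Wsub by blast
      moreover have "x \<in> positions s \<rightarrow>\<^sub>E {1..n}" using x by (simp add: kernel_class_iff)
      ultimately show ?thesis using PiE_mem[of x "positions s" "\<lambda>_. {1..n}" "rep w"] by simp
    qed
    then show "e \<in> tuples n s \<times> (W \<rightarrow>\<^sub>E {1..n})"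
      using half_in_tuples[of x s n b] x by (simp add: e \<phi>_def kernel_class_iff)
  qed
  have "(\<Sum>x\<in>?K. g (half s x b)) = (\<Sum>e\<in>\<phi> ` ?K. g (fst e))"
    by (subst sum.reindex[OF inj]) (simp add: \<phi>_def)
  also have "\<dots> \<le> (\<Sum>e\<in>tuples n s \<times> (W \<rightarrow>\<^sub>E {1..n}). g (fst e))"
    using sub g finW by (intro sum_mono2) (auto simp: finite_PiE)
  also have "\<dots> = (\<Sum>i\<in>tuples n s. \<Sum>h\<in>(W \<rightarrow>\<^sub>E {1..n}). g i)"
    by (simp add: sum.cartesian_product case_prod_unfold del: sum_constant)
  also have "\<dots> = real n ^ card W * (\<Sum>i\<in>tuples n s. g i)"
    using finW by (simp add: card_PiE sum_distrib_left)
  finally show ?thesis by (simp add: W_def)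
qed

lemma positions_split: "positions s = side s b \<union> side s (\<not> b)" "side s b \<inter> side s (\<not> b) = {}"
  by auto

text \<open>
  Values of \<open>x1\<close> taken on one side only have at least two preimages, none of which was shared between
  the sides by \<open>x0\<close>. This is where every factor \<open>n^(-1/2)\<close> is gained.
\<close>

lemma card_private_values:
  fixes x0 x1 :: "bool \<times> nat \<Rightarrow> 'w"
  assumes inj: "\<And>b. inj_on x0 (side s b)"
    and coarse: "\<forall>a\<in>positions s. \<forall>b\<in>positions s. x0 a = x0 b \<longrightarrow> x1 a = x1 b"
    and paired: "\<forall>a\<in>positions s. \<exists>b\<in>positions s - {a}. x1 a = x1 b"
  shows "2 * card (x1 ` side s (\<not> b) - x1 ` side s b) + s \<le> card (x0 ` positions s)"
proof -
  define W where "W = x1 ` side s (\<not> b) - x1 ` side s b"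
  define Q where "Q = {a \<in> side s (\<not> b). x1 a \<in> W}"
  have finQ: "finite Q" and finW: "finite W" by (auto simp: Q_def W_def)
  have two: "2 \<le> card {a \<in> Q. x1 a = w}" if w: "w \<in> W" for w
  proof -
    obtain a where a: "a \<in> side s (\<not> b)" "x1 a = w" using w by (auto simp: W_def)
    then have "a \<in> positions s" by auto
    then obtain c where "c \<in> positions s - {a}" "x1 a = x1 c" using paired by blast
    with a(2) have c: "c \<in> positions s" "c \<noteq> a" "x1 c = w" by simp_all
    have "c \<notin> side s b" using c w by (auto simp: W_def)
    then have "{a, c} \<subseteq> {a \<in> Q. x1 a = w}"
      using a c w positions_split(1)[of s b] by (auto simp: Q_def)
    then have "card {a, c} \<le> card {a \<in> Q. x1 a = w}" using finQ by (intro card_mono) auto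
    then show ?thesis using c(2) by auto
  qed
  have "2 * card W = (\<Sum>w\<in>W. 2)" by simp
  also have "\<dots> \<le> (\<Sum>w\<in>W. card {a \<in> Q. x1 a = w})" using two by (intro sum_mono) auto
  also have "\<dots> = (\<Sum>w\<in>W. \<Sum>a | a \<in> Q \<and> x1 a = w. 1)" by simp
  also have "\<dots> = (\<Sum>a\<in>Q. 1)" using finQ finW by (intro sum.group) (auto simp: Q_def)
  finally have QW: "2 * card W \<le> card Q" by simp
  have disj: "x0 ` Q \<inter> x0 ` side s b = {}"
  proof (intro equals0I, elim IntE imageE)
    fix v a c assume v: "v = x0 a" "a \<in> Q" "v = x0 c" "c \<in> side s b"
    then have "a \<in> positions s" "c \<in> positions s" "x0 a = x0 c" by (auto simp: Q_def)
    then have "x1 a = x1 c" using coarse by blast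
    moreover have "x1 a \<in> W" using v(2) by (simp add: Q_def)
    ultimately have "x1 c \<in> W" by simp
    then show False using v(4) by (simp add: W_def)
  qed
  have "inj_on x0 Q" using inj[of "\<not> b"] by (rule inj_on_subset) (auto simp: Q_def)
  then have "card Q + s = card (x0 ` Q) + card (x0 ` side s b)"
    using inj[of b] by (simp add: card_image)
  also have "\<dots> = card (x0 ` Q \<union> x0 ` side s b)"
    using disj finQ by (intro card_Un_disjoint[symmetric]) auto
  also have "\<dots> \<le> card (x0 ` positions s)"
    by (intro card_mono) (auto simp: Q_def)
  finally show ?thesis using QW by (simp add: W_def)
qed

section \<open>Products of two tensor entries, summed over a pattern\<close>

definition pair_product ::
    "nat \<Rightarrow> ((nat \<Rightarrow> nat) \<Rightarrow> (nat \<Rightarrow> nat) \<Rightarrow> real) \<Rightarrow>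
      (bool \<times> nat \<Rightarrow> nat) \<Rightarrow> (bool \<times> nat \<Rightarrow> nat) \<Rightarrow> real" where
  "pair_product s \<xi> x y = \<xi> (half s x True) (half s y True) * \<xi> (half s x False) (half s y False)"

lemma kernel_class_half_square_sum:
  fixes x1 y1 :: "bool \<times> nat \<Rightarrow> 'w"
  shows "(\<Sum>x\<in>kernel_class (positions s) {1..n} x1. \<Sum>y\<in>kernel_class (positions s) {1..n} y1.
      (\<xi> (half s x b) (half s y b))\<^sup>2)
    \<le> real n ^ (card (x1 ` side s (\<not> b) - x1 ` side s b) + card (y1 ` side s (\<not> b) - y1 ` side s b))
      * tensor_beta n s \<xi>"
proof -
  let ?K = "kernel_class (positions s) {1..n}"
  let ?c = "\<lambda>x :: bool \<times> nat \<Rightarrow> 'w. card (x ` side s (\<not> b) - x ` side s b)"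
  have "(\<Sum>x\<in>?K x1. \<Sum>y\<in>?K y1. (\<xi> (half s x b) (half s y b))\<^sup>2)
      \<le> (\<Sum>x\<in>?K x1. real n ^ ?c y1 * (\<Sum>p\<in>tuples n s. (\<xi> (half s x b) p)\<^sup>2))"
    by (intro sum_mono kernel_class_half_sum) auto
  also have "\<dots> = real n ^ ?c y1 * (\<Sum>x\<in>?K x1. \<Sum>p\<in>tuples n s. (\<xi> (half s x b) p)\<^sup>2)"
    by (simp add: sum_distrib_left)
  also have "\<dots> \<le> real n ^ ?c y1 * (real n ^ ?c x1 * tensor_beta n s \<xi>)"
    unfolding tensor_beta_def
    by (intro mult_left_mono kernel_class_half_sum) (auto intro!: sum_nonneg)
  finally show ?thesis by (simp add: power_add mult_ac)
qed

text \<open>Cauchy--Schwarz separates the two factors, each of which depends on one side only, so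
  that every private value of the opposite side costs a factor \<open>n\<close>. By
  \<open>card_private_values\<close> each of the four counts is at most \<open>(u - s) / 2\<close>
  for \<open>u\<close> values, and the square root of \<open>n^(2 (u - s))\<close> is the
  bound.\<close>

lemma pair_product_paired_bound:
  fixes x0 x1 y1 :: "bool \<times> nat \<Rightarrow> 'w"
  assumes n: "n \<ge> 1" and inj: "\<And>b. inj_on x0 (side s b)"
    and x1: "\<forall>a\<in>positions s. \<forall>b\<in>positions s. x0 a = x0 b \<longrightarrow> x1 a = x1 b"
      "\<forall>a\<in>positions s. \<exists>b\<in>positions s - {a}. x1 a = x1 b"
    and y1: "\<forall>a\<in>positions s. \<forall>b\<in>positions s. x0 a = x0 b \<longrightarrow> y1 a = y1 b"
      "\<forall>a\<in>positions s. \<exists>b\<in>positions s - {a}. y1 a = y1 b"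
  shows "\<bar>\<Sum>x\<in>kernel_class (positions s) {1..n} x1. \<Sum>y\<in>kernel_class (positions s) {1..n} y1.
      pair_product s \<xi> x y\<bar> \<le> real n ^ (card (x0 ` positions s) - s) * tensor_beta n s \<xi>"
proof -
  let ?K = "kernel_class (positions s) {1..n}"
  let ?c = "\<lambda>b (x :: bool \<times> nat \<Rightarrow> 'w). card (x ` side s (\<not> b) - x ` side s b)"
  let ?u = "card (x0 ` positions s)" and ?\<beta> = "tensor_beta n s \<xi>"
  let ?f = "\<lambda>b (x, y). \<xi> (half s x b) (half s y b)"
  have \<beta>0: "0 \<le> ?\<beta>" by (rule tensor_beta_nonneg)
  have "\<bar>\<Sum>x\<in>?K x1. \<Sum>y\<in>?K y1. pair_product s \<xi> x y\<bar>
      \<le> (\<Sum>e\<in>?K x1 \<times> ?K y1. \<bar>?f True e\<bar> * \<bar>?f False e\<bar>)"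
    by (simp add: sum.cartesian_product pair_product_def case_prod_unfold abs_mult[symmetric])
  also have "\<dots> \<le> L2_set (?f True) (?K x1 \<times> ?K y1) * L2_set (?f False) (?K x1 \<times> ?K y1)"
    by (rule L2_set_mult_ineq)
  also have "\<dots> = sqrt (\<Sum>x\<in>?K x1. \<Sum>y\<in>?K y1. (\<xi> (half s x True) (half s y True))\<^sup>2)
      * sqrt (\<Sum>x\<in>?K x1. \<Sum>y\<in>?K y1. (\<xi> (half s x False) (half s y False))\<^sup>2)"
    by (simp add: L2_set_def sum.cartesian_product case_prod_unfold)
  also have "\<dots> \<le> sqrt (real n ^ (?c True x1 + ?c True y1) * ?\<beta>)
      * sqrt (real n ^ (?c False x1 + ?c False y1) * ?\<beta>)"
    by (intro mult_mono real_sqrt_le_mono kernel_class_half_square_sum)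
      (auto intro!: sum_nonneg \<beta>0 mult_nonneg_nonneg)
  also have "\<dots> = sqrt (real n ^ (?c True x1 + ?c True y1 + (?c False x1 + ?c False y1)) * ?\<beta>\<^sup>2)"
    by (simp add: real_sqrt_mult[symmetric] power_add power2_eq_square mult_ac)
  also have "\<dots> \<le> sqrt ((real n ^ (?u - s) * ?\<beta>)\<^sup>2)"
  proof -
    have "2 * ?c True x1 + s \<le> ?u" "2 * ?c False x1 + s \<le> ?u"
      "2 * ?c True y1 + s \<le> ?u" "2 * ?c False y1 + s \<le> ?u"
      using card_private_values[OF inj x1] card_private_values[OF inj y1] by blast+
    then have "?c True x1 + ?c True y1 + (?c False x1 + ?c False y1) \<le> 2 * (?u - s)" by linarith
    then have "real n ^ (?c True x1 + ?c True y1 + (?c False x1 + ?c False y1)) \<le> real n ^ (2 * (?u - s))"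
      using n by (intro power_increasing) auto
    then have "real n ^ (?c True x1 + ?c True y1 + (?c False x1 + ?c False y1)) * ?\<beta>\<^sup>2
        \<le> real n ^ (2 * (?u - s)) * ?\<beta>\<^sup>2"
      by (rule mult_right_mono) simp
    also have "\<dots> = (real n ^ (?u - s) * ?\<beta>)\<^sup>2"
      by (simp add: power_mult_distrib power_mult[symmetric] mult.commute)
    finally show ?thesis by (rule real_sqrt_le_mono)
  qed
  also have "\<dots> = real n ^ (?u - s) * ?\<beta>" using \<beta>0 by simp
  finally show ?thesis .
qed

lemma half_fun_upd:
  assumes x: "x \<in> (positions s - {(b, r)}) \<rightarrow>\<^sub>E V" and r: "r \<in> {1..s}"
  shows "half s (x((b, r) := v)) b = (\<lambda>k\<in>{1..s} - {r}. x (b, k))(r := v)"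
    "half s (x((b, r) := v)) (\<not> b) = half s x (\<not> b)"
  using r by (auto simp: half_def fun_eq_iff restrict_def)

text \<open>A position occurs in only one of the two factors; the other factor is constant in the
  sum, and the Hoeffding property applies to the first.\<close>

lemma pair_product_sum_zero:
  assumes H: "hoeffding_tensor n s \<xi>" and c: "c \<in> positions s"
    and x: "x \<in> (positions s - {c}) \<rightarrow>\<^sub>E {1..n}" and y: "y \<in> positions s \<rightarrow>\<^sub>E {1..n}"
  shows "(\<Sum>v\<in>{1..n}. pair_product s \<xi> (x(c := v)) y) = 0"
    "(\<Sum>v\<in>{1..n}. pair_product s \<xi> y (x(c := v))) = 0"
proof -
  obtain b r where br: "c = (b, r)" "r \<in> {1..s}" using c by blast
  define i where "i = (\<lambda>k\<in>{1..s} - {r}. x (b, k))"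
  have i: "i \<in> ({1..s} - {r}) \<rightarrow>\<^sub>E {1..n}" using x by (auto simp: i_def br(1))
  have p: "pair_product s \<xi> z w = \<xi> (half s z b) (half s w b) * \<xi> (half s z (\<not> b)) (half s w (\<not> b))"
    for z w by (cases b) (auto simp: pair_product_def)
  note upd = half_fun_upd[OF x[unfolded br(1)] br(2), folded i_def]
  show "(\<Sum>v\<in>{1..n}. pair_product s \<xi> (x(c := v)) y) = 0"
    "(\<Sum>v\<in>{1..n}. pair_product s \<xi> y (x(c := v))) = 0"
    unfolding p br(1) upd sum_distrib_right[symmetric]
    using hoeffding_tensor_sum_zero[OF H br(2) i half_in_tuples[OF y, of b]] by simp_all
qed

text \<open>Elimination is run twice: on the row tuples \<open>x\<close>, and then on the column
  tuples \<open>y\<close> for every remaining pattern of \<open>x\<close>. Each run costs a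
  factorial of the number of values.\<close>

lemma pair_product_class_bound:
  fixes x0 :: "bool \<times> nat \<Rightarrow> 'w"
  assumes H: "hoeffding_tensor n s \<xi>" and n: "n \<ge> 1" and inj: "\<And>b. inj_on x0 (side s b)"
  shows "\<bar>\<Sum>x\<in>kernel_class (positions s) {1..n} x0. \<Sum>y\<in>kernel_class (positions s) {1..n} x0.
      pair_product s \<xi> x y\<bar>
    \<le> (fact (card (x0 ` positions s)))\<^sup>2 * (real n ^ (card (x0 ` positions s) - s) * tensor_beta n s \<xi>)"
proof -
  let ?K = "kernel_class (positions s) {1..n}"
  let ?u = "card (x0 ` positions s)"
  let ?M = "real n ^ (?u - s) * tensor_beta n s \<xi>"
  have M0: "0 \<le> ?M" by (simp add: tensor_beta_nonneg)
  have fin: "finite (positions s)" by simp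
  have K: "x \<in> positions s \<rightarrow>\<^sub>E {1..n}" if "x \<in> ?K z" for x and z :: "bool \<times> nat \<Rightarrow> 'w"
    using that by (simp add: kernel_class_iff)
  have inner: "\<bar>\<Sum>y\<in>?K x0. \<Sum>x\<in>?K x1. pair_product s \<xi> x y\<bar> \<le> fact ?u * ?M"
    if x1: "\<forall>a\<in>positions s. \<forall>b\<in>positions s. x0 a = x0 b \<longrightarrow> x1 a = x1 b"
      "\<forall>a\<in>positions s. \<exists>b\<in>positions s - {a}. x1 a = x1 b" for x1 :: "bool \<times> nat \<Rightarrow> 'w"
  proof (rule kernel_class_sum_bound[OF fin _ _ M0])
    fix c z assume cz: "c \<in> positions s" "z \<in> (positions s - {c}) \<rightarrow>\<^sub>E {1..n}"
    have "(\<Sum>v\<in>{1..n}. pair_product s \<xi> x (z(c := v))) = 0" if "x \<in> ?K x1" for x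
      using cz K[OF that] by (rule pair_product_sum_zero(2)[OF H])
    then show "(\<Sum>v\<in>{1..n}. \<Sum>x\<in>?K x1. pair_product s \<xi> x (z(c := v))) = 0"
      by (subst sum.swap) (rule sum.neutral, blast)
  next
    fix y1 :: "bool \<times> nat \<Rightarrow> 'w"
    assume "\<forall>a\<in>positions s. \<forall>b\<in>positions s. x0 a = x0 b \<longrightarrow> y1 a = y1 b"
      "\<forall>a\<in>positions s. \<exists>b\<in>positions s - {a}. y1 a = y1 b"
    from pair_product_paired_bound[OF n inj x1 this, of \<xi>]
    show "\<bar>\<Sum>y\<in>?K y1. \<Sum>x\<in>?K x1. pair_product s \<xi> x y\<bar> \<le> ?M"
      by (subst sum.swap)
  qed simp
  have "\<bar>\<Sum>x\<in>?K x0. \<Sum>y\<in>?K x0. pair_product s \<xi> x y\<bar> \<le> fact ?u * (fact ?u * ?M)"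
  proof (rule kernel_class_sum_bound[OF fin])
    fix c z assume cz: "c \<in> positions s" "z \<in> (positions s - {c}) \<rightarrow>\<^sub>E {1..n}"
    have "(\<Sum>v\<in>{1..n}. pair_product s \<xi> (z(c := v)) y) = 0" if "y \<in> ?K x0" for y
      using cz K[OF that] by (rule pair_product_sum_zero(1)[OF H])
    then show "(\<Sum>v\<in>{1..n}. \<Sum>y\<in>?K x0. pair_product s \<xi> (z(c := v)) y) = 0"
      by (subst sum.swap) (rule sum.neutral, blast)
  next
    show "0 \<le> fact ?u * ?M" using M0 by simp
  next
    fix x1 :: "bool \<times> nat \<Rightarrow> 'w"
    assume "\<forall>a\<in>positions s. \<forall>b\<in>positions s. x0 a = x0 b \<longrightarrow> x1 a = x1 b"
      "\<forall>a\<in>positions s. \<exists>b\<in>positions s - {a}. x1 a = x1 b"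
    from inner[OF this] show "\<bar>\<Sum>x\<in>?K x1. \<Sum>y\<in>?K x0. pair_product s \<xi> x y\<bar> \<le> fact ?u * ?M"
      by (subst sum.swap)
  qed simp
  then show ?thesis by (simp add: power2_eq_square mult_ac)
qed

section \<open>Second moments\<close>

text \<open>The quotient is \<open>n^u\<close> times the product of \<open>1 - k / n\<close> over
  \<open>k < u\<close>, and such a product is at least one minus the sum of the \<open>k / n\<close>
  (Weierstrass).\<close>

lemma fact_quotient_ge:
  assumes "u \<le> n" "n \<ge> 1"
  shows "real n ^ u * (1 - real u * (real u - 1) / (2 * real n)) \<le> fact n / fact (n - u)"
  using assms(1)
proof (induction u)
  case (Suc u)
  let ?a = "real u * (real u - 1) / (2 * real n)" and ?b = "real u / real n"
  have nu: "n - u = Suc (n - Suc u)" using Suc.prems by simp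
  have a0: "0 \<le> ?a" by (cases u) auto
  have "1 - real (Suc u) * (real (Suc u) - 1) / (2 * real n) = 1 - ?a - ?b"
    using assms(2) by (simp add: field_simps)
  also have "\<dots> \<le> (1 - ?a) * (1 - ?b)"
  proof -
    have "1 - a - b \<le> (1 - a) * (1 - b)" if "0 \<le> a" "0 \<le> b" for a b :: real
      using that by (simp add: algebra_simps)
    then show ?thesis using a0 by (metis divide_nonneg_nonneg of_nat_0_le_iff)
  qed
  finally have "real n ^ Suc u * (1 - real (Suc u) * (real (Suc u) - 1) / (2 * real n))
      \<le> real n ^ Suc u * ((1 - ?a) * (1 - ?b))"
    by (intro mult_left_mono) auto
  also have "\<dots> = (real n ^ u * (1 - ?a)) * (real n - real u)"
    using assms(2) by (simp add: field_simps)
  also have "\<dots> \<le> fact n / fact (n - u) * (real n - real u)"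
    using Suc by (intro mult_right_mono) auto
  also have "\<dots> = fact n / fact (n - Suc u)"
    using Suc.prems by (simp add: nu field_simps)
  finally show ?case .
qed simp

text \<open>With at most \<open>2 s\<close> values the correction \<open>u (u - 1) / (2 n)\<close>
  is at most \<open>4 s^2 / (2 n)\<close>, hence at most 1/2. The lower bound on \<open>n\<close> in
  the theorem comes from here.\<close>

lemma fact_quotient_ge_half:
  assumes s: "s \<ge> 1" and n: "n \<ge> 4 * s\<^sup>2" and u: "u \<le> 2 * s"
  shows "real n ^ u / 2 \<le> fact n / fact (n - u)"
proof -
  have "s * 1 \<le> s * s" using s by (intro mult_left_mono) auto
  then have "2 * s \<le> 4 * s\<^sup>2" by (simp add: power2_eq_square)
  then have un: "u \<le> n" and n1: "n \<ge> 1" using u n s by linarith+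
  have "real u * (real u - 1) \<le> real (2 * s) * real (2 * s)"
  proof (cases u)
    case (Suc k)
    then have "real u \<le> real (2 * s)" "real u - 1 \<le> real (2 * s)" "0 \<le> real u - 1"
      using u by simp_all
    then show ?thesis by (intro mult_mono) auto
  qed simp
  also have "\<dots> = real (4 * s\<^sup>2)" by (simp add: power2_eq_square)
  also have "\<dots> \<le> real n" using n by (subst of_nat_le_iff)
  finally have "1 / 2 \<le> 1 - real u * (real u - 1) / (2 * real n)"
    using n1 by (simp add: field_simps)
  then have "real n ^ u * (1 / 2) \<le> real n ^ u * (1 - real u * (real u - 1) / (2 * real n))"
    by (intro mult_left_mono) auto
  also note fact_quotient_ge[OF un n1]
  finally show ?thesis by simp
qed

text \<open>Bounds the elimination cost \<open>(u!)^2\<close> by a factor free of \<open>u\<close>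
  times \<open>(2 s)! / (2 s - u)!\<close>, the number of realizations of the pattern over
  \<open>2 s\<close> letters. One factorial is absorbed by
  \<open>u! (2 s - u)! \<le> (2 s)!\<close>, the other by
  \<open>(2 s)! \<le> 4^s (s!)^2\<close>.\<close>

lemma fact_square_mult_le:
  assumes "u \<le> 2 * s"
  shows "(fact u)\<^sup>2 * fact (2 * s - u) \<le> (fact s)\<^sup>2 * 4 ^ s * (fact (2 * s) :: nat)"
proof -
  have "fact u * fact (2 * s - u) * 1 \<le> fact u * fact (2 * s - u) * (2 * s choose u)"
    using assms by (intro mult_left_mono) (auto simp: Suc_le_eq zero_less_binomial)
  also have "\<dots> = (fact (2 * s) :: nat)" using assms by (rule binomial_fact_lemma)
  finally have 1: "fact u * fact (2 * s - u) \<le> (fact (2 * s) :: nat)" by simp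
  have "fact u \<le> (fact (2 * s) :: nat)" using assms by (intro fact_mono) auto
  also have "\<dots> = fact s * fact (2 * s - s) * (2 * s choose s)"
    by (rule binomial_fact_lemma[symmetric]) simp
  also have "\<dots> \<le> fact s * fact (2 * s - s) * 2 ^ (2 * s)"
    by (intro mult_left_mono binomial_le_pow2) auto
  finally have 2: "fact u \<le> (fact s)\<^sup>2 * (4 ^ s :: nat)"
    by (simp add: power2_eq_square power_mult)
  have "(fact u)\<^sup>2 * fact (2 * s - u) = fact u * (fact u * fact (2 * s - u) :: nat)"
    by (simp add: power2_eq_square)
  also have "\<dots> \<le> ((fact s)\<^sup>2 * 4 ^ s) * fact (2 * s)"
    by (rule mult_mono[OF 2 1]) auto
  finally show ?thesis .
qed

lemma card_inj_tuples: "card (inj_tuples (2 * s) s) * fact s = fact (2 * s)"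
proof -
  have "inj_tuples (2 * s) s = kernel_class {1..s} {1..2 * s} (id :: nat \<Rightarrow> nat)"
    by (auto simp: inj_tuples_def tuples_def kernel_class_def inj_on_def)
  then show ?thesis
    using card_kernel_class[of "{1..s}" "{1..2 * s}" "id :: nat \<Rightarrow> nat"] by simp
qed

lemma card_tuple_pairs: "card (tuple_pairs n s) = (card (inj_tuples n s))\<^sup>2"
proof -
  have "real (card (tuple_pairs n s)) = real ((card (inj_tuples n s))\<^sup>2)"
    using sum_tuple_pairs[where f = "\<lambda>_ _. 1 :: real" and n = n and s = s] by (simp add: power2_eq_square)
  then show ?thesis by (simp only: of_nat_eq_iff)
qed

lemma tuple_pairs_card_image:
  assumes x: "x \<in> tuple_pairs n s"
  shows "s \<le> card (x ` positions s)" "card (x ` positions s) \<le> 2 * s"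
proof -
  have "card (x ` side s True) = s"
    using x by (subst card_image) (auto simp: tuple_pairs_def)
  moreover have "card (x ` side s True) \<le> card (x ` positions s)" by (intro card_mono) auto
  ultimately show "s \<le> card (x ` positions s)" by simp
  have "card (x ` positions s) \<le> card (positions s)" by (intro card_image_le) auto
  then show "card (x ` positions s) \<le> 2 * s" by (simp add: card_cartesian_product)
qed

lemma tuple_pairs_kernel_class:
  assumes x: "x \<in> tuple_pairs n s" and y: "y \<in> kernel_class (positions s) {1..m} x"
  shows "y \<in> tuple_pairs m s"
proof -
  have "inj_on y (side s b)" for b
  proof (rule inj_onI)
    fix e e' assume e: "e \<in> side s b" "e' \<in> side s b" "y e = y e'"
    then have "e \<in> positions s" "e' \<in> positions s" by auto
    with y e(3) have "x e = x e'" unfolding kernel_class_iff by blast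
    moreover have "inj_on x (side s b)" using x by (simp add: tuple_pairs_def)
    ultimately show "e = e'" using e(1,2) by (metis inj_onD)
  qed
  with y show ?thesis by (simp add: tuple_pairs_def kernel_class_iff)
qed

text \<open>
  The patterns are counted with weights: a pattern with \<open>u\<close> values has \<open>(2 s)! / (2 s - u)!\<close>
  realizations over an alphabet of size \<open>2 s\<close>.
\<close>

lemma sum_kernel_classes_card_le:
  assumes rep: "\<And>C. C \<in> kernel_class (positions s) {1..n} ` tuple_pairs n s \<Longrightarrow> rep C \<in> tuple_pairs n s"
      "\<And>C. C \<in> kernel_class (positions s) {1..n} ` tuple_pairs n s \<Longrightarrow>
        kernel_class (positions s) {1..n} (rep C) = C"
  shows "(\<Sum>C\<in>kernel_class (positions s) {1..n} ` tuple_pairs n s.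
      card (kernel_class (positions s) {1..2 * s} (rep C))) \<le> card (tuple_pairs (2 * s) s)"
proof -
  let ?K = "kernel_class (positions s) {1..n}" and ?L = "kernel_class (positions s) {1..2 * s}"
  have "(\<Sum>C\<in>?K ` tuple_pairs n s. card (?L (rep C))) = card (\<Union>C\<in>?K ` tuple_pairs n s. ?L (rep C))"
  proof (rule card_UN_disjoint[symmetric])
    show "\<forall>C\<in>?K ` tuple_pairs n s. \<forall>C'\<in>?K ` tuple_pairs n s. C \<noteq> C' \<longrightarrow> ?L (rep C) \<inter> ?L (rep C') = {}"
    proof (intro ballI impI equals0I, elim IntE)
      fix C C' z assume C: "C \<in> ?K ` tuple_pairs n s" "C' \<in> ?K ` tuple_pairs n s" "C \<noteq> C'"
        and z: "z \<in> ?L (rep C)" "z \<in> ?L (rep C')"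
      have "?K (rep C) = ?K z" "?K (rep C') = ?K z"
        by (rule kernel_class_eq[OF z(1), symmetric], rule kernel_class_eq[OF z(2), symmetric])
      then show False using rep C by metis
    qed
  qed auto
  also have "\<dots> \<le> card (tuple_pairs (2 * s) s)"
  proof (rule card_mono)
    show "(\<Union>C\<in>?K ` tuple_pairs n s. ?L (rep C)) \<subseteq> tuple_pairs (2 * s) s"
    proof (intro subsetI, elim UN_E)
      fix z C assume C: "C \<in> ?K ` tuple_pairs n s" and z: "z \<in> ?L (rep C)"
      show "z \<in> tuple_pairs (2 * s) s" by (rule tuple_pairs_kernel_class[OF rep(1)[OF C] z])
    qed
  qed simp
  finally show ?thesis .
qed

text \<open>The leading 2 is the loss in \<open>fact_quotient_ge_half\<close>; the remaining
  constant is the elimination cost summed over all patterns.\<close>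

definition stat_bound :: "nat \<Rightarrow> nat \<Rightarrow> ((nat \<Rightarrow> nat) \<Rightarrow> (nat \<Rightarrow> nat) \<Rightarrow> real) \<Rightarrow> real" where
  "stat_bound n s \<xi> = 2 * 4 ^ s * (fact (2 * s))\<^sup>2 * (tensor_beta n s \<xi> / real n ^ s)"

text \<open>The weight allows one argument for two purposes: the second moment, with weight 1, and
  the Dirichlet form, where \<open>w\<close> counts index pairs that hit both tuples. Invariance on
  classes lets the weight leave the sum over a class before any cancellation is used.\<close>

lemma weighted_second_moment:
  assumes H: "hoeffding_tensor n s \<xi>" and s: "s \<ge> 1" and n: "n \<ge> 4 * s\<^sup>2"
    and w: "\<And>x y. x \<in> tuple_pairs n s \<Longrightarrow> y \<in> kernel_class (positions s) {1..n} x \<Longrightarrow> w y = w x"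
    and w0: "\<And>x. x \<in> tuple_pairs n s \<Longrightarrow> 0 \<le> w x" and wc: "\<And>x. x \<in> tuple_pairs n s \<Longrightarrow> w x \<le> c"
    and c0: "0 \<le> c"
  shows "(\<Sum>x\<in>tuple_pairs n s.
      w x * perm_mean {1..n} (\<lambda>\<pi>. pair_product s \<xi> x (\<lambda>a\<in>positions s. \<pi> (x a))))
    \<le> c * stat_bound n s \<xi>"
proof -
  let ?K = "kernel_class (positions s) {1..n}" and ?L = "kernel_class (positions s) {1..2 * s}"
  let ?J = "tuple_pairs n s"
  let ?\<beta> = "tensor_beta n s \<xi>"
  let ?m = "\<lambda>x. perm_mean {1..n} (\<lambda>\<pi>. pair_product s \<xi> x (\<lambda>a\<in>positions s. \<pi> (x a)))"
  define rep where "rep C = (SOME x. x \<in> ?J \<and> ?K x = C)" for C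
  define D where "D = c * (2 * (?\<beta> / real n ^ s) * ((fact s)\<^sup>2 * 4 ^ s))"
  have rep: "rep C \<in> ?J" "?K (rep C) = C" if "C \<in> ?K ` ?J" for C
    using that someI_ex[of "\<lambda>x. x \<in> ?J \<and> ?K x = C"] unfolding rep_def by blast+
  have "1 \<le> s\<^sup>2" using s by simp
  then have n1: "n \<ge> 1" using n by linarith
  have D0: "0 \<le> D" using c0 tensor_beta_nonneg by (simp add: D_def)
  have class_le: "(\<Sum>x | x \<in> ?J \<and> ?K x = ?K x0. w x * ?m x) \<le> D * real (card (?L x0))"
    if x0: "x0 \<in> ?J" for x0
  proof -
    let ?u = "card (x0 ` positions s)" and ?N = "real (card (?K x0))"
    have u: "s \<le> ?u" "?u \<le> 2 * s" using tuple_pairs_card_image[OF x0] by auto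
    have "s * 1 \<le> s * s" using s by (intro mult_left_mono) auto
    then have "2 * s \<le> 4 * s\<^sup>2" by (simp add: power2_eq_square)
    then have un: "?u \<le> n" using u(2) n by linarith
    have "real (card (?K x0) * fact (n - ?u)) = real (fact n)"
      using card_kernel_class[of "positions s" "{1..n}" x0] un by (simp del: of_nat_mult)
    then have "?N = fact n / fact (n - ?u)" by (simp add: field_simps)
    with fact_quotient_ge_half[OF s n u(2)] have N: "real n ^ ?u / 2 \<le> ?N" by simp
    have N0: "0 < ?N" using N n1 by (smt (verit) half_gt_zero_iff of_nat_0_less_iff less_le_trans zero_less_one zero_less_power)
    have "real (card (?L x0) * fact (2 * s - ?u)) = real (fact (2 * s))"
      using card_kernel_class[of "positions s" "{1..2 * s}" x0] u by (simp del: of_nat_mult)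
    then have L: "real (card (?L x0)) = fact (2 * s) / fact (2 * s - ?u)" by (simp add: field_simps)
    have "real ((fact ?u)\<^sup>2 * fact (2 * s - ?u)) \<le> real ((fact s)\<^sup>2 * 4 ^ s * fact (2 * s))"
      using fact_square_mult_le[OF u(2)] by (simp only: of_nat_le_iff)
    then have fu: "(fact ?u)\<^sup>2 \<le> (fact s)\<^sup>2 * 4 ^ s * real (card (?L x0))"
      unfolding L by (simp add: field_simps)
    have cls: "{x \<in> ?J. ?K x = ?K x0} = ?K x0"
    proof (intro equalityI subsetI)
      fix x assume "x \<in> {x \<in> ?J. ?K x = ?K x0}"
      then have "x \<in> ?K x" "?K x = ?K x0" by (auto simp: tuple_pairs_def intro: kernel_class_refl)
      then show "x \<in> ?K x0" by simp
    next
      fix x assume "x \<in> ?K x0"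
      then show "x \<in> {x \<in> ?J. ?K x = ?K x0}"
        using tuple_pairs_kernel_class[OF x0] kernel_class_eq by blast
    qed
    have "(\<Sum>x | x \<in> ?J \<and> ?K x = ?K x0. w x * ?m x)
        = (\<Sum>x\<in>?K x0. w x0 / ?N * (\<Sum>y\<in>?K x0. pair_product s \<xi> x y))"
      unfolding cls
    proof (intro sum.cong refl)
      fix x assume x: "x \<in> ?K x0"
      then have "x \<in> positions s \<rightarrow> {1..n}" by (auto simp: kernel_class_iff)
      then have "?m x = (\<Sum>y\<in>?K x. pair_product s \<xi> x y) / card (?K x)"
        by (intro perm_mean_kernel_class[where F = "pair_product s \<xi> x"]) auto
      then show "w x * ?m x = w x0 / ?N * (\<Sum>y\<in>?K x0. pair_product s \<xi> x y)"
        using w[OF x0 x] kernel_class_eq[OF x, of "{1..n}"] by simp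
    qed
    also have "\<dots> = w x0 / ?N * (\<Sum>x\<in>?K x0. \<Sum>y\<in>?K x0. pair_product s \<xi> x y)"
      by (simp add: sum_distrib_left)
    also have "\<dots> \<le> w x0 / ?N * ((fact ?u)\<^sup>2 * (real n ^ (?u - s) * ?\<beta>))"
    proof (rule mult_left_mono)
      have "inj_on x0 (side s b)" for b using x0 by (simp add: tuple_pairs_def)
      from order.trans[OF abs_ge_self pair_product_class_bound[OF H n1 this]]
      show "(\<Sum>x\<in>?K x0. \<Sum>y\<in>?K x0. pair_product s \<xi> x y)
          \<le> (fact ?u)\<^sup>2 * (real n ^ (?u - s) * ?\<beta>)" .
      show "0 \<le> w x0 / ?N" using w0[OF x0] N0 by simp
    qed
    \<comment> \<open>The class has at least \<open>n^u / 2\<close> members, so the averaging turns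
      \<open>n^(u - s)\<close> into \<open>2 / n^s\<close>, whatever \<open>u\<close> is.\<close>
    also have "\<dots> \<le> c / (real n ^ ?u / 2) * ((fact ?u)\<^sup>2 * (real n ^ (?u - s) * ?\<beta>))"
      using wc[OF x0] w0[OF x0] N N0 n1 tensor_beta_nonneg
      by (intro mult_right_mono frac_le) auto
    also have "\<dots> = c * (2 * (?\<beta> / real n ^ s)) * (fact ?u)\<^sup>2"
    proof -
      have "real n ^ ?u = real n ^ (?u - s) * real n ^ s"
        using u by (simp add: power_add[symmetric])
      then show ?thesis using n1 by (simp add: field_simps)
    qed
    also have "\<dots> \<le> c * (2 * (?\<beta> / real n ^ s)) * ((fact s)\<^sup>2 * 4 ^ s * real (card (?L x0)))"
      using fu c0 tensor_beta_nonneg by (intro mult_left_mono) auto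
    finally show ?thesis by (simp add: D_def mult_ac)
  qed
  have "(\<Sum>x\<in>?J. w x * ?m x) = (\<Sum>C\<in>?K ` ?J. \<Sum>x | x \<in> ?J \<and> ?K x = C. w x * ?m x)"
    by (rule sum.image_gen) simp
  also have "\<dots> \<le> (\<Sum>C\<in>?K ` ?J. D * real (card (?L (rep C))))"
  proof (rule sum_mono)
    fix C assume C: "C \<in> ?K ` ?J"
    show "(\<Sum>x | x \<in> ?J \<and> ?K x = C. w x * ?m x) \<le> D * real (card (?L (rep C)))"
      using class_le[OF rep(1)[OF C]] rep(2)[OF C] by simp
  qed
  also have "\<dots> = D * real (\<Sum>C\<in>?K ` ?J. card (?L (rep C)))"
    by (simp add: sum_distrib_left)
  also have "\<dots> \<le> D * real (card (tuple_pairs (2 * s) s))"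
    by (intro mult_left_mono of_nat_mono sum_kernel_classes_card_le rep D0)
  \<comment> \<open>There are \<open>((2 s)! / s!)^2\<close> pairs of injective tuples over
    \<open>2 s\<close> letters; this cancels the \<open>(s!)^2\<close> in \<open>D\<close>.\<close>
  also have "\<dots> = c * stat_bound n s \<xi>"
  proof -
    have "real (card (inj_tuples (2 * s) s) * fact s) = real (fact (2 * s))"
      by (simp only: card_inj_tuples)
    then have "real (card (tuple_pairs (2 * s) s)) * (fact s)\<^sup>2 = (fact (2 * s))\<^sup>2"
      by (simp add: card_tuple_pairs power_mult_distrib[symmetric])
    then show ?thesis by (simp add: D_def stat_bound_def mult_ac)
  qed
  finally show ?thesis .
qed

section \<open>Second moment and Dirichlet form of one component\<close>

definition tensor_stat ::
    "nat \<Rightarrow> nat \<Rightarrow> ((nat \<Rightarrow> nat) \<Rightarrow> (nat \<Rightarrow> nat) \<Rightarrow> real) \<Rightarrow> (nat \<Rightarrow> nat) \<Rightarrow> real" where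
  "tensor_stat n s \<xi> \<pi> = (\<Sum>i\<in>inj_tuples n s. \<xi> i (compose {1..s} \<pi> i))"

lemma perm_mean_square_tuple_sum:
  "perm_mean V (\<lambda>\<pi>. (\<Sum>i\<in>inj_tuples n s. h i * \<xi> i (compose {1..s} \<pi> i))\<^sup>2)
    = (\<Sum>x\<in>tuple_pairs n s. h (half s x True) * h (half s x False) *
        perm_mean V (\<lambda>\<pi>. pair_product s \<xi> x (\<lambda>a\<in>positions s. \<pi> (x a))))"
proof -
  have half: "half s (\<lambda>a\<in>positions s. \<pi> (x a)) b = compose {1..s} \<pi> (half s x b)"
    for \<pi> x b by (auto simp: half_def compose_def fun_eq_iff)
  have "(\<Sum>i\<in>inj_tuples n s. h i * \<xi> i (compose {1..s} \<pi> i))\<^sup>2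
      = (\<Sum>x\<in>tuple_pairs n s. h (half s x True) * h (half s x False) *
        pair_product s \<xi> x (\<lambda>a\<in>positions s. \<pi> (x a)))" for \<pi>
    unfolding power2_eq_square sum_product sum_tuple_pairs pair_product_def half
    by (simp add: mult_ac)
  then show ?thesis by (simp add: perm_mean_sum perm_mean_cmult)
qed

lemma tensor_stat_second_moment:
  assumes H: "hoeffding_tensor n s \<xi>" and s: "s \<ge> 1" and n: "n \<ge> 4 * s\<^sup>2"
  shows "perm_mean {1..n} (\<lambda>\<pi>. (tensor_stat n s \<xi> \<pi>)\<^sup>2) \<le> stat_bound n s \<xi>"
  using weighted_second_moment[OF assms, of "\<lambda>_. 1" 1]
    perm_mean_square_tuple_sum[where V = "{1..n}" and n = n and s = s and h = "\<lambda>_. 1" and \<xi> = \<xi>]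
  by (simp add: tensor_stat_def)

text \<open>Marks the tuples whose summand can change when the permutation is composed with the
  transposition of \<open>I\<close> and \<open>J\<close>.\<close>

definition hits :: "nat \<Rightarrow> nat \<Rightarrow> nat \<Rightarrow> (nat \<Rightarrow> nat) \<Rightarrow> real" where
  "hits s I J i = of_bool (I \<in> i ` {1..s} \<or> J \<in> i ` {1..s})"

text \<open>Members of one class differ by a permutation of the values, which is absorbed by
  relabelling the summation indices \<open>I\<close> and \<open>J\<close>.\<close>

lemma hits_weight_invariant:
  assumes x: "x \<in> tuple_pairs n s" and y: "y \<in> kernel_class (positions s) {1..n} x"
  shows "(\<Sum>I\<in>{1..n}. \<Sum>J\<in>{1..n}. hits s I J (half s y True) * hits s I J (half s y False))
    = (\<Sum>I\<in>{1..n}. \<Sum>J\<in>{1..n}. hits s I J (half s x True) * hits s I J (half s x False))"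
proof -
  have "x \<in> positions s \<rightarrow> {1..n}" using x by (auto simp: tuple_pairs_def)
  then obtain \<rho> where \<rho>: "\<rho> permutes {1..n}" "\<And>a. a \<in> positions s \<Longrightarrow> y a = \<rho> (x a)"
    using kernel_class_permutes[OF _ _ _ y] by auto
  have im: "half s y b ` {1..s} = \<rho> ` (half s x b ` {1..s})" for b
    using \<rho>(2) by (auto simp: half_def image_image intro!: image_cong)
  have h: "hits s (\<rho> I) (\<rho> J) (half s y b) = hits s I J (half s x b)" for I J b
    unfolding hits_def im using permutes_inj[OF \<rho>(1)] by (simp only: inj_image_mem_iff)
  have r: "(\<Sum>I\<in>{1..n}. f I) = (\<Sum>I\<in>{1..n}. f (\<rho> I))" for f :: "nat \<Rightarrow> real"
    using sum.permute[OF \<rho>(1), of f] by (simp add: o_def)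
  have "(\<Sum>I\<in>{1..n}. \<Sum>J\<in>{1..n}. hits s I J (half s y True) * hits s I J (half s y False))
      = (\<Sum>I\<in>{1..n}. \<Sum>J\<in>{1..n}. hits s (\<rho> I) (\<rho> J) (half s y True) * hits s (\<rho> I) (\<rho> J) (half s y False))"
    by (subst r, rule sum.cong[OF refl], rule r)
  then show ?thesis by (simp only: h)
qed

text \<open>Bounding the second indicator by 1, one of \<open>I\<close> and \<open>J\<close> must be
  among the at most \<open>s\<close> values of \<open>i\<close>, while the other is free.\<close>

lemma hits_weight_le:
  "(\<Sum>I\<in>{1..n}. \<Sum>J\<in>{1..n}. hits s I J i * hits s I J j) \<le> 2 * real s * real n"
proof -
  let ?S = "i ` {1..s} \<inter> {1..n}"
  have S: "real (card ?S) \<le> real s"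
    using card_mono[of "i ` {1..s}" ?S] card_image_le[of "{1..s}" i] by simp
  have "(\<Sum>I\<in>{1..n}. \<Sum>J\<in>{1..n}. hits s I J i * hits s I J j)
      \<le> (\<Sum>I\<in>{1..n}. \<Sum>J\<in>{1..n}. of_bool (I \<in> i ` {1..s}) + of_bool (J \<in> i ` {1..s}))"
    by (intro sum_mono) (auto simp: hits_def)
  also have "\<dots> = 2 * real (card ?S) * real n"
    by (simp add: sum.distrib sum_distrib_left[symmetric] Int_commute)
  also have "\<dots> \<le> 2 * real s * real n"
    using S by (intro mult_right_mono mult_left_mono) auto
  finally show ?thesis .
qed

lemma compose_transpose_not_hit:
  assumes "hits s I J i = 0"
  shows "compose {1..s} (\<pi> \<circ> Transposition.transpose I J) i = compose {1..s} \<pi> i"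
proof
  fix r show "compose {1..s} (\<pi> \<circ> Transposition.transpose I J) i r = compose {1..s} \<pi> i r"
  proof (cases "r \<in> {1..s}")
    case True
    then have "i r \<noteq> I" "i r \<noteq> J" using assms by (auto simp: hits_def)
    then show ?thesis by (simp add: compose_def)
  qed (auto simp: compose_def)
qed

text \<open>Summands that are not hit cancel in the difference. The two remaining sums have the same
  distribution, so the squared difference costs a factor 4 over the second moment of one of them,
  and summing over \<open>I\<close> and \<open>J\<close> turns the indicators into a weight of at
  most \<open>2 s n\<close>.\<close>

lemma tensor_stat_Dirichlet_form:
  assumes H: "hoeffding_tensor n s \<xi>" and s: "s \<ge> 1" and n: "n \<ge> 4 * s\<^sup>2"
  shows "perm_mean {1..n} (\<lambda>\<pi>. \<Sum>I\<in>{1..n}. \<Sum>J\<in>{1..n}.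
      (tensor_stat n s \<xi> \<pi> - tensor_stat n s \<xi> (\<pi> \<circ> Transposition.transpose I J))\<^sup>2)
    \<le> 8 * real s * real n * stat_bound n s \<xi>"
proof -
  define A where "A I J \<pi> = (\<Sum>i\<in>inj_tuples n s. hits s I J i * \<xi> i (compose {1..s} \<pi> i))" for I J \<pi>
  let ?m = "\<lambda>x. perm_mean {1..n} (\<lambda>\<pi>. pair_product s \<xi> x (\<lambda>a\<in>positions s. \<pi> (x a)))"
  have diff: "tensor_stat n s \<xi> \<pi> - tensor_stat n s \<xi> (\<pi> \<circ> Transposition.transpose I J)
      = A I J \<pi> - A I J (\<pi> \<circ> Transposition.transpose I J)" for I J \<pi>
    unfolding tensor_stat_def A_def sum_subtractf[symmetric]
  proof (rule sum.cong[OF refl])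
    fix i
    consider "hits s I J i = 0" | "hits s I J i = 1" unfolding hits_def of_bool_def by argo
    then show "\<xi> i (compose {1..s} \<pi> i) - \<xi> i (compose {1..s} (\<pi> \<circ> Transposition.transpose I J) i)
      = hits s I J i * \<xi> i (compose {1..s} \<pi> i)
        - hits s I J i * \<xi> i (compose {1..s} (\<pi> \<circ> Transposition.transpose I J) i)"
      by cases (simp_all add: compose_transpose_not_hit del: One_nat_def)
  qed
  have IJ: "perm_mean {1..n} (\<lambda>\<pi>. (tensor_stat n s \<xi> \<pi> - tensor_stat n s \<xi> (\<pi> \<circ> Transposition.transpose I J))\<^sup>2)
      \<le> 4 * perm_mean {1..n} (\<lambda>\<pi>. (A I J \<pi>)\<^sup>2)" if "I \<in> {1..n}" "J \<in> {1..n}" for I J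
  proof -
    have t: "Transposition.transpose I J permutes {1..n}" using that by (rule permutes_swap_id)
    have "(a - b)\<^sup>2 \<le> 2 * a\<^sup>2 + 2 * b\<^sup>2" for a b :: real
      using zero_le_power2[of "a + b"] by (simp add: power2_eq_square algebra_simps)
    then have "perm_mean {1..n} (\<lambda>\<pi>. (A I J \<pi> - A I J (\<pi> \<circ> Transposition.transpose I J))\<^sup>2)
        \<le> perm_mean {1..n} (\<lambda>\<pi>. 2 * (A I J \<pi>)\<^sup>2 + 2 * (A I J (\<pi> \<circ> Transposition.transpose I J))\<^sup>2)"
      by (intro perm_mean_mono)
    also have "\<dots> = 4 * perm_mean {1..n} (\<lambda>\<pi>. (A I J \<pi>)\<^sup>2)"
      using perm_mean_compose_right[OF t, of "\<lambda>\<pi>. (A I J \<pi>)\<^sup>2"]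
      by (simp add: perm_mean_add perm_mean_cmult)
    finally show ?thesis by (simp only: diff)
  qed
  have "perm_mean {1..n} (\<lambda>\<pi>. \<Sum>I\<in>{1..n}. \<Sum>J\<in>{1..n}.
      (tensor_stat n s \<xi> \<pi> - tensor_stat n s \<xi> (\<pi> \<circ> Transposition.transpose I J))\<^sup>2)
    \<le> (\<Sum>I\<in>{1..n}. \<Sum>J\<in>{1..n}. 4 * perm_mean {1..n} (\<lambda>\<pi>. (A I J \<pi>)\<^sup>2))"
    unfolding perm_mean_sum by (intro sum_mono IJ)
  also have "\<dots> = 4 * (\<Sum>I\<in>{1..n}. \<Sum>J\<in>{1..n}. \<Sum>x\<in>tuple_pairs n s.
      hits s I J (half s x True) * hits s I J (half s x False) * ?m x)"
    unfolding A_def perm_mean_square_tuple_sum by (simp add: sum_distrib_left)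
  also have "\<dots> = 4 * (\<Sum>x\<in>tuple_pairs n s. (\<Sum>I\<in>{1..n}. \<Sum>J\<in>{1..n}.
      hits s I J (half s x True) * hits s I J (half s x False)) * ?m x)"
    unfolding sum_distrib_right by (subst sum.swap, subst (2) sum.swap) (rule refl)
  also have "\<dots> \<le> 4 * (2 * real s * real n * stat_bound n s \<xi>)"
    by (intro mult_left_mono weighted_second_moment[OF H s n] hits_weight_invariant hits_weight_le
        sum_nonneg) (auto simp: hits_def)
  finally show ?thesis by (simp add: mult_ac)
qed

section \<open>The linear statistic\<close>

lemma sum_square_differences:
  fixes f :: "'a \<Rightarrow> real"
  shows "(\<Sum>x\<in>A. \<Sum>y\<in>A. (f x - f y)\<^sup>2) = 2 * real (card A) * (\<Sum>x\<in>A. (f x)\<^sup>2) - 2 * (\<Sum>x\<in>A. f x)\<^sup>2"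
proof -
  have "(\<Sum>x\<in>A. \<Sum>y\<in>A. (f x - f y)\<^sup>2)
      = (\<Sum>x\<in>A. \<Sum>y\<in>A. (f x)\<^sup>2) + (\<Sum>x\<in>A. \<Sum>y\<in>A. (f y)\<^sup>2) - 2 * (\<Sum>x\<in>A. \<Sum>y\<in>A. f x * f y)"
    by (simp add: power2_diff sum.distrib sum_subtractf sum_distrib_left mult.assoc del: sum_constant)
  then show ?thesis
    by (simp add: sum_distrib_left[symmetric] sum_distrib_right[symmetric] power2_eq_square)
qed

lemma abs_sum4_cube_le:
  fixes w x y z :: real
  shows "\<bar>w + x - y - z\<bar> ^ 3 \<le> 16 * (\<bar>w\<bar> ^ 3 + \<bar>x\<bar> ^ 3 + \<bar>y\<bar> ^ 3 + \<bar>z\<bar> ^ 3)"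
proof -
  have two: "(s + t) ^ 3 \<le> 4 * (s ^ 3 + t ^ 3)" if "0 \<le> s" "0 \<le> t" for s t :: real
  proof -
    have "4 * (s ^ 3 + t ^ 3) - (s + t) ^ 3 = 3 * ((s + t) * (s - t)\<^sup>2)"
      by (simp add: power2_eq_square power3_eq_cube algebra_simps)
    moreover have "0 \<le> (s + t) * (s - t)\<^sup>2" using that by simp
    ultimately show ?thesis by linarith
  qed
  have "\<bar>w + x - y - z\<bar> ^ 3 \<le> ((\<bar>w\<bar> + \<bar>x\<bar>) + (\<bar>y\<bar> + \<bar>z\<bar>)) ^ 3"
    by (intro power_mono) auto
  also have "\<dots> \<le> 4 * ((\<bar>w\<bar> + \<bar>x\<bar>) ^ 3 + (\<bar>y\<bar> + \<bar>z\<bar>) ^ 3)" by (intro two) auto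
  also have "\<dots> \<le> 4 * (4 * (\<bar>w\<bar> ^ 3 + \<bar>x\<bar> ^ 3) + 4 * (\<bar>y\<bar> ^ 3 + \<bar>z\<bar> ^ 3))"
    by (intro mult_left_mono add_mono two) auto
  finally show ?thesis by simp
qed

text \<open>
  Pairs that share an index are paid for separately, so that the rest can be compared
  with independent indices using only that \<open>G\<close> is nonnegative.
\<close>

lemma sum_symmetric_square_le:
  fixes G :: "'a \<Rightarrow> 'a \<Rightarrow> real"
  assumes G0: "\<And>i j. 0 \<le> G i j" and diag: "\<And>i. G i i = 0" and sym: "\<And>i j. G i j = G j i"
    and A: "finite A"
  shows "(\<Sum>i\<in>A. \<Sum>j\<in>A. G i j)\<^sup>2 \<le> 4 * (\<Sum>i\<in>A. (\<Sum>j\<in>A. G i j)\<^sup>2)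
    + (\<Sum>i\<in>A. \<Sum>j\<in>A. \<Sum>k\<in>A. \<Sum>l\<in>A. of_bool (card {i, j, k, l} = 4) * (G i j * G k l))"
proof -
  have le: "G i j * G k l \<le> of_bool (i = k) * (G i j * G k l) + of_bool (i = l) * (G i j * G k l)
      + of_bool (j = k) * (G i j * G k l) + of_bool (j = l) * (G i j * G k l)
      + of_bool (card {i, j, k, l} = 4) * (G i j * G k l)" for i j k l
  proof -
    have nn: "0 \<le> G i j * G k l" using G0 by simp
    consider "i = j" | "k = l" | "i = k" | "i = l" | "j = k" | "j = l" | "card {i, j, k, l} = 4"
      by (cases "distinct [i, j, k, l]") (auto dest: distinct_card)
    then show ?thesis using nn by cases (auto simp: diag)
  qed
  have square: "(\<Sum>i\<in>A. (\<Sum>j\<in>A. G i j)\<^sup>2) = (\<Sum>i\<in>A. \<Sum>j\<in>A. \<Sum>l\<in>A. G i j * G i l)"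
    by (simp add: power2_eq_square sum_product)
  have ik: "(\<Sum>i\<in>A. \<Sum>j\<in>A. \<Sum>k\<in>A. \<Sum>l\<in>A. of_bool (i = k) * (G i j * G k l))
      = (\<Sum>i\<in>A. (\<Sum>j\<in>A. G i j)\<^sup>2)"
    unfolding square sum_distrib_left[symmetric]
    by (intro sum.cong refl) (simp add: A of_bool_def if_distrib[of "\<lambda>x. x * _"] sum.delta cong: if_cong)
  have il: "(\<Sum>i\<in>A. \<Sum>j\<in>A. \<Sum>k\<in>A. \<Sum>l\<in>A. of_bool (i = l) * (G i j * G k l))
      = (\<Sum>i\<in>A. \<Sum>j\<in>A. \<Sum>k\<in>A. \<Sum>l\<in>A. of_bool (i = k) * (G i j * G k l))"
    by (rule sum.cong[OF refl], rule sum.cong[OF refl], subst sum.swap, intro sum.cong refl)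
      (metis sym)
  have jk: "(\<Sum>i\<in>A. \<Sum>j\<in>A. \<Sum>k\<in>A. \<Sum>l\<in>A. of_bool (j = k) * (G i j * G k l))
      = (\<Sum>i\<in>A. \<Sum>j\<in>A. \<Sum>k\<in>A. \<Sum>l\<in>A. of_bool (i = k) * (G i j * G k l))"
    by (subst sum.swap, intro sum.cong refl) (metis sym)
  have jl: "(\<Sum>i\<in>A. \<Sum>j\<in>A. \<Sum>k\<in>A. \<Sum>l\<in>A. of_bool (j = l) * (G i j * G k l))
      = (\<Sum>i\<in>A. \<Sum>j\<in>A. \<Sum>k\<in>A. \<Sum>l\<in>A. of_bool (i = l) * (G i j * G k l))"
    by (subst sum.swap, intro sum.cong refl) (metis sym)
  have "(\<Sum>i\<in>A. \<Sum>j\<in>A. G i j)\<^sup>2 = (\<Sum>i\<in>A. \<Sum>j\<in>A. \<Sum>k\<in>A. \<Sum>l\<in>A. G i j * G k l)"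
    unfolding power2_eq_square sum_product by (rule sum.cong[OF refl], rule sum.swap)
  also have "\<dots> \<le> (\<Sum>i\<in>A. \<Sum>j\<in>A. \<Sum>k\<in>A. \<Sum>l\<in>A. of_bool (i = k) * (G i j * G k l)
      + of_bool (i = l) * (G i j * G k l) + of_bool (j = k) * (G i j * G k l)
      + of_bool (j = l) * (G i j * G k l) + of_bool (card {i, j, k, l} = 4) * (G i j * G k l))"
    by (intro sum_mono le)
  also have "\<dots> = 4 * (\<Sum>i\<in>A. (\<Sum>j\<in>A. G i j)\<^sup>2)
    + (\<Sum>i\<in>A. \<Sum>j\<in>A. \<Sum>k\<in>A. \<Sum>l\<in>A. of_bool (card {i, j, k, l} = 4) * (G i j * G k l))"
    unfolding sum.distrib jl jk il ik by simp
  finally show ?thesis .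
qed

locale centered_matrix =
  fixes n :: nat and a :: "nat \<Rightarrow> nat \<Rightarrow> real"
  assumes n4: "n \<ge> 4"
    and row: "i \<in> {1..n} \<Longrightarrow> (\<Sum>j\<in>{1..n}. a i j) = 0"
    and col: "j \<in> {1..n} \<Longrightarrow> (\<Sum>i\<in>{1..n}. a i j) = 0"
    and norm: "(\<Sum>i\<in>{1..n}. \<Sum>j\<in>{1..n}. (a i j)\<^sup>2) = real n - 1"
begin

abbreviation "V \<equiv> {1..n}"

definition T :: "(nat \<Rightarrow> nat) \<Rightarrow> real" where "T \<pi> = (\<Sum>i\<in>V. a i (\<pi> i))"

text \<open>The increment of \<open>T\<close> when the values \<open>p\<close> and \<open>q\<close>
  at \<open>I\<close> and \<open>J\<close> are exchanged; see \<open>T_diff\<close>.\<close>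

definition D :: "nat \<Rightarrow> nat \<Rightarrow> nat \<Rightarrow> nat \<Rightarrow> real" where "D I J p q = a I p + a J q - a I q - a J p"

definition \<gamma> :: real where "\<gamma> = (\<Sum>i\<in>V. \<Sum>j\<in>V. \<bar>a i j\<bar> ^ 3)"

text \<open>The factor 32 is chosen so that truncation loses at most a sixth of the mean of
  \<open>\<eta>\<close>; see \<open>perm_mean_eta_ge\<close>.\<close>

definition \<delta> :: real where "\<delta> = 32 * \<gamma> / n"

text \<open>A square with linear growth beyond \<open>\<delta>\<close>, since a function clipped at
  distance \<open>\<delta>\<close> need not move further than \<open>\<delta>\<close>.\<close>

definition g :: "real \<Rightarrow> real" where "g x = \<bar>x\<bar> * min \<bar>x\<bar> \<delta>"

text \<open>The truncated conditional variance of the exchangeable pair; the normalization gives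
  mean 1 if \<open>g\<close> is replaced by the square.\<close>

definition \<eta> :: "(nat \<Rightarrow> nat) \<Rightarrow> real" where
  "\<eta> \<pi> = (\<Sum>I\<in>V. \<Sum>J\<in>V. g (D I J (\<pi> I) (\<pi> J))) / (4 * n)"

lemma D_diag [simp]: "D I I p q = 0" "D I J p p = 0"
  by (simp_all add: D_def)

lemma D_sym: "D J I q p = D I J p q"
  by (simp add: D_def)

lemma sum_perm: "\<pi> permutes V \<Longrightarrow> (\<Sum>i\<in>V. f (\<pi> i)) = (\<Sum>i\<in>V. f i)" for f :: "nat \<Rightarrow> real"
  using sum.permute[of \<pi> V f] by (simp add: o_def)

lemma T_diff:
  assumes "I \<in> V" "J \<in> V"
  shows "T \<pi> - T (\<pi> \<circ> Transposition.transpose I J) = D I J (\<pi> I) (\<pi> J)"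
proof (cases "I = J")
  case False
  have "T \<pi> - T (\<pi> \<circ> Transposition.transpose I J)
      = (\<Sum>i\<in>V. a i (\<pi> i) - a i (\<pi> (Transposition.transpose I J i)))"
    by (simp add: T_def sum_subtractf)
  also have "\<dots> = (\<Sum>i\<in>{I, J}. a i (\<pi> i) - a i (\<pi> (Transposition.transpose I J i)))"
    using assms by (intro sum.mono_neutral_right) auto
  finally show ?thesis using False by (simp add: D_def)
qed simp

text \<open>Stein's linear regression condition: for independent uniform \<open>I\<close> and
  \<open>J\<close> the conditional mean increment is \<open>2 T / n\<close>. The mixed terms vanish
  because a permuted row still sums to zero.\<close>

lemma sum_D:
  assumes "\<pi> permutes V"
  shows "(\<Sum>I\<in>V. \<Sum>J\<in>V. D I J (\<pi> I) (\<pi> J)) = 2 * real n * T \<pi>"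
proof -
  have "(\<Sum>I\<in>V. \<Sum>J\<in>V. D I J (\<pi> I) (\<pi> J))
      = (\<Sum>I\<in>V. \<Sum>J\<in>V. a I (\<pi> I)) + (\<Sum>I\<in>V. \<Sum>J\<in>V. a J (\<pi> J))
        - (\<Sum>I\<in>V. \<Sum>J\<in>V. a I (\<pi> J)) - (\<Sum>I\<in>V. \<Sum>J\<in>V. a J (\<pi> I))"
    by (simp add: D_def sum.distrib sum_subtractf del: sum_constant)
  also have zero: "(\<Sum>I\<in>V. \<Sum>J\<in>V. a I (\<pi> J)) = 0"
  proof (rule sum.neutral, rule ballI)
    fix I assume "I \<in> V"
    then show "(\<Sum>J\<in>V. a I (\<pi> J)) = 0" using sum_perm[OF assms, of "a I"] row[of I] by simp
  qed
  also have "(\<Sum>I\<in>V. \<Sum>J\<in>V. a J (\<pi> I)) = 0"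
    by (subst sum.swap) (rule zero)
  finally show ?thesis by (simp add: T_def sum_distrib_left[symmetric])
qed

text \<open>\<open>D\<close> is a difference of row differences. The identity
  \<open>sum_square_differences\<close> is used first over \<open>p, q\<close> and then over
  \<open>I, J\<close>; centering kills its correction term both times.\<close>

lemma sum_D_square: "(\<Sum>I\<in>V. \<Sum>J\<in>V. \<Sum>p\<in>V. \<Sum>q\<in>V. (D I J p q)\<^sup>2) = 4 * (real n)\<^sup>2 * (real n - 1)"
proof -
  have "(\<Sum>p\<in>V. \<Sum>q\<in>V. (D I J p q)\<^sup>2) = 2 * real n * (\<Sum>p\<in>V. (a I p - a J p)\<^sup>2)"
    if "I \<in> V" "J \<in> V" for I J
  proof -
    have "(\<Sum>p\<in>V. \<Sum>q\<in>V. (D I J p q)\<^sup>2) = (\<Sum>p\<in>V. \<Sum>q\<in>V. ((a I p - a J p) - (a I q - a J q))\<^sup>2)"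
      by (simp add: D_def algebra_simps)
    also have "\<dots> = 2 * real n * (\<Sum>p\<in>V. (a I p - a J p)\<^sup>2)"
      unfolding sum_square_differences using row that by (simp add: sum_subtractf)
    finally show ?thesis .
  qed
  then have "(\<Sum>I\<in>V. \<Sum>J\<in>V. \<Sum>p\<in>V. \<Sum>q\<in>V. (D I J p q)\<^sup>2)
      = (\<Sum>I\<in>V. \<Sum>J\<in>V. 2 * real n * (\<Sum>p\<in>V. (a I p - a J p)\<^sup>2))"
    by (intro sum.cong refl)
  also have "\<dots> = 2 * real n * (\<Sum>I\<in>V. \<Sum>J\<in>V. \<Sum>p\<in>V. (a I p - a J p)\<^sup>2)"
    by (simp add: sum_distrib_left)
  also have "(\<Sum>I\<in>V. \<Sum>J\<in>V. \<Sum>p\<in>V. (a I p - a J p)\<^sup>2) = (\<Sum>p\<in>V. \<Sum>I\<in>V. \<Sum>J\<in>V. (a I p - a J p)\<^sup>2)"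
    by (subst (2) sum.swap, subst sum.swap) (rule refl)
  also have "\<dots> = (\<Sum>p\<in>V. 2 * real n * (\<Sum>I\<in>V. (a I p)\<^sup>2))"
    by (intro sum.cong refl, subst sum_square_differences) (simp add: col del: One_nat_def)
  also have "\<dots> = 2 * real n * (\<Sum>i\<in>V. \<Sum>j\<in>V. (a i j)\<^sup>2)"
    unfolding sum_distrib_left[symmetric] by (subst sum.swap) (rule refl)
  finally show ?thesis unfolding norm by (simp add: power2_eq_square)
qed

lemma sum_D_cube: "(\<Sum>I\<in>V. \<Sum>J\<in>V. \<Sum>p\<in>V. \<Sum>q\<in>V. \<bar>D I J p q\<bar> ^ 3) \<le> 64 * (real n)\<^sup>2 * \<gamma>"
proof -
  have "(\<Sum>I\<in>V. \<Sum>J\<in>V. \<Sum>p\<in>V. \<Sum>q\<in>V. \<bar>D I J p q\<bar> ^ 3)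
      \<le> (\<Sum>I\<in>V. \<Sum>J\<in>V. \<Sum>p\<in>V. \<Sum>q\<in>V.
          16 * (\<bar>a I p\<bar> ^ 3 + \<bar>a J q\<bar> ^ 3 + \<bar>a I q\<bar> ^ 3 + \<bar>a J p\<bar> ^ 3))"
    unfolding D_def by (intro sum_mono abs_sum4_cube_le)
  also have "\<dots> = 16 * ((\<Sum>I\<in>V. \<Sum>J\<in>V. \<Sum>p\<in>V. \<Sum>q\<in>V. \<bar>a I p\<bar> ^ 3)
      + (\<Sum>I\<in>V. \<Sum>J\<in>V. \<Sum>p\<in>V. \<Sum>q\<in>V. \<bar>a J q\<bar> ^ 3)
      + (\<Sum>I\<in>V. \<Sum>J\<in>V. \<Sum>p\<in>V. \<Sum>q\<in>V. \<bar>a I q\<bar> ^ 3)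
      + (\<Sum>I\<in>V. \<Sum>J\<in>V. \<Sum>p\<in>V. \<Sum>q\<in>V. \<bar>a J p\<bar> ^ 3))"
    by (simp only: sum_distrib_left[symmetric] sum.distrib)
  also have "\<dots> = 64 * (real n)\<^sup>2 * \<gamma>"
    by (simp add: \<gamma>_def sum_distrib_left[symmetric] power2_eq_square)
  finally show ?thesis .
qed

lemma perm_mean_sum_D:
  assumes "h 0 = 0"
  shows "perm_mean V (\<lambda>\<pi>. \<Sum>I\<in>V. \<Sum>J\<in>V. h (D I J (\<pi> I) (\<pi> J)))
    = (\<Sum>I\<in>V. \<Sum>J\<in>V. \<Sum>p\<in>V. \<Sum>q\<in>V. h (D I J p q)) / (real n * (real n - 1))"
proof -
  have "perm_mean V (\<lambda>\<pi>. h (D I J (\<pi> I) (\<pi> J)))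
      = (\<Sum>p\<in>V. \<Sum>q\<in>V. h (D I J p q)) / (real n * (real n - 1))" if "I \<in> V" "J \<in> V" for I J
  proof (cases "I = J")
    case True
    then show ?thesis using assms by (simp add: perm_mean_const)
  next
    case False
    then show ?thesis
      using perm_mean_two[of V I J "\<lambda>p q. h (D I J p q)"] that assms by simp
  qed
  then show ?thesis
    by (simp add: perm_mean_sum sum_divide_distrib)
qed

lemma perm_mean_D_square: "perm_mean V (\<lambda>\<pi>. \<Sum>I\<in>V. \<Sum>J\<in>V. (D I J (\<pi> I) (\<pi> J))\<^sup>2) = 4 * real n"
proof -
  have "perm_mean V (\<lambda>\<pi>. \<Sum>I\<in>V. \<Sum>J\<in>V. (D I J (\<pi> I) (\<pi> J))\<^sup>2)
      = (\<Sum>I\<in>V. \<Sum>J\<in>V. \<Sum>p\<in>V. \<Sum>q\<in>V. (D I J p q)\<^sup>2) / (real n * (real n - 1))"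
    by (rule perm_mean_sum_D) simp
  also have "\<dots> = 4 * real n"
    unfolding sum_D_square using n4 by (simp add: power2_eq_square)
  finally show ?thesis .
qed

lemma perm_mean_D_cube:
  "perm_mean V (\<lambda>\<pi>. \<Sum>I\<in>V. \<Sum>J\<in>V. \<bar>D I J (\<pi> I) (\<pi> J)\<bar> ^ 3) \<le> 256 / 3 * \<gamma>"
proof -
  have \<gamma>0: "0 \<le> \<gamma>" by (auto simp: \<gamma>_def intro!: sum_nonneg)
  have "perm_mean V (\<lambda>\<pi>. \<Sum>I\<in>V. \<Sum>J\<in>V. \<bar>D I J (\<pi> I) (\<pi> J)\<bar> ^ 3)
      = (\<Sum>I\<in>V. \<Sum>J\<in>V. \<Sum>p\<in>V. \<Sum>q\<in>V. \<bar>D I J p q\<bar> ^ 3) / (real n * (real n - 1))"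
    by (rule perm_mean_sum_D) simp
  also have "\<dots> \<le> 64 * (real n)\<^sup>2 * \<gamma> / (real n * (real n - 1))"
    by (rule divide_right_mono[OF sum_D_cube]) (use n4 in simp)
  also have "\<dots> = 64 * (real n / (real n - 1)) * \<gamma>"
    using n4 by (simp add: power2_eq_square)
  \<comment> \<open>\<open>n / (n - 1)\<close> is at most 4/3 from \<open>n = 4\<close> on.\<close>
  also have "\<dots> \<le> 64 * (4 / 3) * \<gamma>"
    using n4 \<gamma>0 by (intro mult_right_mono mult_left_mono) (auto simp: field_simps)
  finally show ?thesis by simp
qed

text \<open>By exchangeability the mean of \<open>(T - T')^2\<close> is twice that of
  \<open>T (T - T')\<close>. Summed over all pairs, the left side is \<open>4 n\<close> and the
  right side is \<open>4 n\<close> times the second moment by \<open>sum_D\<close>.\<close>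

lemma perm_mean_T_square: "perm_mean V (\<lambda>\<pi>. (T \<pi>)\<^sup>2) = 1"
proof -
  let ?t = "\<lambda>I J \<pi>. \<pi> \<circ> Transposition.transpose I J"
  have "perm_mean V (\<lambda>\<pi>. (T \<pi> - T (?t I J \<pi>))\<^sup>2) = perm_mean V (\<lambda>\<pi>. 2 * (T \<pi> * (T \<pi> - T (?t I J \<pi>))))"
    if "I \<in> V" "J \<in> V" for I J
  proof -
    have "perm_mean V (\<lambda>\<pi>. (T (?t I J \<pi>))\<^sup>2) = perm_mean V (\<lambda>\<pi>. (T \<pi>)\<^sup>2)"
      using perm_mean_compose_right[OF permutes_swap_id[OF that], of "\<lambda>\<pi>. (T \<pi>)\<^sup>2"] .
    moreover have "perm_mean V (\<lambda>\<pi>. (T \<pi> - T (?t I J \<pi>))\<^sup>2)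
        = perm_mean V (\<lambda>\<pi>. 2 * (T \<pi> * (T \<pi> - T (?t I J \<pi>))) + ((T (?t I J \<pi>))\<^sup>2 - (T \<pi>)\<^sup>2))"
      by (intro perm_mean_cong) (simp add: power2_eq_square algebra_simps)
    ultimately show ?thesis by (simp add: perm_mean_add perm_mean_diff)
  qed
  then have "perm_mean V (\<lambda>\<pi>. \<Sum>I\<in>V. \<Sum>J\<in>V. (T \<pi> - T (?t I J \<pi>))\<^sup>2)
      = perm_mean V (\<lambda>\<pi>. \<Sum>I\<in>V. \<Sum>J\<in>V. 2 * (T \<pi> * (T \<pi> - T (?t I J \<pi>))))"
    unfolding perm_mean_sum by (intro sum.cong refl)
  moreover have "perm_mean V (\<lambda>\<pi>. \<Sum>I\<in>V. \<Sum>J\<in>V. (T \<pi> - T (?t I J \<pi>))\<^sup>2) = 4 * real n"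
    using perm_mean_D_square by (simp add: T_diff del: One_nat_def)
  moreover have "perm_mean V (\<lambda>\<pi>. \<Sum>I\<in>V. \<Sum>J\<in>V. 2 * (T \<pi> * (T \<pi> - T (?t I J \<pi>))))
      = perm_mean V (\<lambda>\<pi>. 4 * real n * (T \<pi>)\<^sup>2)"
  proof (rule perm_mean_cong)
    fix \<pi> assume "\<pi> permutes V"
    have "(\<Sum>I\<in>V. \<Sum>J\<in>V. 2 * (T \<pi> * (T \<pi> - T (?t I J \<pi>))))
        = 2 * (T \<pi> * (\<Sum>I\<in>V. \<Sum>J\<in>V. D I J (\<pi> I) (\<pi> J)))"
      by (simp add: T_diff sum_distrib_left del: One_nat_def)
    then show "(\<Sum>I\<in>V. \<Sum>J\<in>V. 2 * (T \<pi> * (T \<pi> - T (?t I J \<pi>)))) = 4 * real n * (T \<pi>)\<^sup>2"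
      using sum_D[OF \<open>\<pi> permutes V\<close>] by (simp add: power2_eq_square)
  qed
  ultimately show ?thesis using n4 by (simp add: perm_mean_cmult)
qed

text \<open>Makes the error terms of order \<open>1 / n\<close> negligible against \<open>\<gamma> / n\<close>.\<close>

lemma gamma_ge: "1 / 3 \<le> \<gamma>"
proof -
  \<comment> \<open>This \<open>t\<close> makes the error \<open>1 / t^2\<close>, summed over all
    \<open>n^2\<close> entries, equal to \<open>n / 2\<close>, about half of the total
    \<open>n - 1\<close>.\<close>
  define t where "t = sqrt (2 * real n)"
  have t: "0 < t" "t\<^sup>2 = 2 * real n" using n4 by (auto simp: t_def)
  have "x\<^sup>2 \<le> t * x ^ 3 + 1 / t\<^sup>2" if "0 \<le> x" for x
  proof (cases "1 \<le> t * x")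
    case True
    then have "x\<^sup>2 * 1 \<le> x\<^sup>2 * (t * x)" by (intro mult_left_mono) auto
    then have "x\<^sup>2 \<le> t * x ^ 3" by (simp add: power2_eq_square power3_eq_cube mult_ac)
    then show ?thesis by (simp add: add_increasing2)
  next
    case False
    then have "(t * x)\<^sup>2 \<le> 1" using that t by (simp add: power_le_one)
    then have "x\<^sup>2 \<le> 1 / t\<^sup>2" using t(1) by (simp add: field_simps)
    then show ?thesis using that t by (simp add: add_increasing)
  qed
  then have "(a i j)\<^sup>2 \<le> t * \<bar>a i j\<bar> ^ 3 + 1 / t\<^sup>2" for i j
    by (metis abs_ge_zero power2_abs)
  then have "(\<Sum>i\<in>V. \<Sum>j\<in>V. (a i j)\<^sup>2) \<le> (\<Sum>i\<in>V. \<Sum>j\<in>V. t * \<bar>a i j\<bar> ^ 3 + 1 / t\<^sup>2)"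
    by (intro sum_mono)
  also have "\<dots> = t * \<gamma> + (real n)\<^sup>2 / t\<^sup>2"
    by (simp add: \<gamma>_def sum.distrib sum_distrib_left power2_eq_square)
  also have "(real n)\<^sup>2 / t\<^sup>2 = real n / 2" using n4 unfolding t(2) by (simp add: power2_eq_square)
  finally have le: "real n / 2 - 1 \<le> t * \<gamma>" unfolding norm by simp
  have "t \<le> 3 * (real n / 2 - 1)"
  proof -
    have "0 \<le> (real n - 4) * (9 * real n - 8)" using n4 by (intro mult_nonneg_nonneg) auto
    moreover have "(3 * (real n / 2 - 1))\<^sup>2 = (9 * (real n * real n) - 36 * real n + 36) / 4"
      by (simp add: power2_eq_square field_simps)
    ultimately have "2 * real n \<le> (3 * (real n / 2 - 1))\<^sup>2" by (simp add: algebra_simps)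
    then show ?thesis unfolding t_def using n4 by (intro real_le_lsqrt) auto
  qed
  then have "t * (1 / 3) \<le> t * \<gamma>" using le by simp
  then show ?thesis using t(1) mult_le_cancel_left_pos by blast
qed

end

section \<open>The concentration inequality\<close>

context centered_matrix begin

section \<open>Truncated squared increments and their fluctuations\<close>

lemma gamma_pos: "0 < \<gamma>"
  using gamma_ge by linarith

lemma delta_pos: "0 < \<delta>"
  using gamma_pos n4 by (simp add: \<delta>_def)

lemma g_zero [simp]: "g 0 = 0"
  by (simp add: g_def)

lemma g_nonneg: "0 \<le> g x"
  using delta_pos by (simp add: g_def)

lemma g_le_square: "g x \<le> x\<^sup>2"
proof -
  have "\<bar>x\<bar> * min \<bar>x\<bar> \<delta> \<le> \<bar>x\<bar> * \<bar>x\<bar>" by (intro mult_left_mono) auto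
  then show ?thesis by (simp add: g_def power2_eq_square)
qed

lemma g_square_le: "(g x)\<^sup>2 \<le> \<delta>\<^sup>2 * x\<^sup>2"
proof -
  have "g x \<le> \<bar>x\<bar> * \<delta>" unfolding g_def by (intro mult_left_mono) auto
  then have "(g x)\<^sup>2 \<le> (\<bar>x\<bar> * \<delta>)\<^sup>2" using g_nonneg by (intro power_mono)
  then show ?thesis by (simp add: power_mult_distrib mult.commute)
qed

text \<open>The parabola \<open>t - t^2 / (4 \<delta>)\<close> lies below both \<open>t\<close> and
  \<open>\<delta>\<close>: its maximum, at \<open>t = 2 \<delta>\<close>, is exactly
  \<open>\<delta>\<close>. So truncation costs only a third moment.\<close>

lemma g_ge: "x\<^sup>2 - \<bar>x\<bar> ^ 3 / (4 * \<delta>) \<le> g x"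
proof -
  let ?t = "\<bar>x\<bar>"
  have "0 \<le> (?t - 2 * \<delta>)\<^sup>2" by simp
  then have "4 * \<delta> * ?t - ?t\<^sup>2 \<le> 4 * \<delta> * \<delta>" by (simp add: power2_eq_square algebra_simps)
  then have "?t - ?t\<^sup>2 / (4 * \<delta>) \<le> \<delta>" using delta_pos by (simp add: field_simps)
  moreover have "?t - ?t\<^sup>2 / (4 * \<delta>) \<le> ?t" using delta_pos by simp
  ultimately have "?t * (?t - ?t\<^sup>2 / (4 * \<delta>)) \<le> ?t * min ?t \<delta>"
    by (intro mult_left_mono) auto
  then show ?thesis
    by (simp add: g_def power2_eq_square power3_eq_cube right_diff_distrib)
qed

lemma eta_nonneg: "0 \<le> \<eta> \<pi>"
  unfolding \<eta>_def by (intro divide_nonneg_nonneg sum_nonneg g_nonneg) auto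

lemma perm_mean_eta:
  "perm_mean V \<eta> = perm_mean V (\<lambda>\<pi>. \<Sum>I\<in>V. \<Sum>J\<in>V. g (D I J (\<pi> I) (\<pi> J))) / (4 * real n)"
  using perm_mean_cmult[of V "1 / (4 * real n)" "\<lambda>\<pi>. \<Sum>I\<in>V. \<Sum>J\<in>V. g (D I J (\<pi> I) (\<pi> J))"]
  by (simp add: \<eta>_def[abs_def])

lemma perm_mean_eta_le: "perm_mean V \<eta> \<le> 1"
proof -
  have "perm_mean V (\<lambda>\<pi>. \<Sum>I\<in>V. \<Sum>J\<in>V. g (D I J (\<pi> I) (\<pi> J))) \<le> 4 * real n"
    unfolding perm_mean_D_square[symmetric] by (intro perm_mean_mono sum_mono g_le_square)
  then show ?thesis using n4 unfolding perm_mean_eta by simp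
qed

text \<open>Of the total \<open>4 n\<close> in \<open>perm_mean_D_square\<close>, truncation loses
  at most \<open>1 / (4 \<delta>)\<close> times the cubic moment, which is \<open>2 n / 3\<close> by
  the choice of \<open>\<delta>\<close>.\<close>

lemma perm_mean_eta_ge: "5 / 6 \<le> perm_mean V \<eta>"
proof -
  let ?D = "\<lambda>\<pi> I J. D I J (\<pi> I) (\<pi> J)"
  have "perm_mean V (\<lambda>\<pi>. (\<Sum>I\<in>V. \<Sum>J\<in>V. (?D \<pi> I J)\<^sup>2) - 1 / (4 * \<delta>) * (\<Sum>I\<in>V. \<Sum>J\<in>V. \<bar>?D \<pi> I J\<bar> ^ 3))
      \<le> perm_mean V (\<lambda>\<pi>. \<Sum>I\<in>V. \<Sum>J\<in>V. g (?D \<pi> I J))"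
    unfolding sum_distrib_left sum_subtractf[symmetric]
    using g_ge by (intro perm_mean_mono sum_mono) simp
  then have "4 * real n \<le> perm_mean V (\<lambda>\<pi>. \<Sum>I\<in>V. \<Sum>J\<in>V. g (?D \<pi> I J))
      + 1 / (4 * \<delta>) * perm_mean V (\<lambda>\<pi>. \<Sum>I\<in>V. \<Sum>J\<in>V. \<bar>?D \<pi> I J\<bar> ^ 3)"
    unfolding perm_mean_diff perm_mean_cmult perm_mean_D_square diff_le_eq .
  also have "\<dots> \<le> perm_mean V (\<lambda>\<pi>. \<Sum>I\<in>V. \<Sum>J\<in>V. g (?D \<pi> I J)) + 1 / (4 * \<delta>) * (256 / 3 * \<gamma>)"
    using delta_pos by (intro add_left_mono mult_left_mono perm_mean_D_cube) auto
  also have "1 / (4 * \<delta>) * (256 / 3 * \<gamma>) = 2 / 3 * real n"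
    using gamma_pos n4 by (simp add: \<delta>_def)
  finally have "10 / 3 * real n \<le> perm_mean V (\<lambda>\<pi>. \<Sum>I\<in>V. \<Sum>J\<in>V. g (?D \<pi> I J))"
    by simp
  then show ?thesis using n4 unfolding perm_mean_eta by (simp add: field_simps)
qed

text \<open>For disjoint pairs of indices the product is compared with independent values, so that
  the quadruple sum factorizes into a square.\<close>

lemma perm_mean_quadruple_sum_le:
  "perm_mean V (\<lambda>\<pi>. \<Sum>I\<in>V. \<Sum>J\<in>V. \<Sum>K\<in>V. \<Sum>L\<in>V. of_bool (card {I, J, K, L} = 4)
      * (g (D I J (\<pi> I) (\<pi> J)) * g (D K L (\<pi> K) (\<pi> L))))
    \<le> fact (n - 4) / fact n * (\<Sum>I\<in>V. \<Sum>J\<in>V. \<Sum>p\<in>V. \<Sum>q\<in>V. g (D I J p q))\<^sup>2"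
proof -
  let ?c = "fact (n - 4) / fact n :: real"
  let ?S = "\<lambda>I J. \<Sum>p\<in>V. \<Sum>q\<in>V. g (D I J p q)"
  have S0: "0 \<le> ?S I J" for I J by (intro sum_nonneg g_nonneg)
  have le: "perm_mean V (\<lambda>\<pi>. of_bool (card {I, J, K, L} = 4)
      * (g (D I J (\<pi> I) (\<pi> J)) * g (D K L (\<pi> K) (\<pi> L)))) \<le> ?c * (?S I J * ?S K L)"
    if "I \<in> V" "J \<in> V" "K \<in> V" "L \<in> V" for I J K L
  proof (cases "card {I, J, K, L} = 4")
    case True
    have "perm_mean V (\<lambda>\<pi>. g (D I J (\<pi> I) (\<pi> J)) * g (D K L (\<pi> K) (\<pi> L)))
        \<le> fact (card V - 4) / fact (card V)
          * (\<Sum>p\<in>V. \<Sum>q\<in>V. \<Sum>r\<in>V. \<Sum>s\<in>V. g (D I J p q) * g (D K L r s))"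
      using that True g_nonneg by (intro perm_mean_four_le) (auto simp del: One_nat_def)
    also have "\<dots> = ?c * (?S I J * ?S K L)"
      by (simp only: sum_distrib_left[symmetric] sum_distrib_right[symmetric] card_atLeastAtMost) simp
    finally show ?thesis using True by (simp del: One_nat_def)
  next
    case False
    then show ?thesis using S0[of I J] S0[of K L] by (simp add: perm_mean_const del: One_nat_def)
  qed
  have "perm_mean V (\<lambda>\<pi>. \<Sum>I\<in>V. \<Sum>J\<in>V. \<Sum>K\<in>V. \<Sum>L\<in>V. of_bool (card {I, J, K, L} = 4)
      * (g (D I J (\<pi> I) (\<pi> J)) * g (D K L (\<pi> K) (\<pi> L))))
    \<le> (\<Sum>I\<in>V. \<Sum>J\<in>V. \<Sum>K\<in>V. \<Sum>L\<in>V. ?c * (?S I J * ?S K L))"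
    unfolding perm_mean_sum by (intro sum_mono le)
  also have "\<dots> = ?c * (\<Sum>I\<in>V. \<Sum>J\<in>V. ?S I J)\<^sup>2"
    unfolding sum_distrib_left[symmetric] sum_distrib_right[symmetric] power2_eq_square by (rule refl)
  finally show ?thesis .
qed

text \<open>Overlapping pairs of indices cost \<open>\<delta>^2\<close>: one factor
  \<open>\<delta>\<close> is taken out of each truncated square, and second moments of
  \<open>D\<close> suffice. Disjoint pairs give the squared mean up to the ratio of
  \<open>(n (n - 1))^2\<close> to \<open>n (n - 1) (n - 2) (n - 3)\<close>.\<close>

lemma perm_mean_eta_square_le:
  "perm_mean V (\<lambda>\<pi>. (\<eta> \<pi>)\<^sup>2)
    \<le> \<delta>\<^sup>2 + real n * (real n - 1) / ((real n - 2) * (real n - 3)) * (perm_mean V \<eta>)\<^sup>2"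
proof -
  let ?G = "\<lambda>\<pi> I J. g (D I J (\<pi> I) (\<pi> J))"
  let ?Y = "\<lambda>\<pi>. \<Sum>I\<in>V. \<Sum>J\<in>V. ?G \<pi> I J"
  let ?Q = "\<lambda>\<pi>. \<Sum>I\<in>V. \<Sum>J\<in>V. \<Sum>K\<in>V. \<Sum>L\<in>V. of_bool (card {I, J, K, L} = 4) * (?G \<pi> I J * ?G \<pi> K L)"
  let ?S = "\<Sum>I\<in>V. \<Sum>J\<in>V. \<Sum>p\<in>V. \<Sum>q\<in>V. g (D I J p q)"
  have "(?Y \<pi>)\<^sup>2 \<le> 4 * (real n * \<delta>\<^sup>2) * (\<Sum>I\<in>V. \<Sum>J\<in>V. (D I J (\<pi> I) (\<pi> J))\<^sup>2) + ?Q \<pi>" for \<pi>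
  proof -
    have "(?Y \<pi>)\<^sup>2 \<le> 4 * (\<Sum>I\<in>V. (\<Sum>J\<in>V. ?G \<pi> I J)\<^sup>2) + ?Q \<pi>"
      by (intro sum_symmetric_square_le g_nonneg) (simp_all add: D_sym)
    also have "(\<Sum>I\<in>V. (\<Sum>J\<in>V. ?G \<pi> I J)\<^sup>2) \<le> (\<Sum>I\<in>V. (\<Sum>J\<in>V. \<delta>\<^sup>2 * (D I J (\<pi> I) (\<pi> J))\<^sup>2) * real n)"
    proof (rule sum_mono)
      fix I
      have "(\<Sum>J\<in>V. ?G \<pi> I J)\<^sup>2 \<le> (\<Sum>J\<in>V. (?G \<pi> I J)\<^sup>2) * real n"
        using sum_squared_le_sum_of_squares[of "?G \<pi> I" V] by simp
      also have "\<dots> \<le> (\<Sum>J\<in>V. \<delta>\<^sup>2 * (D I J (\<pi> I) (\<pi> J))\<^sup>2) * real n"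
        by (intro mult_right_mono sum_mono g_square_le) simp
      finally show "(\<Sum>J\<in>V. ?G \<pi> I J)\<^sup>2 \<le> (\<Sum>J\<in>V. \<delta>\<^sup>2 * (D I J (\<pi> I) (\<pi> J))\<^sup>2) * real n" .
    qed
    also have "\<dots> = real n * \<delta>\<^sup>2 * (\<Sum>I\<in>V. \<Sum>J\<in>V. (D I J (\<pi> I) (\<pi> J))\<^sup>2)"
      by (simp only: sum_distrib_left[symmetric] sum_distrib_right[symmetric] mult_ac)
    finally show ?thesis by (simp add: mult.assoc)
  qed
  then have "perm_mean V (\<lambda>\<pi>. (?Y \<pi>)\<^sup>2)
      \<le> perm_mean V (\<lambda>\<pi>. 4 * (real n * \<delta>\<^sup>2) * (\<Sum>I\<in>V. \<Sum>J\<in>V. (D I J (\<pi> I) (\<pi> J))\<^sup>2) + ?Q \<pi>)"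
    by (intro perm_mean_mono)
  also have "\<dots> = 4 * (real n * \<delta>\<^sup>2) * (4 * real n) + perm_mean V ?Q"
    by (simp only: perm_mean_add perm_mean_cmult perm_mean_D_square)
  also have "\<dots> \<le> 4 * (real n * \<delta>\<^sup>2) * (4 * real n) + fact (n - 4) / fact n * ?S\<^sup>2"
    by (intro add_left_mono perm_mean_quadruple_sum_le)
  finally have Y2: "perm_mean V (\<lambda>\<pi>. (?Y \<pi>)\<^sup>2) \<le> 16 * (real n)\<^sup>2 * \<delta>\<^sup>2 + fact (n - 4) / fact n * ?S\<^sup>2"
    by (simp add: power2_eq_square mult_ac)
  obtain m where m: "n = Suc (Suc (Suc (Suc m)))" using n4 by (auto simp: numeral_eq_Suc dest!: le_Suc_ex)
  have f: "fact (n - 4) / fact n = 1 / (real n * (real n - 1) * ((real n - 2) * (real n - 3)))"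
  proof -
    have "fact n = (real n * (real n - 1) * ((real n - 2) * (real n - 3))) * fact (n - 4)"
      by (simp add: m algebra_simps)
    then show ?thesis by simp
  qed
  have "perm_mean V ?Y = ?S / (real n * (real n - 1))"
    by (rule perm_mean_sum_D) simp
  then have S: "?S = real n * (real n - 1) * (4 * real n * perm_mean V \<eta>)"
    using n4 unfolding perm_mean_eta by simp
  have "perm_mean V (\<lambda>\<pi>. (\<eta> \<pi>)\<^sup>2) = 1 / (16 * (real n)\<^sup>2) * perm_mean V (\<lambda>\<pi>. (?Y \<pi>)\<^sup>2)"
    unfolding perm_mean_cmult[symmetric] by (simp add: \<eta>_def power_divide power_mult_distrib)
  also have "\<dots> \<le> 1 / (16 * (real n)\<^sup>2) * (16 * (real n)\<^sup>2 * \<delta>\<^sup>2 + fact (n - 4) / fact n * ?S\<^sup>2)"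
    using Y2 by (intro mult_left_mono) auto
  also have "\<dots> = \<delta>\<^sup>2 + real n * (real n - 1) / ((real n - 2) * (real n - 3)) * (perm_mean V \<eta>)\<^sup>2"
  proof -
    have "1 / (16 * N\<^sup>2) * (16 * N\<^sup>2 * d + 1 / (N * y * w) * (N * y * (4 * N * m))\<^sup>2) = d + N * y / w * m\<^sup>2"
      if "N \<noteq> 0" "y \<noteq> 0" "w \<noteq> 0" for N y w m d :: real
      using that by (simp add: field_simps power2_eq_square)
    then show ?thesis unfolding f S using n4 by simp
  qed
  finally show ?thesis .
qed

text \<open>Chebyshev's inequality: below 1/2, \<open>\<eta>\<close> is at least 1/3 away from its
  mean, hence the factor 9. The variance is at most \<open>\<delta>^2 + 20 / n\<close>; here
  \<open>\<delta>^2 \<le> \<delta>\<close>, and \<open>gamma_ge\<close> turns \<open>20 / n\<close>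
  into \<open>60 \<gamma> / n\<close>, so that \<open>828 = 9 (32 + 60)\<close>.\<close>

lemma perm_mean_eta_small:
  assumes "\<delta> \<le> 1"
  shows "perm_mean V (\<lambda>\<pi>. of_bool (\<eta> \<pi> < 1 / 2)) \<le> 828 * \<gamma> / n"
proof -
  let ?m = "perm_mean V \<eta>"
  have "of_bool (\<eta> \<pi> < 1 / 2) \<le> 9 * ((\<eta> \<pi>)\<^sup>2 + (?m\<^sup>2 - 2 * ?m * \<eta> \<pi>))" for \<pi>
  proof (cases "\<eta> \<pi> < 1 / 2")
    case True
    then have "(1 / 3)\<^sup>2 \<le> (?m - \<eta> \<pi>)\<^sup>2" using perm_mean_eta_ge by (intro power_mono) auto
    then show ?thesis using True by (simp add: power2_eq_square algebra_simps)
  next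
    case False
    have "0 \<le> (?m - \<eta> \<pi>)\<^sup>2" by simp
    then show ?thesis using False by (simp add: power2_eq_square algebra_simps)
  qed
  then have "perm_mean V (\<lambda>\<pi>. of_bool (\<eta> \<pi> < 1 / 2))
      \<le> perm_mean V (\<lambda>\<pi>. 9 * ((\<eta> \<pi>)\<^sup>2 + (?m\<^sup>2 - 2 * ?m * \<eta> \<pi>)))"
    by (rule perm_mean_mono)
  also have "\<dots> = 9 * (perm_mean V (\<lambda>\<pi>. (\<eta> \<pi>)\<^sup>2) - ?m\<^sup>2)"
    by (simp add: perm_mean_cmult perm_mean_add perm_mean_diff perm_mean_const power2_eq_square)
  also have "\<dots> \<le> 9 * (\<delta>\<^sup>2 + 20 / real n)"
  proof -
    let ?k = "real n * (real n - 1) / ((real n - 2) * (real n - 3))"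
    have pos: "0 < (real n - 2) * (real n - 3)" using n4 by (intro mult_pos_pos) auto
    \<comment> \<open>The constant 20 is the one for which the inequality below is an equality at
      \<open>n = 4\<close>.\<close>
    have "0 \<le> (real n - 4) * (16 * real n - 30)" using n4 by (intro mult_nonneg_nonneg) auto
    then have "real n * (4 * real n - 6) \<le> 20 * ((real n - 2) * (real n - 3))"
      by (simp add: algebra_simps)
    then have "(4 * real n - 6) / ((real n - 2) * (real n - 3)) \<le> 20 / real n"
      using n4 pos by (simp add: divide_le_eq pos_le_divide_eq mult.commute)
    moreover have "?k - 1 = (4 * real n - 6) / ((real n - 2) * (real n - 3))"
    proof -
      have "real n * (real n - 1) = (real n - 2) * (real n - 3) + (4 * real n - 6)"
        by (simp add: algebra_simps)
      then show ?thesis using n4 by (simp only: add_divide_distrib) simp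
    qed
    ultimately have k: "?k - 1 \<le> 20 / real n" by simp
    have "?m\<^sup>2 \<le> 1" using perm_mean_eta_le perm_mean_eta_ge by (simp add: power_le_one)
    then have "(?k - 1) * ?m\<^sup>2 \<le> 20 / real n * 1" using k by (intro mult_mono) auto
    then have "?k * ?m\<^sup>2 - ?m\<^sup>2 \<le> 20 / real n" by (simp add: left_diff_distrib)
    moreover have "9 * (x - m) \<le> 9 * (e + c)" if "y - m \<le> c" "x \<le> e + y" for x y m e c :: real
      using that by simp
    ultimately show ?thesis using perm_mean_eta_square_le by blast
  qed
  also have "\<dots> \<le> 9 * (32 * \<gamma> / n + 60 * \<gamma> / n)"
  proof -
    have "\<delta>\<^sup>2 \<le> \<delta>" using assms delta_pos by (simp add: power2_eq_square mult_le_cancel_left1)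
    moreover have "20 / real n \<le> 60 * \<gamma> / n" using gamma_ge n4 by (intro divide_right_mono) auto
    ultimately show ?thesis by (simp add: \<delta>_def)
  qed
  finally show ?thesis by (simp add: field_simps)
qed

section \<open>The clipped test function\<close>

definition clip :: "real \<Rightarrow> real \<Rightarrow> real" where "clip \<rho> x = max (- \<rho>) (min \<rho> x)"

text \<open>The level \<open>r + \<delta>\<close> leaves \<open>x\<close> unclipped with room
  \<open>\<delta>\<close> on both sides, so going from \<open>x\<close> to \<open>y\<close> moves
  the clipped value by at least \<open>min \<bar>x - y\<bar> \<delta>\<close>.\<close>

lemma clip_diff_ge:
  assumes "\<bar>x\<bar> \<le> r"
  shows "g (x - y) \<le> (x - y) * (clip (r + \<delta>) x - clip (r + \<delta>) y)"
proof -
  have x: "clip (r + \<delta>) x = x" using assms delta_pos by (auto simp: clip_def)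
  show ?thesis
  proof (cases "y \<le> x")
    case True
    then have "min \<bar>x - y\<bar> \<delta> \<le> x - clip (r + \<delta>) y"
      using assms delta_pos by (auto simp: clip_def min_def max_def)
    then have "\<bar>x - y\<bar> * min \<bar>x - y\<bar> \<delta> \<le> \<bar>x - y\<bar> * (x - clip (r + \<delta>) y)"
      by (rule mult_left_mono) simp
    then show ?thesis using True by (simp add: g_def x)
  next
    case False
    then have "min \<bar>x - y\<bar> \<delta> \<le> clip (r + \<delta>) y - x"
      using assms delta_pos by (auto simp: clip_def min_def max_def)
    then have "\<bar>x - y\<bar> * min \<bar>x - y\<bar> \<delta> \<le> \<bar>x - y\<bar> * (clip (r + \<delta>) y - x)"
      by (rule mult_left_mono) simp
    also have "\<dots> = (x - y) * (x - clip (r + \<delta>) y)" using False by (simp add: algebra_simps)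
    finally show ?thesis by (simp add: g_def x)
  qed
qed

lemma clip_mono_nonneg: "0 \<le> (x - y) * (clip \<rho> x - clip \<rho> y)"
  by (cases x y rule: le_cases) (auto simp: clip_def min_def max_def zero_le_mult_iff)

lemma clip_abs_le: "0 \<le> \<rho> \<Longrightarrow> \<bar>clip \<rho> x\<bar> \<le> \<rho>"
  by (auto simp: clip_def)

text \<open>Lipschitz continuity in the level rather than in the argument; it pays for the change of
  \<open>\<bar>\<Delta>\<bar>\<close> under a transposition.\<close>

lemma clip_Lipschitz: "0 \<le> \<rho> \<Longrightarrow> 0 \<le> \<sigma> \<Longrightarrow> \<bar>clip \<rho> x - clip \<sigma> x\<bar> \<le> \<bar>\<rho> - \<sigma>\<bar>"
  by (auto simp: clip_def min_def max_def)

text \<open>On the event, \<open>\<bar>T - z\<bar>\<close> is at least \<open>\<delta>\<close> below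
  the clipping level, so the truncated square of each increment is dominated by the increment of
  \<open>T\<close> times that of the clipped function. Exchangeability reduces the total to the mean
  of \<open>T f\<close>, and \<open>\<eta> \<ge> 1 / 2\<close> off a rare event removes
  \<open>\<eta>\<close>. The constant is \<open>892 = 64 + 828\<close>, from
  \<open>2 \<delta>\<close> and from the rare event.\<close>

lemma concentration:
  fixes \<Delta> :: "(nat \<Rightarrow> nat) \<Rightarrow> real"
  assumes "\<delta> \<le> 1"
  shows "perm_mean V (\<lambda>\<pi>. of_bool (\<bar>T \<pi> - z\<bar> \<le> \<bar>\<Delta> \<pi>\<bar>))
    \<le> 2 * (perm_mean V (\<lambda>\<pi>. \<bar>T \<pi>\<bar> * \<bar>\<Delta> \<pi>\<bar>)
        + perm_mean V (\<lambda>\<pi>. \<Sum>I\<in>V. \<Sum>J\<in>V. \<bar>D I J (\<pi> I) (\<pi> J)\<bar>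
            * \<bar>\<Delta> \<pi> - \<Delta> (\<pi> \<circ> Transposition.transpose I J)\<bar>) / (4 * n))
      + 892 * \<gamma> / n"
proof -
  let ?t = "\<lambda>I J \<pi>. \<pi> \<circ> Transposition.transpose I J"
  define A where "A \<pi> = (of_bool (\<bar>T \<pi> - z\<bar> \<le> \<bar>\<Delta> \<pi>\<bar>) :: real)" for \<pi>
  define f where "f \<pi> = clip (\<bar>\<Delta> \<pi>\<bar> + \<delta>) (T \<pi> - z)" for \<pi>
  let ?D = "\<lambda>I J \<pi>. D I J (\<pi> I) (\<pi> J)"
  let ?R = "\<lambda>I J \<pi>. \<bar>?D I J \<pi>\<bar> * \<bar>\<Delta> \<pi> - \<Delta> (?t I J \<pi>)\<bar>"
  \<comment> \<open>\<open>D (f - f')\<close> is written as \<open>2 D f - D (f + f')\<close>: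
    \<open>sum_D\<close> evaluates the first part, and the second is antisymmetric under
    exchange.\<close>
  have point: "A \<pi> * g (?D I J \<pi>)
      \<le> 2 * (?D I J \<pi> * f \<pi>) - ?D I J \<pi> * (f \<pi> + f (?t I J \<pi>)) + ?R I J \<pi>"
    if "I \<in> V" "J \<in> V" for I J \<pi>
  proof -
    \<comment> \<open>\<open>?k\<close> keeps the level of \<open>\<pi>\<close> at the transposed
      permutation, so that \<open>clip_diff_ge\<close> applies with one level; passing to the true
      value of \<open>f\<close> there gives \<open>?R\<close>.\<close>
    let ?k = "clip (\<bar>\<Delta> \<pi>\<bar> + \<delta>) (T (?t I J \<pi>) - z)"
    have D: "?D I J \<pi> = (T \<pi> - z) - (T (?t I J \<pi>) - z)" using T_diff[OF that] by simp
    have "A \<pi> * g (?D I J \<pi>) \<le> ?D I J \<pi> * (f \<pi> - ?k)"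
      unfolding A_def D f_def
      using clip_diff_ge[of "T \<pi> - z" "\<bar>\<Delta> \<pi>\<bar>" "T (?t I J \<pi>) - z"]
        clip_mono_nonneg[of "T \<pi> - z" "T (?t I J \<pi>) - z" "\<bar>\<Delta> \<pi>\<bar> + \<delta>"]
      by (cases "\<bar>T \<pi> - z\<bar> \<le> \<bar>\<Delta> \<pi>\<bar>") simp_all
    also have "\<dots> = 2 * (?D I J \<pi> * f \<pi>) - ?D I J \<pi> * (f \<pi> + f (?t I J \<pi>))
        + ?D I J \<pi> * (f (?t I J \<pi>) - ?k)"
      by (simp add: algebra_simps)
    also have "?D I J \<pi> * (f (?t I J \<pi>) - ?k) \<le> ?R I J \<pi>"
    proof -
      have "\<bar>f (?t I J \<pi>) - ?k\<bar> \<le> \<bar>(\<bar>\<Delta> (?t I J \<pi>)\<bar> + \<delta>) - (\<bar>\<Delta> \<pi>\<bar> + \<delta>)\<bar>"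
        unfolding f_def using delta_pos by (intro clip_Lipschitz) auto
      also have "\<dots> \<le> \<bar>\<Delta> \<pi> - \<Delta> (?t I J \<pi>)\<bar>" by linarith
      finally have "\<bar>?D I J \<pi>\<bar> * \<bar>f (?t I J \<pi>) - ?k\<bar> \<le> ?R I J \<pi>" by (rule mult_left_mono) simp
      then show ?thesis by (metis abs_le_D1 abs_mult)
    qed
    finally show ?thesis by (simp add: comp_def)
  qed
  \<comment> \<open>exchangeability: the integrand changes sign when \<open>\<pi>\<close> and its transposed version are swapped\<close>
  have anti: "perm_mean V (\<lambda>\<pi>. ?D I J \<pi> * (f \<pi> + f (?t I J \<pi>))) = 0" if IJ: "I \<in> V" "J \<in> V" for I J
  proof -
    let ?H = "\<lambda>\<pi>. (T \<pi> - T (?t I J \<pi>)) * (f \<pi> + f (?t I J \<pi>))"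
    have inv: "?t I J (?t I J \<pi>) = \<pi>" for \<pi> :: "nat \<Rightarrow> nat" by (simp add: comp_assoc)
    have "perm_mean V ?H = perm_mean V (\<lambda>\<pi>. ?H (?t I J \<pi>))"
      by (rule perm_mean_compose_right[OF permutes_swap_id[OF IJ], of ?H, symmetric])
    also have "\<dots> = perm_mean V (\<lambda>\<pi>. - 1 * ?H \<pi>)"
      unfolding inv by (intro perm_mean_cong) (simp add: algebra_simps)
    also have "\<dots> = - perm_mean V ?H" unfolding perm_mean_cmult by simp
    finally show ?thesis using T_diff[OF IJ] by simp
  qed
  have "4 * real n * perm_mean V (\<lambda>\<pi>. A \<pi> * \<eta> \<pi>)
      = perm_mean V (\<lambda>\<pi>. \<Sum>I\<in>V. \<Sum>J\<in>V. A \<pi> * g (?D I J \<pi>))"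
    using n4 unfolding perm_mean_cmult[symmetric] \<eta>_def by (simp add: sum_distrib_left[symmetric])
  also have "\<dots> \<le> perm_mean V (\<lambda>\<pi>. \<Sum>I\<in>V. \<Sum>J\<in>V.
      2 * (?D I J \<pi> * f \<pi>) - ?D I J \<pi> * (f \<pi> + f (?t I J \<pi>)) + ?R I J \<pi>)"
    by (intro perm_mean_mono sum_mono point)
  also have "\<dots> = perm_mean V (\<lambda>\<pi>. \<Sum>I\<in>V. \<Sum>J\<in>V. 2 * (?D I J \<pi> * f \<pi>))
      - (\<Sum>I\<in>V. \<Sum>J\<in>V. perm_mean V (\<lambda>\<pi>. ?D I J \<pi> * (f \<pi> + f (?t I J \<pi>))))
      + perm_mean V (\<lambda>\<pi>. \<Sum>I\<in>V. \<Sum>J\<in>V. ?R I J \<pi>)"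
    by (simp only: sum.distrib sum_subtractf perm_mean_add perm_mean_diff perm_mean_sum)
  also have "(\<Sum>I\<in>V. \<Sum>J\<in>V. perm_mean V (\<lambda>\<pi>. ?D I J \<pi> * (f \<pi> + f (?t I J \<pi>)))) = 0"
    by (intro sum.neutral ballI anti)
  also have "perm_mean V (\<lambda>\<pi>. \<Sum>I\<in>V. \<Sum>J\<in>V. 2 * (?D I J \<pi> * f \<pi>))
      \<le> perm_mean V (\<lambda>\<pi>. 4 * real n * (\<bar>T \<pi>\<bar> * \<bar>\<Delta> \<pi>\<bar> + \<delta> * (1 / 2 + 1 / 2 * (T \<pi>)\<^sup>2)))"
  proof (rule perm_mean_mono)
    fix \<pi> assume \<pi>: "\<pi> permutes V"
    have "(\<Sum>I\<in>V. \<Sum>J\<in>V. 2 * (?D I J \<pi> * f \<pi>)) = 2 * ((\<Sum>I\<in>V. \<Sum>J\<in>V. ?D I J \<pi>) * f \<pi>)"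
      by (simp only: sum_distrib_left sum_distrib_right)
    also have "\<dots> = 4 * real n * (T \<pi> * f \<pi>)" by (simp only: sum_D[OF \<pi>])
    also have "\<dots> \<le> 4 * real n * (\<bar>T \<pi>\<bar> * \<bar>\<Delta> \<pi>\<bar> + \<delta> * (1 / 2 + 1 / 2 * (T \<pi>)\<^sup>2))"
    proof (rule mult_left_mono)
      have "T \<pi> * f \<pi> \<le> \<bar>T \<pi>\<bar> * \<bar>f \<pi>\<bar>" by (metis abs_ge_self abs_mult)
      also have "\<dots> \<le> \<bar>T \<pi>\<bar> * (\<bar>\<Delta> \<pi>\<bar> + \<delta>)"
        unfolding f_def using delta_pos by (intro mult_left_mono clip_abs_le) auto
      also have "\<dots> = \<bar>T \<pi>\<bar> * \<bar>\<Delta> \<pi>\<bar> + \<delta> * \<bar>T \<pi>\<bar>" by (simp add: algebra_simps)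
      \<comment> \<open>\<open>\<bar>T\<bar>\<close> is at most \<open>(1 + T^2) / 2\<close>, whose
        mean is 1.\<close>
      also have "\<dots> \<le> \<bar>T \<pi>\<bar> * \<bar>\<Delta> \<pi>\<bar> + \<delta> * (1 / 2 + 1 / 2 * (T \<pi>)\<^sup>2)"
        using zero_le_power2[of "\<bar>T \<pi>\<bar> - 1"] delta_pos
        by (intro add_left_mono mult_left_mono) (auto simp: power2_diff)
      finally show "T \<pi> * f \<pi> \<le> \<bar>T \<pi>\<bar> * \<bar>\<Delta> \<pi>\<bar> + \<delta> * (1 / 2 + 1 / 2 * (T \<pi>)\<^sup>2)" .
    qed simp
    finally show "(\<Sum>I\<in>V. \<Sum>J\<in>V. 2 * (?D I J \<pi> * f \<pi>))
      \<le> 4 * real n * (\<bar>T \<pi>\<bar> * \<bar>\<Delta> \<pi>\<bar> + \<delta> * (1 / 2 + 1 / 2 * (T \<pi>)\<^sup>2))" .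
  qed
  also have "perm_mean V (\<lambda>\<pi>. 4 * real n * (\<bar>T \<pi>\<bar> * \<bar>\<Delta> \<pi>\<bar> + \<delta> * (1 / 2 + 1 / 2 * (T \<pi>)\<^sup>2)))
      = 4 * real n * (perm_mean V (\<lambda>\<pi>. \<bar>T \<pi>\<bar> * \<bar>\<Delta> \<pi>\<bar>) + \<delta>)"
    by (simp only: perm_mean_cmult perm_mean_add perm_mean_T_square perm_mean_const[OF finite_atLeastAtMost])
      simp
  finally have "4 * real n * perm_mean V (\<lambda>\<pi>. A \<pi> * \<eta> \<pi>)
      \<le> 4 * real n * (perm_mean V (\<lambda>\<pi>. \<bar>T \<pi>\<bar> * \<bar>\<Delta> \<pi>\<bar>) + \<delta>)
        + perm_mean V (\<lambda>\<pi>. \<Sum>I\<in>V. \<Sum>J\<in>V. ?R I J \<pi>)" by (simp add: comp_def)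
  then have A\<eta>: "perm_mean V (\<lambda>\<pi>. A \<pi> * \<eta> \<pi>) \<le> perm_mean V (\<lambda>\<pi>. \<bar>T \<pi>\<bar> * \<bar>\<Delta> \<pi>\<bar>) + \<delta>
        + perm_mean V (\<lambda>\<pi>. \<Sum>I\<in>V. \<Sum>J\<in>V. ?R I J \<pi>) / (4 * real n)"
    using n4 by (simp add: field_simps)
  \<comment> \<open>Where \<open>\<eta> \<ge> 1 / 2\<close>, the indicator \<open>A\<close> is at
    most \<open>2 A \<eta>\<close>; elsewhere the second indicator covers it.\<close>
  have "perm_mean V A \<le> perm_mean V (\<lambda>\<pi>. 2 * (A \<pi> * \<eta> \<pi>) + of_bool (\<eta> \<pi> < 1 / 2))"
    using eta_nonneg by (intro perm_mean_mono) (auto simp: A_def of_bool_def)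
  also have "\<dots> \<le> 2 * (perm_mean V (\<lambda>\<pi>. \<bar>T \<pi>\<bar> * \<bar>\<Delta> \<pi>\<bar>) + \<delta>
        + perm_mean V (\<lambda>\<pi>. \<Sum>I\<in>V. \<Sum>J\<in>V. ?R I J \<pi>) / (4 * real n)) + 828 * \<gamma> / n"
    unfolding perm_mean_add perm_mean_cmult
    by (intro add_mono mult_left_mono A\<eta> perm_mean_eta_small assms) simp
  finally show ?thesis by (simp add: A_def[abs_def] \<delta>_def field_simps)
qed

end

section \<open>The perturbed central limit theorem\<close>

lemma inj_tuples_one: "inj_tuples n 1 = singleton_tuple ` {1..n}"
  "tuples n 1 = singleton_tuple ` {1..n}"
proof -
  show t: "tuples n 1 = singleton_tuple ` {1..n}"
  proof (intro equalityI subsetI)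
    fix i assume i: "i \<in> tuples n 1"
    then have "i = singleton_tuple (i 1)"
      by (auto simp: tuples_def singleton_tuple_def fun_eq_iff PiE_iff extensional_def)
    moreover have "i 1 \<in> {1..n}"
      using i unfolding tuples_def by (rule PiE_mem) simp
    ultimately show "i \<in> singleton_tuple ` {1..n}" by blast
  qed (auto simp: tuples_def singleton_tuple_def split: if_splits)
  show "inj_tuples n 1 = singleton_tuple ` {1..n}"
    unfolding t[symmetric] by (auto simp: inj_tuples_def)
qed

lemma inj_singleton_tuple: "inj_on singleton_tuple A"
proof (rule inj_onI)
  fix x y assume "singleton_tuple x = singleton_tuple y"
  from fun_cong[OF this, of 1] show "x = y" by (simp add: singleton_tuple_def)
qed

lemma sum_tuples_one: "(\<Sum>i\<in>tuples n 1. f i) = (\<Sum>k\<in>{1..n}. f (singleton_tuple k))"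
  unfolding inj_tuples_one by (simp add: sum.reindex[OF inj_singleton_tuple] o_def)

lemma tensor_stat_one:
  "tensor_stat n 1 \<xi> \<pi> = (\<Sum>i\<in>{1..n}. \<xi> (singleton_tuple i) (singleton_tuple (\<pi> i)))"
proof -
  have "compose {1..1} \<pi> (singleton_tuple k) = singleton_tuple (\<pi> k)" for k
    by (auto simp: compose_def singleton_tuple_def fun_eq_iff)
  then show ?thesis
    unfolding tensor_stat_def inj_tuples_one sum.reindex[OF inj_singleton_tuple] by (simp only: o_def)
qed

lemma centered_matrix_tensor:
  assumes "n \<ge> 4" and H: "hoeffding_tensor n 1 \<xi>" and b: "tensor_beta n 1 \<xi> = real n - 1"
  shows "centered_matrix n (\<lambda>i j. \<xi> (singleton_tuple i) (singleton_tuple j))"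
proof
  \<comment> \<open>For \<open>s = 1\<close> the other coordinates form the empty set, whose only
    extensional function is constantly \<open>undefined\<close>; updating it at 1 gives the
    singleton tuple.\<close>
  have upd: "(\<lambda>_. undefined)(1 := v) = singleton_tuple v" for v
    by (auto simp: singleton_tuple_def fun_eq_iff)
  have one: "(\<lambda>_ :: nat. undefined) \<in> ({1..1} - {1}) \<rightarrow>\<^sub>E {1..n}" by simp
  fix i assume "i \<in> {1..n}"
  then have i: "singleton_tuple i \<in> tuples n 1" unfolding inj_tuples_one by (rule imageI)
  have "(1 :: nat) \<in> {1..1}" by simp
  from hoeffding_tensor_sum_zero[OF H this one i]
  show "(\<Sum>j\<in>{1..n}. \<xi> (singleton_tuple i) (singleton_tuple j)) = 0"
    "(\<Sum>j\<in>{1..n}. \<xi> (singleton_tuple j) (singleton_tuple i)) = 0"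
    unfolding upd by simp_all
next
  show "(\<Sum>i\<in>{1..n}. \<Sum>j\<in>{1..n}. (\<xi> (singleton_tuple i) (singleton_tuple j))\<^sup>2) = real n - 1"
    using b unfolding tensor_beta_def sum_tuples_one .
qed (use assms in simp)

section \<open>Distribution functions and the Kolmogorov distance\<close>

lemma cdf_uniform_perm:
  "cdf (distr (uniform_perm n) borel f) z = perm_mean {1..n} (\<lambda>\<pi>. of_bool (f \<pi> \<le> z))"
proof -
  let ?P = "{\<pi>. \<pi> permutes {1..n}}"
  have P: "finite ?P" "?P \<noteq> {}"
    using permutes_id[of "{1..n}"] by (simp add: finite_permutations, blast)
  have "cdf (distr (uniform_perm n) borel f) z = measure (uniform_perm n) {\<pi>. f \<pi> \<le> z}"
    by (simp add: cdf_def measure_distr vimage_def)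
  also have "\<dots> = real (card (?P \<inter> {\<pi>. f \<pi> \<le> z})) / real (card ?P)"
    unfolding uniform_perm_def by (rule measure_pmf_of_set[OF P(2,1)])
  also have "\<dots> = perm_mean {1..n} (\<lambda>\<pi>. of_bool (f \<pi> \<le> z))"
    using P(1) by (simp add: perm_mean_def card_permutations sum_of_bool_eq[OF P(1)] Int_def)
  finally show ?thesis .
qed

lemma cdf_diff_le_one:
  assumes "prob_space M" "prob_space N"
  shows "\<bar>cdf M x - cdf N x\<bar> \<le> 1"
proof -
  interpret M: prob_space M by fact
  interpret N: prob_space N by fact
  have "0 \<le> cdf M x" "cdf M x \<le> 1" "0 \<le> cdf N x" "cdf N x \<le> 1"
    by (simp_all add: cdf_def)
  then show ?thesis by linarith
qed

lemma kolmogorov_dist_ge: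
  assumes "prob_space M" "prob_space N"
  shows "\<bar>cdf M x - cdf N x\<bar> \<le> kolmogorov_dist M N"
  unfolding kolmogorov_dist_def
  using cdf_diff_le_one[OF assms] by (intro cSUP_upper bdd_aboveI[of _ 1]) auto

section \<open>Contribution of the components of order at least two\<close>

lemma perm_mean_mult_stat_le:
  assumes "perm_mean {1..n} (\<lambda>\<pi>. (f \<pi>)\<^sup>2) = 1"
    and "hoeffding_tensor n s \<xi>" "s \<ge> 1" "n \<ge> 4 * s\<^sup>2"
  shows "perm_mean {1..n} (\<lambda>\<pi>. \<bar>f \<pi>\<bar> * \<bar>tensor_stat n s \<xi> \<pi>\<bar>) \<le> sqrt (stat_bound n s \<xi>)"
proof -
  have "perm_mean {1..n} (\<lambda>\<pi>. \<bar>f \<pi>\<bar> * \<bar>tensor_stat n s \<xi> \<pi>\<bar>)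
      \<le> sqrt (perm_mean {1..n} (\<lambda>\<pi>. (tensor_stat n s \<xi> \<pi>)\<^sup>2))"
    using perm_mean_Cauchy_Schwarz[of "{1..n}" "\<lambda>_. f" "\<lambda>_. tensor_stat n s \<xi>" "{()}"] assms(1) by simp
  also have "\<dots> \<le> sqrt (stat_bound n s \<xi>)"
    by (intro real_sqrt_le_mono tensor_stat_second_moment assms)
  finally show ?thesis .
qed

text \<open>Cauchy--Schwarz over permutations and index pairs pairs the two Dirichlet forms,
  \<open>4 n\<close> for \<open>T\<close> and \<open>8 s n\<close> times the second moment bound.
  The factor \<open>4 n\<close> taken out cancels the normalization in
  \<open>concentration\<close>.\<close>

lemma (in centered_matrix) perm_mean_D_mult_stat_le:
  assumes "hoeffding_tensor n s \<xi>" "s \<ge> 1" "n \<ge> 4 * s\<^sup>2"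
  shows "perm_mean V (\<lambda>\<pi>. \<Sum>I\<in>V. \<Sum>J\<in>V. \<bar>D I J (\<pi> I) (\<pi> J)\<bar>
      * \<bar>tensor_stat n s \<xi> \<pi> - tensor_stat n s \<xi> (\<pi> \<circ> Transposition.transpose I J)\<bar>)
    \<le> 4 * real n * sqrt (2 * real s * stat_bound n s \<xi>)"
proof -
  let ?f = "\<lambda>(I, J) \<pi>. D I J (\<pi> I) (\<pi> J)"
  let ?h = "\<lambda>(I, J) \<pi>. tensor_stat n s \<xi> \<pi> - tensor_stat n s \<xi> (\<pi> \<circ> Transposition.transpose I J)"
  have "perm_mean V (\<lambda>\<pi>. \<Sum>e\<in>V \<times> V. \<bar>?f e \<pi>\<bar> * \<bar>?h e \<pi>\<bar>)
      \<le> sqrt (perm_mean V (\<lambda>\<pi>. \<Sum>e\<in>V \<times> V. (?f e \<pi>)\<^sup>2)) * sqrt (perm_mean V (\<lambda>\<pi>. \<Sum>e\<in>V \<times> V. (?h e \<pi>)\<^sup>2))"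
    by (rule perm_mean_Cauchy_Schwarz)
  also have "\<dots> = sqrt (4 * real n) * sqrt (perm_mean V (\<lambda>\<pi>. \<Sum>I\<in>V. \<Sum>J\<in>V.
      (tensor_stat n s \<xi> \<pi> - tensor_stat n s \<xi> (\<pi> \<circ> Transposition.transpose I J))\<^sup>2))"
    unfolding perm_mean_D_square[symmetric] by (simp add: sum.cartesian_product case_prod_unfold)
  also have "\<dots> \<le> sqrt (4 * real n) * sqrt (8 * real s * real n * stat_bound n s \<xi>)"
    by (intro mult_left_mono real_sqrt_le_mono tensor_stat_Dirichlet_form assms) simp
  also have "\<dots> = sqrt ((4 * real n)\<^sup>2 * (2 * real s * stat_bound n s \<xi>))"
    unfolding real_sqrt_mult[symmetric] by (simp add: power2_eq_square mult_ac)
  also have "\<dots> = 4 * real n * sqrt (2 * real s * stat_bound n s \<xi>)"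
    unfolding real_sqrt_mult[of "(4 * real n)\<^sup>2"] real_sqrt_abs by simp
  finally show ?thesis by (simp add: sum.cartesian_product case_prod_unfold)
qed

text \<open>The origin of \<open>C_d\<close>: the root of \<open>stat_bound\<close> carries
  \<open>sqrt 2 * 2^s * (2 s)!\<close>. For \<open>s \<ge> 2\<close>,
  \<open>sqrt (2 s) \<le> s\<close> and \<open>sqrt 2 \<le> 3 / 2\<close> bound the remaining factor
  by \<open>3 (1 + s)\<close>, hence by \<open>5 s^2\<close>, while \<open>2^s\<close> is at most
  \<open>e^d\<close>.\<close>

lemma stat_bound_coefficient:
  assumes s: "2 \<le> s" "s \<le> d"
  shows "2 * (sqrt (stat_bound n s \<xi>) + sqrt (2 * real s * stat_bound n s \<xi>))
    \<le> 5 * (real d)\<^sup>2 * exp (real d) * fact (2 * d) * sqrt (tensor_beta n s \<xi> / real n ^ s)"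
proof -
  let ?r = "sqrt (tensor_beta n s \<xi> / real n ^ s)"
  have r0: "0 \<le> ?r" using tensor_beta_nonneg by simp
  have "stat_bound n s \<xi> = 2 * (2 ^ s * fact (2 * s))\<^sup>2 * (tensor_beta n s \<xi> / real n ^ s)"
    by (simp add: stat_bound_def power_mult_distrib power_mult[symmetric] mult.commute[of s 2])
      (simp add: power_mult)
  then have B: "sqrt (stat_bound n s \<xi>) = sqrt 2 * (2 ^ s * fact (2 * s)) * ?r"
    by (simp only: real_sqrt_mult real_sqrt_abs) simp
  have "2 * real s \<le> (real s)\<^sup>2" using s by (simp add: power2_eq_square)
  then have "sqrt (2 * real s) \<le> real s" by (intro real_le_lsqrt) auto
  moreover have "sqrt 2 \<le> 3 / 2" by (rule real_le_lsqrt) (auto simp: power2_eq_square)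
  ultimately have "2 * (1 + sqrt (2 * real s)) * sqrt 2 \<le> 2 * (1 + real s) * (3 / 2)"
    by (intro mult_mono) auto
  also have "\<dots> \<le> 5 * (real s)\<^sup>2"
  proof -
    have "2 * real s \<le> real s * real s" "2 \<le> real s" using s by (simp_all add: mult_right_mono)
    then have "3 + 3 * real s \<le> 5 * (real s * real s)" by (smt (verit))
    then show ?thesis by (simp add: power2_eq_square algebra_simps)
  qed
  also have "\<dots> \<le> 5 * (real d)\<^sup>2" using s by simp
  finally have 1: "2 * (1 + sqrt (2 * real s)) * sqrt 2 \<le> 5 * (real d)\<^sup>2" .
  have "(2 :: real) ^ s \<le> 2 ^ d" using s by (intro power_increasing) auto
  also have "\<dots> \<le> exp 1 ^ d" using exp_ge_add_one_self[of 1] by (intro power_mono) auto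
  also have "\<dots> = exp (real d)" by (simp add: exp_of_nat_mult[symmetric])
  finally have 2: "(2 :: real) ^ s \<le> exp (real d)" .
  have 3: "fact (2 * s) \<le> (fact (2 * d) :: real)" using s by (intro fact_mono) auto
  have "2 * (sqrt (stat_bound n s \<xi>) + sqrt (2 * real s * stat_bound n s \<xi>))
      = (2 * (1 + sqrt (2 * real s)) * sqrt 2) * 2 ^ s * fact (2 * s) * ?r"
    unfolding real_sqrt_mult[of "2 * real s" "stat_bound n s \<xi>"] B by (simp add: algebra_simps)
  also have "\<dots> \<le> 5 * (real d)\<^sup>2 * exp (real d) * fact (2 * d) * ?r"
    by (rule mult_right_mono[OF mult_mono[OF mult_mono[OF 1 2] 3] r0]) auto
  finally show ?thesis .
qed

text \<open>Both error terms in \<open>concentration\<close> are subadditive in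
  \<open>\<Delta>\<close>, so the triangle inequality splits them by order, and no covariance
  between components of different orders arises.\<close>

lemma (in centered_matrix) perturbation_bound:
  assumes n: "n \<ge> 4 * d\<^sup>2" and H: "\<And>s. s \<in> {2..d} \<Longrightarrow> hoeffding_tensor n s (\<xi> s)"
    and \<delta>: "\<delta> \<le> 1"
  shows "perm_mean V (\<lambda>\<pi>. of_bool (\<bar>T \<pi> - z\<bar> \<le> \<bar>\<Sum>s=2..d. tensor_stat n s (\<xi> s) \<pi>\<bar>))
    \<le> 892 * \<gamma> / n + 5 * (real d)\<^sup>2 * exp (real d) * fact (2 * d)
        * (\<Sum>s=2..d. sqrt (tensor_beta n s (\<xi> s) / real n ^ s))"
proof -
  let ?U = "\<lambda>s. tensor_stat n s (\<xi> s)" and ?B = "\<lambda>s. stat_bound n s (\<xi> s)"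
  let ?\<Delta> = "\<lambda>\<pi>. \<Sum>s=2..d. ?U s \<pi>"
  have ns: "n \<ge> 4 * s\<^sup>2" if "s \<in> {2..d}" for s
  proof -
    have "s\<^sup>2 \<le> d\<^sup>2" using that by (intro power_mono) auto
    with n show ?thesis by linarith
  qed
  have "perm_mean V (\<lambda>\<pi>. \<bar>T \<pi>\<bar> * \<bar>?\<Delta> \<pi>\<bar>) \<le> perm_mean V (\<lambda>\<pi>. \<Sum>s=2..d. \<bar>T \<pi>\<bar> * \<bar>?U s \<pi>\<bar>)"
    unfolding sum_distrib_left[symmetric] by (intro perm_mean_mono mult_left_mono sum_abs) auto
  also have "\<dots> \<le> (\<Sum>s=2..d. sqrt (?B s))"
    unfolding perm_mean_sum
    by (intro sum_mono perm_mean_mult_stat_le[OF perm_mean_T_square] H ns) auto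
  finally have 1: "perm_mean V (\<lambda>\<pi>. \<bar>T \<pi>\<bar> * \<bar>?\<Delta> \<pi>\<bar>) \<le> (\<Sum>s=2..d. sqrt (?B s))" .
  have "perm_mean V (\<lambda>\<pi>. \<Sum>I\<in>V. \<Sum>J\<in>V. \<bar>D I J (\<pi> I) (\<pi> J)\<bar>
        * \<bar>?\<Delta> \<pi> - ?\<Delta> (\<pi> \<circ> Transposition.transpose I J)\<bar>)
      \<le> perm_mean V (\<lambda>\<pi>. \<Sum>I\<in>V. \<Sum>J\<in>V. \<Sum>s=2..d. \<bar>D I J (\<pi> I) (\<pi> J)\<bar>
        * \<bar>?U s \<pi> - ?U s (\<pi> \<circ> Transposition.transpose I J)\<bar>)"
    unfolding sum_distrib_left[symmetric] sum_subtractf[symmetric]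
    by (intro perm_mean_mono sum_mono mult_left_mono sum_abs) auto
  also have "\<dots> = (\<Sum>s=2..d. perm_mean V (\<lambda>\<pi>. \<Sum>I\<in>V. \<Sum>J\<in>V. \<bar>D I J (\<pi> I) (\<pi> J)\<bar>
        * \<bar>?U s \<pi> - ?U s (\<pi> \<circ> Transposition.transpose I J)\<bar>))"
    unfolding perm_mean_sum[symmetric]
    by (intro perm_mean_cong, subst (2) sum.swap, subst sum.swap) (rule refl)
  also have "\<dots> \<le> (\<Sum>s=2..d. 4 * real n * sqrt (2 * real s * ?B s))"
    by (intro sum_mono perm_mean_D_mult_stat_le H ns) auto
  finally have 2: "perm_mean V (\<lambda>\<pi>. \<Sum>I\<in>V. \<Sum>J\<in>V. \<bar>D I J (\<pi> I) (\<pi> J)\<bar>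
        * \<bar>?\<Delta> \<pi> - ?\<Delta> (\<pi> \<circ> Transposition.transpose I J)\<bar>) / (4 * n)
      \<le> (\<Sum>s=2..d. sqrt (2 * real s * ?B s))"
    using n4 by (simp add: sum_distrib_left[symmetric] divide_le_eq mult.commute)
  have "perm_mean V (\<lambda>\<pi>. of_bool (\<bar>T \<pi> - z\<bar> \<le> \<bar>?\<Delta> \<pi>\<bar>))
      \<le> 2 * ((\<Sum>s=2..d. sqrt (?B s)) + (\<Sum>s=2..d. sqrt (2 * real s * ?B s))) + 892 * \<gamma> / n"
    by (rule order.trans[OF concentration[OF \<delta>]]) (intro add_right_mono mult_left_mono add_mono 1 2, simp)
  also have "2 * ((\<Sum>s=2..d. sqrt (?B s)) + (\<Sum>s=2..d. sqrt (2 * real s * ?B s)))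
      = (\<Sum>s=2..d. 2 * (sqrt (?B s) + sqrt (2 * real s * ?B s)))"
    by (simp only: sum.distrib[symmetric] sum_distrib_left)
  also have "\<dots> \<le> (\<Sum>s=2..d. 5 * (real d)\<^sup>2 * exp (real d) * fact (2 * d)
      * sqrt (tensor_beta n s (\<xi> s) / real n ^ s))"
    by (intro sum_mono stat_bound_coefficient) auto
  finally show ?thesis by (simp only: sum_distrib_left[symmetric] add.commute)
qed

theorem theorem2p2:
  fixes n d :: nat
    and \<xi> :: "nat \<Rightarrow> (nat \<Rightarrow> nat) \<Rightarrow> (nat \<Rightarrow> nat) \<Rightarrow> real"
    and C1 :: real
  assumes "n \<ge> 1" and "d \<ge> 1" and "n \<ge> 4 * d\<^sup>2"
    and "bolthausen_constant C1"
    and "\<And>s. s \<in> {1..d} \<Longrightarrow> hoeffding_tensor n s (\<xi> s)"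
    and "tensor_beta n 1 (\<xi> 1) = real n - 1"
  shows "kolmogorov_dist
      (distr (uniform_perm n) borel
        (\<lambda>\<pi>. \<Sum>s=1..d. \<Sum>i\<in>inj_tuples n s. \<xi> s i (compose {1..s} \<pi> i)))
      std_normal_distribution
    \<le> 2 ^ 18 * C1 / real n *
        (\<Sum>i=1..n. \<Sum>j=1..n. \<bar>\<xi> 1 (singleton_tuple i) (singleton_tuple j)\<bar> ^ 3)
      + (5 * (real d)\<^sup>2 * exp (real d) * fact (2 * d)) *
        (\<Sum>s=2..d. sqrt (tensor_beta n s (\<xi> s) / real n ^ s))"
proof -
  have "1 \<le> d\<^sup>2" using assms(2) by simp
  then have n4: "n \<ge> 4" using assms(3) by linarith
  have H1: "hoeffding_tensor n 1 (\<xi> 1)" using assms(2,5) by simp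
  interpret centered_matrix n "\<lambda>i j. \<xi> 1 (singleton_tuple i) (singleton_tuple j)"
    using n4 H1 assms(6) by (rule centered_matrix_tensor)
  define \<Delta> where "\<Delta> \<pi> = (\<Sum>s=2..d. tensor_stat n s (\<xi> s) \<pi>)" for \<pi>
  define W where "W \<pi> = (\<Sum>s=1..d. \<Sum>i\<in>inj_tuples n s. \<xi> s i (compose {1..s} \<pi> i))" for \<pi>
  let ?R = "5 * (real d)\<^sup>2 * exp (real d) * fact (2 * d) * (\<Sum>s=2..d. sqrt (tensor_beta n s (\<xi> s) / real n ^ s))"
  let ?N = std_normal_distribution
  have R0: "0 \<le> ?R" using tensor_beta_nonneg by (intro mult_nonneg_nonneg sum_nonneg) auto
  have C1: "C1 \<ge> 1" using assms(4) by (simp add: bolthausen_constant_def)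
  have W: "W \<pi> = T \<pi> + \<Delta> \<pi>" for \<pi>
  proof -
    have "W \<pi> = (\<Sum>s=1..d. tensor_stat n s (\<xi> s) \<pi>)" by (simp add: W_def tensor_stat_def)
    also have "\<dots> = tensor_stat n 1 (\<xi> 1) \<pi> + \<Delta> \<pi>"
      using assms(2) unfolding \<Delta>_def by (subst sum.atLeast_Suc_atMost) (auto simp: numeral_2_eq_2)
    finally show ?thesis unfolding tensor_stat_one T_def .
  qed
  have N: "prob_space ?N" by (simp add: prob_space_normal_density)
  have P: "prob_space (distr (uniform_perm n) borel f)" for f :: "(nat \<Rightarrow> nat) \<Rightarrow> real"
    by (intro prob_space.prob_space_distr prob_space_measure_pmf) simp
  have "kolmogorov_dist (distr (uniform_perm n) borel T) ?N \<le> C1 / real n * \<gamma>"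
    using assms(4) H1 n4 norm unfolding bolthausen_constant_def T_def[abs_def] \<gamma>_def by simp
  then have CLT: "\<bar>cdf (distr (uniform_perm n) borel T) z - cdf ?N z\<bar> \<le> C1 / real n * \<gamma>" for z
    using kolmogorov_dist_ge[OF P N] order.trans by blast
  \<comment> \<open>The events \<open>W \<le> z\<close> and \<open>T \<le> z\<close> differ only if
    \<open>z\<close> separates \<open>T\<close> from \<open>T + \<Delta>\<close>.\<close>
  have near: "\<bar>cdf (distr (uniform_perm n) borel W) z - cdf (distr (uniform_perm n) borel T) z\<bar>
      \<le> perm_mean V (\<lambda>\<pi>. of_bool (\<bar>T \<pi> - z\<bar> \<le> \<bar>\<Delta> \<pi>\<bar>))" for z
    unfolding cdf_uniform_perm
  proof (rule perm_mean_abs_diff_le)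
    fix \<pi>
    show "\<bar>of_bool (W \<pi> \<le> z) - of_bool (T \<pi> \<le> z)\<bar> \<le> (of_bool (\<bar>T \<pi> - z\<bar> \<le> \<bar>\<Delta> \<pi>\<bar>) :: real)"
      unfolding W by (cases "T \<pi> + \<Delta> \<pi> \<le> z"; cases "T \<pi> \<le> z") auto
  qed
  have "\<bar>cdf (distr (uniform_perm n) borel W) z - cdf ?N z\<bar> \<le> 2 ^ 18 * C1 / real n * \<gamma> + ?R" for z
  proof (cases "\<delta> \<le> 1")
    case True
    have "perm_mean V (\<lambda>\<pi>. of_bool (\<bar>T \<pi> - z\<bar> \<le> \<bar>\<Delta> \<pi>\<bar>)) \<le> 892 * \<gamma> / n + ?R"
      unfolding \<Delta>_def using assms(3) True by (intro perturbation_bound assms(5)) auto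
    moreover have "C1 / real n * \<gamma> + 892 * \<gamma> / n \<le> 2 ^ 18 * C1 / real n * \<gamma>"
    proof -
      have "C1 / real n * \<gamma> + 892 * \<gamma> / n = (C1 + 892) * (\<gamma> / n)"
        by (simp add: distrib_right add_divide_distrib)
      \<comment> \<open>\<open>C1 \<ge> 1\<close> absorbs the additive 892 into a multiple of
        \<open>C1\<close>.\<close>
      also have "\<dots> \<le> 2 ^ 18 * C1 * (\<gamma> / n)"
        using C1 gamma_pos by (intro mult_right_mono) auto
      also have "\<dots> = 2 ^ 18 * C1 / real n * \<gamma>" by simp
      finally show ?thesis .
    qed
    ultimately show ?thesis using near[of z] CLT[of z] by linarith
  next
    case False
    \<comment> \<open>Here the cubic term alone is at least 1, which bounds any difference of two
      distribution functions.\<close>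
    then have "1 \<le> 32 * (\<gamma> / n)" unfolding \<delta>_def by simp
    also have "\<dots> \<le> 2 ^ 18 * C1 * (\<gamma> / n)"
      using C1 gamma_pos by (intro mult_right_mono) auto
    finally have "1 \<le> 2 ^ 18 * C1 / real n * \<gamma>" by simp
    with cdf_diff_le_one[OF P N] R0 show ?thesis by (meson add_increasing2 order.trans)
  qed
  then have "kolmogorov_dist (distr (uniform_perm n) borel W) ?N \<le> 2 ^ 18 * C1 / real n * \<gamma> + ?R"
    unfolding kolmogorov_dist_def by (intro cSUP_least) auto
  then show ?thesis unfolding W_def[abs_def] \<gamma>_def .
qed

end
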